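(* Let $q\ge3$ be an integer, and let $\chi$ be a quadratic Dirichlet character modulo $q$ (not necessarily primitive). If $\beta>0$ is a real number for which $L(\beta,\chi)=0$, then $$\beta\le1-\frac{40}{\sqrt q\,(\log q)^2}.$$
   Context: $L(s,\chi)$ denotes the Dirichlet $L$-function of $\chi$ (analytic continuation of $\sum_{n\ge1}\chi(n)n^{-s}$). $\log$ is the natural logarithm. *)

theory Defs
  imports "HOL-Complex_Analysis.Complex_Analysis"
begin

definition dirichlet_character :: "nat \<Rightarrow> (int \<Rightarrow> complex) \<Rightarrow> bool" where
  "dirichlet_character q chi \<longleftrightarrow>
     (\<forall>a. chi (a + int q) = chi a) \<and>
     (\<forall>a b. chi (a * b) = chi a * chi b) \<and>
     (\<forall>a. chi a \<noteq> 0 \<longleftrightarrow> coprime a (int q))"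

definition principal_character :: "nat \<Rightarrow> int \<Rightarrow> complex" where
  "principal_character q a = (if coprime a (int q) then 1 else 0)"

(* Order exactly 2 in the group of characters modulo q: the principal character is excluded. *)
definition quadratic_character :: "nat \<Rightarrow> (int \<Rightarrow> complex) \<Rightarrow> bool" where
  "quadratic_character q chi \<longleftrightarrow>
     dirichlet_character q chi \<and> chi \<noteq> principal_character q \<and>
     (\<lambda>a. (chi a)\<^sup>2) = principal_character q"

definition dirichlet_series :: "(int \<Rightarrow> complex) \<Rightarrow> complex \<Rightarrow> complex" where
  "dirichlet_series chi s = (\<Sum>n. chi (int (Suc n)) * of_nat (Suc n) powr (- s))"

(* The continuation is taken to the whole plane; nicely_meromorphic_on makes it continuous away
   from its poles and gives it the value 0 at a pole. So for the principal character
   L(1) = 0 by convention; for every other character the continuation is entire. *)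
definition dirichlet_L :: "(int \<Rightarrow> complex) \<Rightarrow> complex \<Rightarrow> complex" where
  "dirichlet_L chi =
     (THE f. f nicely_meromorphic_on UNIV \<and> (\<forall>s. Re s > 1 \<longrightarrow> f s = dirichlet_series chi s))"

lemma nicely_meromorphic_eqI:
  assumes f: "f nicely_meromorphic_on UNIV" and g: "g nicely_meromorphic_on UNIV"
    and eq: "\<And>s. Re s > 1 \<Longrightarrow> f s = g s"
  shows "f = g"
proof
  fix z
  let ?d = "\<lambda>z. f z - g z"
  have mero: "?d meromorphic_on UNIV"
    using f g by (auto simp: nicely_meromorphic_on_def intro!: meromorphic_intros)
  have "eventually (\<lambda>s. s \<in> {s. Re s > 1}) (nhds (2::complex))"
    by (intro eventually_nhds_in_open) (auto simp: open_halfspace_Re_gt)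
  then have "eventually (\<lambda>s. ?d s = 0) (at 2)"
    unfolding eventually_at_filter by eventually_elim (use eq in auto)
  moreover have "eventually (\<lambda>s. ?d s \<noteq> 0) (at 2)" if "\<forall>\<^sub>\<approx>s\<in>UNIV. ?d s \<noteq> 0"
    using that by (simp add: eventually_cosparse_open_eq)
  ultimately have "\<not> (\<forall>\<^sub>\<approx>s\<in>UNIV. ?d s \<noteq> 0)"
    using eventually_conj[of "\<lambda>s. ?d s = 0" "at 2" "\<lambda>s. ?d s \<noteq> 0"] by auto
  then have "\<forall>\<^sub>\<approx>s\<in>UNIV. ?d s = 0"
    using meromorphic_imp_constant_or_avoid[OF mero, of 0] by auto
  then have ev: "eventually (\<lambda>s. f s = g s) (at z)"
    by (simp add: eventually_cosparse_open_eq)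
  have pole: "is_pole f z \<longleftrightarrow> is_pole g z"
    by (rule is_pole_cong) (use ev in auto)
  show "f z = g z"
  proof (cases "is_pole f z")
    case True
    then show ?thesis
      using pole is_pole_zero_at_nicely_mero[OF f] is_pole_zero_at_nicely_mero[OF g] by auto
  next
    case False
    then have "f \<midarrow>z\<rightarrow> f z" "g \<midarrow>z\<rightarrow> g z"
      using f g pole by (auto simp: nicely_meromorphic_on_def)
    moreover from this have "f \<midarrow>z\<rightarrow> g z"
      using tendsto_cong[OF ev] by auto
    ultimately show ?thesis
      using LIM_unique by blast
  qed
qed

lemma dirichlet_L_eqI:
  assumes "f nicely_meromorphic_on UNIV"
    and "\<And>s. Re s > 1 \<Longrightarrow> f s = dirichlet_series chi s"
  shows "dirichlet_L chi = f"
  unfolding dirichlet_L_def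
  by (rule the_equality) (use assms in \<open>auto intro!: nicely_meromorphic_eqI\<close>)

end

theory Submission
  imports Defs "HOL-Probability.Probability" "HOL-Number_Theory.Number_Theory"
    "HOL-Computational_Algebra.Squarefree"
begin

text \<open>For primitive \<open>\<chi>\<close>, let \<open>S\<close> be the multiplicative convolution, in logarithmic coordinates,
  of the theta series \<open>\<psi>\<close> of \<open>\<zeta>\<close> and the theta series of \<open>\<chi>\<close>. The functional equations of the two series give
  \<open>S(-u) = e\<^sup>u S(u) + c\<^sub>0 (e\<^sup>u - 1)\<close> with \<open>c\<^sub>0\<close> a positive multiple of \<open>L(1,\<chi>)\<close>.
  The Mellin transform of \<open>S\<close> has a factor \<open>L(s,\<chi>)\<close>, so a zero \<open>\<beta> < 1\<close> forces
  \<open>c\<^sub>0 \<le> 2 \<beta>(1 - \<beta>) \<integral> S(u) e\<^sup>u du\<close> over \<open>u > 0\<close>.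
  The coefficients of \<open>\<zeta>(s) L(s,\<chi>)\<close>, grouped by square divisors, are nonnegative, and express \<open>S(u)\<close> as a
  nonnegative combination of values \<open>\<psi>(2 a e\<^sup>u cosh x / \<surd>q)\<close>. If \<open>\<beta>\<close> exceeds the bound, an elementary inequality
  for \<open>\<psi>\<close> at these points yields
  \<open>c\<^sub>0 = S(-ln 2) - 2 S(ln 2) \<ge> 2.02 \<beta>(1 - \<beta>) \<integral> S(u) e\<^sup>u du\<close>, a contradiction.
  The exact functional equation of the theta series of \<open>\<chi>\<close> rests on the sign of the Gauss sum of \<open>\<chi>\<close>, which is
  derived from Dirichlet's evaluation of \<open>\<Sum> exp(2\<pi>in\<^sup>2/N)\<close> by Fourier series.\<close>

section \<open>Fourier series and Poisson summation\<close>

text \<open>The choice \<open>u = ln 2\<close> does two things at once. There the functional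
  equation becomes \<open>S (- u) - 2 * S u = c0\<close>, and in the expansion of \<open>S\<close>
  it produces \<open>psi (x / 2) - 2 * psi (2 * x)\<close>, in which the leading terms of size
  \<open>1 / sqrt x\<close> cancel and 1/2 survives as x tends to 0. Small x is the critical range,
  and it is under control because grouping by square divisors has summed the kernels into a full
  theta series with its own functional equation. The margin 12/25 is 1/2 less a tail of at most
  1/50. The largest value of 1/x is \<open>Y = sqrt q / 2\<close>, and
  \<open>Y * (ln (2 * Y))\<^sup>2\<close> is one eighth of \<open>sqrt q * (ln q)\<^sup>2\<close>,
  so 40 becomes the 5 of the final numerical inequality; 2.02 is a value above 2 that this
  inequality still tolerates. The sign of the Gauss sum matters: the opposite sign would reverse the
  functional equation of the theta series of the character and destroy the relation between
  \<open>S (- u)\<close> and \<open>S u\<close>. Even and odd characters are treated together by a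
  weight inside the theta kernel and a measure that is Lebesgue measure or a unit mass at 0.\<close>

definition unit_exp :: "real \<Rightarrow> complex" where
  "unit_exp x = cis (2 * pi * x)"

lemma unit_exp_0 [simp]: "unit_exp 0 = 1"
  by (simp add: unit_exp_def)

lemma norm_unit_exp [simp]: "norm (unit_exp x) = 1"
  by (simp add: unit_exp_def)

lemma unit_exp_add: "unit_exp (x + y) = unit_exp x * unit_exp y"
  by (simp add: unit_exp_def cis_mult distrib_left)

lemma unit_exp_minus: "unit_exp (- x) = cnj (unit_exp x)"
  by (simp add: unit_exp_def cis_cnj)

lemma unit_exp_of_int [simp]: "unit_exp (of_int k) = 1"
  by (simp add: unit_exp_def complex_eq_iff cos_int_2pin sin_int_2pin)

lemma unit_exp_of_nat [simp]: "unit_exp (of_nat k) = 1"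
  using unit_exp_of_int[of "int k"] by simp

lemma unit_exp_1 [simp]: "unit_exp 1 = 1"
  using unit_exp_of_nat[of 1] by simp

lemma unit_exp_add_int [simp]: "unit_exp (x + of_int k) = unit_exp x"
  by (simp add: unit_exp_add)

lemma unit_exp_conv_exp: "unit_exp x = exp (2 * pi * \<i> * x)"
  by (simp add: unit_exp_def cis_conv_exp mult_ac)

lemma unit_exp_power: "unit_exp x ^ n = unit_exp (of_nat n * x)"
  by (simp add: unit_exp_def Complex.DeMoivre mult_ac)

lemma continuous_on_unit_exp [continuous_intros]:
  "continuous_on S f \<Longrightarrow> continuous_on S (\<lambda>x. unit_exp (f x))"
  unfolding unit_exp_def by (intro continuous_intros)

lemma has_vector_derivative_unit_exp:
  "((\<lambda>x. unit_exp (a * x)) has_vector_derivative (2 * pi * \<i> * a * unit_exp (a * x))) (at x within S)"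
proof -
  have "((\<lambda>z. exp (2 * pi * \<i> * a * z)) has_field_derivative
          (2 * pi * \<i> * a * exp (2 * pi * \<i> * a * of_real x))) (at (of_real x))"
    by (auto intro!: derivative_eq_intros)
  hence "((\<lambda>x. exp (2 * pi * \<i> * a * of_real x)) has_vector_derivative
          (2 * pi * \<i> * a * exp (2 * pi * \<i> * a * of_real x))) (at x within S)"
    by (rule has_vector_derivative_real_field)
  thus ?thesis by (simp add: unit_exp_conv_exp mult_ac)
qed

lemma integral_unit_exp:
  "integral {0..1} (\<lambda>x. unit_exp (of_int k * x)) = (if k = 0 then 1 else 0)"
proof (cases "k = 0")
  case False
  let ?c = "2 * pi * \<i> * of_int k :: complex"
  have c: "?c \<noteq> 0" using False by auto
  have "((\<lambda>x. ?c * unit_exp (of_int k * x)) has_integral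
          (unit_exp (of_int k * 1) - unit_exp (of_int k * 0))) {0..1}"
    by (intro fundamental_theorem_of_calculus)
       (use has_vector_derivative_unit_exp[of "of_int k"] in auto)
  hence "((\<lambda>x. ?c * unit_exp (of_int k * x)) has_integral 0) {0..1}" by simp
  hence "((\<lambda>x. (1 / ?c) * (?c * unit_exp (of_int k * x))) has_integral (1 / ?c) * 0) {0..1}"
    by (rule has_integral_mult_right)
  thus ?thesis using c False by (simp add: integral_unique)
qed auto

text \<open>The class of continuous functions all of whose products with functions having vanishing
  Fourier coefficients again have vanishing Fourier coefficients is a ring containing
  sine and cosine; so the Stone--Weierstrass theorem applies to it.\<close>

definition fourier_null :: "(real \<Rightarrow> complex) \<Rightarrow> bool" where
  "fourier_null F \<longleftrightarrow> continuous_on {0..1} F \<and>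
     (\<forall>k::int. integral {0..1} (\<lambda>x. F x * unit_exp (of_int k * x)) = 0)"

lemma fourier_null_add:
  assumes "fourier_null F" "fourier_null G"
  shows "fourier_null (\<lambda>x. F x + G x)"
proof -
  have "integral {0..1} (\<lambda>x. (F x + G x) * unit_exp (of_int k * x)) = 0" for k
    using assms unfolding fourier_null_def
    by (subst distrib_right, subst integral_add)
       (auto intro!: integrable_continuous_interval continuous_intros)
  thus ?thesis using assms by (auto simp: fourier_null_def intro!: continuous_intros)
qed

lemma fourier_null_cmult:
  assumes "fourier_null F"
  shows "fourier_null (\<lambda>x. F x * c)"
proof -
  have "integral {0..1} (\<lambda>x. (F x * c) * unit_exp (of_int k * x)) = 0" for k
  proof -
    have "(\<lambda>x. (F x * c) * unit_exp (of_int k * x)) = (\<lambda>x. (F x * unit_exp (of_int k * x)) * c)"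
      by (simp add: mult_ac)
    thus ?thesis using assms by (simp add: fourier_null_def)
  qed
  thus ?thesis using assms by (auto simp: fourier_null_def intro!: continuous_intros)
qed

lemma fourier_null_unit_exp:
  assumes "fourier_null F"
  shows "fourier_null (\<lambda>x. F x * unit_exp (of_int m * x))"
proof -
  have "integral {0..1} (\<lambda>x. (F x * unit_exp (of_int m * x)) * unit_exp (of_int k * x)) = 0" for k
  proof -
    have "(\<lambda>x. (F x * unit_exp (of_int m * x)) * unit_exp (of_int k * x)) =
          (\<lambda>x. F x * unit_exp (of_int (m + k) * x))"
      by (simp add: unit_exp_add distrib_right mult.assoc mult.commute[of "unit_exp (of_int m * _)"])
    thus ?thesis using assms by (simp only: fourier_null_def)
  qed
  thus ?thesis using assms by (auto simp: fourier_null_def intro!: continuous_intros)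
qed

text \<open>Generalising over \<open>F\<close> in the induction turns the product case into two
  successive applications of the hypotheses.\<close>

lemma fourier_null_real_polynomial:
  fixes g :: "complex \<Rightarrow> real"
  assumes "real_polynomial_function g" "fourier_null F"
  shows "fourier_null (\<lambda>x. F x * of_real (g (unit_exp x)))"
  using assms
proof (induction g arbitrary: F rule: real_polynomial_function.induct)
  case (linear f)
  interpret f: bounded_linear f by fact
  \<comment> \<open>A real-linear form on the complex plane is a combination of z and its conjugate,
    so on the unit circle only the frequencies 1 and -1 occur.\<close>
  have *: "of_real (f (unit_exp x)) =
      unit_exp (of_int 1 * x) * ((f 1 - \<i> * f \<i>) / 2) + unit_exp (of_int (-1) * x) * ((f 1 + \<i> * f \<i>) / 2)" for x
  proof -
    have "unit_exp x = Re (unit_exp x) *\<^sub>R 1 + Im (unit_exp x) *\<^sub>R \<i>"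
      by (simp add: complex_eq_iff)
    hence "f (unit_exp x) = Re (unit_exp x) *\<^sub>R f 1 + Im (unit_exp x) *\<^sub>R f \<i>"
      by (metis f.add f.scaleR)
    thus ?thesis
      by (simp add: unit_exp_minus complex_eq_iff field_simps)
  qed
  have "fourier_null (\<lambda>x. F x * unit_exp (of_int 1 * x) * ((f 1 - \<i> * f \<i>) / 2) +
           F x * unit_exp (of_int (-1) * x) * ((f 1 + \<i> * f \<i>) / 2))"
    by (intro fourier_null_add fourier_null_cmult fourier_null_unit_exp linear)
  thus ?case
    unfolding * by (simp only: distrib_left mult.assoc)
next
  case (const c)
  thus ?case by (intro fourier_null_cmult)
next
  case (add f g)
  have "fourier_null (\<lambda>x. F x * of_real (f (unit_exp x)) + F x * of_real (g (unit_exp x)))"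
    by (intro fourier_null_add add)
  thus ?case by (simp add: distrib_left)
next
  case (mult f g)
  have "fourier_null (\<lambda>x. (F x * of_real (f (unit_exp x))) * of_real (g (unit_exp x)))"
    by (intro mult)
  thus ?case by (simp add: mult.assoc)
qed

text \<open>A continuous periodic \<open>g\<close> is a continuous function on the circle, hence a
  uniform limit of real polynomials in the coordinates of \<open>unit_exp x\<close>; the integral
  against each such polynomial vanishes.\<close>

lemma fourier_null_real_unique:
  fixes g :: "real \<Rightarrow> real"
  assumes F: "fourier_null F" and g: "continuous_on {0..1} g" "g 0 = g 1"
  shows "integral {0..1} (\<lambda>x. F x * of_real (g x)) = 0"
proof -
  have Fc: "continuous_on {0..1} F" using F by (simp add: fourier_null_def)
  define h where "h = g \<circ> (\<lambda>z. Arg2pi z / (2*pi))"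
  \<comment> \<open>The constant homotopy of the loop \<open>g\<close> is used only to obtain
    continuity of \<open>h\<close> on the circle, including the point 1 where the ends of the
    interval are glued.\<close>
  have "homotopic_loops (g ` {0..1}) g g"
    using g by (simp add: homotopic_loops_refl path_def path_image_def pathstart_def pathfinish_def)
  then have hom: "homotopic_with_canon (\<lambda>h. True) (sphere 0 1) (g ` {0..1}) h h"
    unfolding h_def by (rule homotopic_loops_imp_homotopic_circlemaps)
  hence conth: "continuous_on (sphere 0 1) h"
    using homotopic_with_imp_continuous by blast
  have hg: "h (unit_exp x) = g x" if "x \<in> {0..1}" for x
  proof (cases "x = 1")
    case True
    then show ?thesis using g by (simp add: h_def Arg2pi_of_real[of 1, simplified])
  next
    case False
    hence "Arg2pi (exp (\<i> * (2 * of_real pi * of_real x))) / (2*pi) = x"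
      using that by (auto simp: Arg2pi_exp field_split_simps)
    thus ?thesis by (simp add: h_def unit_exp_conv_exp mult_ac)
  qed
  obtain B where B: "\<And>x. x \<in> {0..1} \<Longrightarrow> norm (F x) \<le> B"
    using compact_continuous_image[OF Fc] compact_imp_bounded
    by (metis bounded_iff compact_Icc imageI)
  have "norm (F 0) \<le> B" using B by simp
  hence B0: "B \<ge> 0" using norm_ge_zero order_trans by blast
  let ?I = "integral {0..1} (\<lambda>x. F x * of_real (g x))"
  have "norm ?I \<le> e * B" if e: "e > 0" for e
  proof -
    obtain p where p: "real_polynomial_function p" "\<And>z. z \<in> sphere 0 1 \<Longrightarrow> \<bar>h z - p z\<bar> < e"
      using Stone_Weierstrass_real_polynomial_function[OF compact_sphere conth e] by blast
    have "fourier_null (\<lambda>x. F x * of_real (p (unit_exp x)))"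
      by (rule fourier_null_real_polynomial[OF p(1) F])
    hence pc: "continuous_on {0..1} (\<lambda>x. F x * of_real (p (unit_exp x)))"
      and "integral {0..1} (\<lambda>x. F x * of_real (p (unit_exp x)) * unit_exp (of_int 0 * x)) = 0"
      unfolding fourier_null_def by blast+
    hence p0: "integral {0..1} (\<lambda>x. F x * of_real (p (unit_exp x))) = 0" by simp
    have gc: "continuous_on {0..1} (\<lambda>x. F x * of_real (g x))"
      by (intro continuous_intros Fc g)
    have "?I = integral {0..1} (\<lambda>x. F x * of_real (g x) - F x * of_real (p (unit_exp x)))"
      by (subst integral_diff) (use gc pc p0 in \<open>auto intro: integrable_continuous_interval\<close>)
    also have "norm \<dots> \<le> e * B * (1 - 0)"
    proof (rule integral_bound)
      fix t :: real assume t: "t \<in> {0..1}"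
      have "\<bar>h (unit_exp t) - p (unit_exp t)\<bar> < e" by (intro p) simp
      hence e': "\<bar>g t - p (unit_exp t)\<bar> < e" using hg[OF t] by simp
      have "norm (F t * of_real (g t) - F t * of_real (p (unit_exp t))) =
            norm (F t) * \<bar>g t - p (unit_exp t)\<bar>"
        by (simp flip: right_diff_distrib of_real_diff add: norm_mult)
      also have "\<dots> \<le> B * e"
        using e' B[OF t] B0 by (intro mult_mono) auto
      finally show "norm (F t * of_real (g t) - F t * of_real (p (unit_exp t))) \<le> e * B"
        by (simp add: mult.commute)
    qed (auto intro!: continuous_intros gc pc)
    finally show ?thesis by simp
  qed
  hence *: "norm ?I \<le> e * B" if "e > 0" for e using that by blast
  have "norm ?I \<le> 0 + e" if "e > 0" for e
  proof -
    \<comment> \<open>Dividing by \<open>B + 1\<close> instead of \<open>B\<close> covers the case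
      \<open>B = 0\<close>.\<close>
    have "e / (B + 1) > 0" using that B0 by simp
    hence "norm ?I \<le> e / (B + 1) * B" by (rule *)
    also have "\<dots> \<le> e" using that B0 by (simp add: field_simps)
    finally show ?thesis by simp
  qed
  hence "norm ?I \<le> 0" by (rule field_le_epsilon)
  thus ?thesis by simp
qed

text \<open>Testing \<open>F\<close> against its own real and imaginary parts, both admissible
  periodic functions, makes the integral of the squared modulus vanish.\<close>

lemma fourier_null_imp_zero:
  assumes F: "fourier_null F" "F 0 = F 1" and x: "x \<in> {0..1}"
  shows "F x = 0"
proof -
  have c: "continuous_on {0..1} F" using F by (simp add: fourier_null_def)
  have R: "integral {0..1} (\<lambda>x. F x * of_real (Re (F x))) = 0"
    by (rule fourier_null_real_unique) (use F in \<open>auto intro!: continuous_intros c\<close>)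
  have I: "integral {0..1} (\<lambda>x. F x * of_real (Im (F x))) = 0"
    by (rule fourier_null_real_unique) (use F in \<open>auto intro!: continuous_intros c\<close>)
  have "integral {0..1} (\<lambda>x. Re (F x * of_real (Re (F x)))) = 0"
    using R integral_linear[OF _ bounded_linear_Re, of "\<lambda>x. F x * of_real (Re (F x))" "{0..1}"]
    by (simp add: o_def integrable_continuous_interval continuous_intros c)
  moreover have "integral {0..1} (\<lambda>x. Im (F x * of_real (Im (F x)))) = 0"
    using I integral_linear[OF _ bounded_linear_Im, of "\<lambda>x. F x * of_real (Im (F x))" "{0..1}"]
    by (simp add: o_def integrable_continuous_interval continuous_intros c)
  ultimately have "integral {0..1} (\<lambda>x. (Re (F x))\<^sup>2 + (Im (F x))\<^sup>2) = 0"
    by (subst integral_add)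
       (auto intro!: integrable_continuous_interval continuous_intros c simp: power2_eq_square)
  hence "(Re (F x))\<^sup>2 + (Im (F x))\<^sup>2 = 0"
    by (subst (asm) integral_eq_0_iff) (use x in \<open>auto intro!: continuous_intros c\<close>)
  thus ?thesis by (simp add: complex_eq_iff sum_power2_eq_zero_iff)
qed

text \<open>Absolute summability makes the series converge uniformly to a continuous
  \<open>H\<close>. Termwise integration shows that \<open>H\<close> has the coefficients of
  \<open>F\<close>, so \<open>F - H\<close> is Fourier-null and vanishes.\<close>

theorem fourier_series_has_sum:
  fixes F :: "real \<Rightarrow> complex" and c :: "int \<Rightarrow> complex"
  assumes F: "continuous_on {0..1} F" "F 0 = F 1"
    and c: "\<And>k. ((\<lambda>x. F x * unit_exp (- of_int k * x)) has_integral c k) {0..1}"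
    and summable: "(\<lambda>k. norm (c k)) summable_on UNIV" and x: "x \<in> {0..1}"
  shows "((\<lambda>k. c k * unit_exp (of_int k * x)) has_sum F x) UNIV"
proof -
  define H where "H = (\<lambda>x. \<Sum>\<^sub>\<infinity>k. c k * unit_exp (of_int k * x))"
  have ab: "(\<lambda>k. c k * unit_exp (of_int k * x)) summable_on UNIV" for x
    by (rule abs_summable_summable) (simp add: norm_mult summable)
  have lim: "uniform_limit {0..1} (\<lambda>K x. \<Sum>k\<in>K. c k * unit_exp (of_int k * x)) H
          (finite_subsets_at_top UNIV)"
    unfolding H_def by (rule Weierstrass_m_test_general) (auto simp: norm_mult summable)
  have Hc: "continuous_on {0..1} H"
    by (rule uniform_limit_theorem[OF _ lim]) (auto intro!: always_eventually continuous_intros)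
  have coeff: "integral {0..1} (\<lambda>x. H x * unit_exp (of_int (-m) * x)) = c m" for m
  proof -
    have "uniform_limit {0..1} (\<lambda>K x. (\<Sum>k\<in>K. c k * unit_exp (of_int k * x)) * unit_exp (of_int (-m) * x))
             (\<lambda>x. H x * unit_exp (of_int (-m) * x)) (finite_subsets_at_top UNIV)"
      by (intro uniform_lim_mult lim uniform_limit_const compact_imp_bounded[OF compact_continuous_image]
             Hc continuous_intros compact_Icc)
    then obtain I J where
      I: "\<And>K. ((\<lambda>x. (\<Sum>k\<in>K. c k * unit_exp (of_int k * x)) * unit_exp (of_int (-m) * x)) has_integral I K) {0..1}"
      and J: "((\<lambda>x. H x * unit_exp (of_int (-m) * x)) has_integral J) {0..1}"
      and IJ: "(I \<longlongrightarrow> J) (finite_subsets_at_top UNIV)"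
      by (rule uniform_limit_integral) (auto intro!: continuous_intros)
    have "I K = c m" if "finite K" "m \<in> K" for K
    proof -
      have "I K = integral {0..1} (\<lambda>x. \<Sum>k\<in>K. c k * unit_exp (of_int (k - m) * x))"
      proof -
        have "unit_exp (of_int (k - m) * x) = unit_exp (of_int k * x) * unit_exp (of_int (-m) * x)" for k x
          by (simp flip: unit_exp_add add: left_diff_distrib)
        hence "(\<lambda>x. \<Sum>k\<in>K. c k * unit_exp (of_int (k - m) * x)) =
               (\<lambda>x. (\<Sum>k\<in>K. c k * unit_exp (of_int k * x)) * unit_exp (of_int (-m) * x))"
          by (simp only: sum_distrib_right mult.assoc)
        thus ?thesis using I[of K] by (metis integral_unique)
      qed
      also have "\<dots> = (\<Sum>k\<in>K. integral {0..1} (\<lambda>x. c k * unit_exp (of_int (k - m) * x)))"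
        by (rule integral_sum) (auto intro!: integrable_continuous_interval continuous_intros that)
      also have "\<dots> = (\<Sum>k\<in>K. if k = m then c m else 0)"
        by (intro sum.cong refl)
           (simp only: integral_mult_right integral_unit_exp, simp)
      also have "\<dots> = c m" using that by simp
      finally show ?thesis .
    qed
    \<comment> \<open>By orthogonality the integral over a finite set of frequencies no longer
      changes once the set contains \<open>m\<close>.\<close>
    hence "eventually (\<lambda>K. I K = c m) (finite_subsets_at_top UNIV)"
      unfolding eventually_finite_subsets_at_top by (intro exI[of _ "{m}"]) auto
    hence "(I \<longlongrightarrow> c m) (finite_subsets_at_top UNIV)" by (rule tendsto_eventually)
    hence "J = c m" using IJ tendsto_unique[OF finite_subsets_at_top_neq_bot] by blast
    thus ?thesis using J by (simp add: integral_unique)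
  qed
  have "fourier_null (\<lambda>x. F x - H x)"
    unfolding fourier_null_def
  proof (intro conjI allI)
    fix k :: int
    have "integral {0..1} (\<lambda>x. F x * unit_exp (of_int k * x)) = c (-k)"
      using c[of "-k"] by (simp add: integral_unique)
    moreover have "integral {0..1} (\<lambda>x. H x * unit_exp (of_int k * x)) = c (-k)"
      using coeff[of "-k"] by simp
    ultimately show "integral {0..1} (\<lambda>x. (F x - H x) * unit_exp (of_int k * x)) = 0"
      by (subst left_diff_distrib, subst integral_diff)
         (auto intro!: integrable_continuous_interval continuous_intros F Hc)
  qed (intro continuous_intros F Hc)
  moreover have "F 0 - H 0 = F 1 - H 1"
    using F by (simp add: H_def)
  ultimately have "F x - H x = 0" using x by (rule fourier_null_imp_zero)
  thus ?thesis using ab by (simp add: H_def has_sum_infsum)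
qed

section \<open>Sums over the integers and Poisson summation\<close>

lemma summable_on_int_abs:
  fixes g :: "nat \<Rightarrow> real"
  assumes "summable g" "\<And>n. g n \<ge> 0"
  shows "(\<lambda>k::int. g (nat \<bar>k\<bar>)) summable_on UNIV"
proof -
  have g: "g summable_on UNIV"
    using assms by (intro norm_summable_imp_summable_on) simp
  have "(\<lambda>k::int. g (nat \<bar>k\<bar>)) summable_on range int"
    by (subst summable_on_reindex) (use g in \<open>auto simp: o_def\<close>)
  moreover have "(\<lambda>k::int. g (nat \<bar>k\<bar>)) summable_on range (\<lambda>n. - int n)"
    by (subst summable_on_reindex) (use g in \<open>auto simp: o_def inj_on_def\<close>)
  moreover have "UNIV = range int \<union> range (\<lambda>n. - int n)"
    by (auto simp: image_iff) (metis int_cases2)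
  ultimately show ?thesis by (metis summable_on_union)
qed

lemma has_sum_int_even:
  fixes f :: "int \<Rightarrow> 'a :: {real_normed_field, banach}"
  assumes f: "(f has_sum s) UNIV" and even: "\<And>k. f (- k) = f k"
  shows "((\<lambda>n. f (int (Suc n))) has_sum ((s - f 0) / 2)) UNIV"
proof -
  let ?P = "range (\<lambda>n. int (Suc n))" and ?N = "range (\<lambda>n. - int (Suc n))"
  have "f 0 = sum f {0}" by simp
  have "(f has_sum (s - f 0)) (UNIV - {0})"
    using has_sum_Diff[OF f has_sum_finite[of "{0}" f]] by simp
  moreover have U: "UNIV - {0::int} = ?P \<union> ?N"
  proof -
    have "x \<in> ?P \<union> ?N" if "x \<noteq> 0" for x :: int
    proof (cases "x > 0")
      case True
      hence "x = int (Suc (nat x - 1))" by simp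
      thus ?thesis by blast
    next
      case False
      hence "x = - int (Suc (nat (-x) - 1))" using that by simp
      thus ?thesis by blast
    qed
    thus ?thesis by auto
  qed
  ultimately have tot: "(f has_sum (s - f 0)) (?P \<union> ?N)" by simp
  have summ: "f summable_on ?P" "f summable_on ?N"
    using f by (meson has_sum_imp_summable subset_UNIV summable_on_subset_banach)+
  define a where "a = infsum f ?P"
  have P: "(f has_sum a) ?P" using summ unfolding a_def by simp
  hence P': "((\<lambda>n. f (int (Suc n))) has_sum a) UNIV"
    by (subst (asm) has_sum_reindex) (auto simp: o_def inj_on_def)
  have N: "(f has_sum a) ?N"
    by (subst has_sum_reindex) (use P' in \<open>auto simp: o_def inj_on_def even simp del: of_nat_Suc\<close>)
  have "(f has_sum (a + a)) (?P \<union> ?N)"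
    by (rule has_sum_Un_disjoint[OF P N]) auto
  hence "s - f 0 = a + a" using tot has_sum_unique by blast
  thus ?thesis using P' by (simp add: field_simps)
qed

text \<open>It reads an unordered sum over the integers along the sets \<open>{-N..<N}\<close>,
  whose half-open shape matches the tiling of the interval from -N to N by unit intervals.\<close>

lemma filterlim_int_intervals:
  "filterlim (\<lambda>N. {-int N..<int N}) (finite_subsets_at_top UNIV) sequentially"
  unfolding filterlim_finite_subsets_at_top
proof (intro allI impI)
  fix X :: "int set" assume X: "finite X \<and> X \<subseteq> UNIV"
  then obtain B where B: "\<And>x. x \<in> X \<Longrightarrow> \<bar>x\<bar> \<le> B"
    by (metis finite_int_iff_bounded_le abs_le_iff atLeastAtMost_iff image_subset_iff subsetD abs_ge_self imageI atMost_iff)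
  show "\<forall>\<^sub>F N in sequentially. finite {-int N..<int N} \<and> X \<subseteq> {-int N..<int N} \<and> {-int N..<int N} \<subseteq> UNIV"
    using eventually_gt_at_top[of "nat B"]
  proof eventually_elim
    case (elim N)
    have "\<bar>x\<bar> < int N" if "x \<in> X" for x using B[OF that] elim by linarith
    thus ?case by (auto simp: abs_less_iff less_eq_int_def[symmetric]) (smt (verit))+
  qed
qed

text \<open>The majorant \<open>M\<close> makes the periodisation of \<open>g\<close> continuous.
  Its Fourier coefficients unfold into integrals over growing symmetric intervals, so the transform
  \<open>gh\<close> is only asked for as the limit of such integrals.\<close>

lemma poisson_summation:
  fixes g :: "real \<Rightarrow> complex" and M :: "int \<Rightarrow> real" and gh :: "int \<Rightarrow> complex"
  assumes g: "continuous_on UNIV g"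
    and M: "M summable_on UNIV" "\<And>n x. x \<in> {0..1} \<Longrightarrow> norm (g (x + of_int n)) \<le> M n"
    and gh: "\<And>k. (\<lambda>N::nat. integral {-real N..real N} (\<lambda>x. g x * unit_exp (- of_int k * x))) \<longlonglongrightarrow> gh k"
    and sgh: "(\<lambda>k. norm (gh k)) summable_on UNIV" and x: "x \<in> {0..1}"
  shows "((\<lambda>k. gh k * unit_exp (of_int k * x)) has_sum (\<Sum>\<^sub>\<infinity>n. g (x + of_int n))) UNIV"
    and "(\<lambda>n. g (x + of_int n)) summable_on UNIV"
proof -
  have gc: "continuous_on S g" for S using g continuous_on_subset by blast
  have gcc: "continuous_on S (\<lambda>x. g (f x))" if "continuous_on S f" for S :: "real set" and f
    using continuous_on_compose2[OF g that] by simp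
  define F where "F = (\<lambda>x. \<Sum>\<^sub>\<infinity>n. g (x + of_int n))"
  have lim: "uniform_limit {0..1} (\<lambda>K x. \<Sum>n\<in>K. g (x + of_int n)) F (finite_subsets_at_top UNIV)"
    unfolding F_def by (rule Weierstrass_m_test_general) (auto intro: M)
  have Fc: "continuous_on {0..1} F"
    by (rule uniform_limit_theorem[OF _ lim]) (auto intro!: always_eventually continuous_intros gcc)
  have sm: "(\<lambda>n. g (x + of_int n)) summable_on UNIV" if "x \<in> {0..1}" for x
  proof (rule abs_summable_summable)
    show "(\<lambda>n. norm (g (x + of_int n))) summable_on UNIV"
      by (rule summable_on_comparison_test[OF M(1)]) (use M(2) that in auto)
  qed
  show "(\<lambda>n. g (x + of_int n)) summable_on UNIV" by (rule sm[OF x])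
  have F01: "F 0 = F 1"
  proof -
    have "F 1 = (\<Sum>\<^sub>\<infinity>n. g (of_int (n + 1)))" by (simp add: F_def add.commute)
    also have "\<dots> = (\<Sum>\<^sub>\<infinity>n\<in>range (\<lambda>n::int. n + 1). g (of_int n))"
      by (subst infsum_reindex) (auto simp: o_def inj_on_def)
    also have "range (\<lambda>n::int. n + 1) = UNIV" by (auto intro!: image_eqI[of _ _ "_ - 1"])
    finally show ?thesis by (simp add: F_def)
  qed
  have coeff: "((\<lambda>x. F x * unit_exp (- of_int k * x)) has_integral gh k) {0..1}" for k
  proof -
    have "uniform_limit {0..1} (\<lambda>K x. (\<Sum>n\<in>K. g (x + of_int n)) * unit_exp (- of_int k * x))
             (\<lambda>x. F x * unit_exp (- of_int k * x)) (finite_subsets_at_top UNIV)"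
      by (intro uniform_lim_mult lim uniform_limit_const compact_imp_bounded[OF compact_continuous_image]
             Fc continuous_intros compact_Icc)
    then obtain I J where
      I: "\<And>K. ((\<lambda>x. (\<Sum>n\<in>K. g (x + of_int n)) * unit_exp (- of_int k * x)) has_integral I K) {0..1}"
      and J: "((\<lambda>x. F x * unit_exp (- of_int k * x)) has_integral J) {0..1}"
      and IJ: "(I \<longlongrightarrow> J) (finite_subsets_at_top UNIV)"
      by (rule uniform_limit_integral) (auto intro!: continuous_intros gcc)
    let ?h = "\<lambda>x. g x * unit_exp (- of_int k * x)"
    have hc: "continuous_on S ?h" for S by (intro continuous_intros gc)
    have IK: "I {-int N..<int N} = integral {-real N..real N} ?h" for N
    proof -
      have "I {-int N..<int N} = integral {0..1} (\<lambda>x. \<Sum>n\<in>{-int N..<int N}. ?h (x + of_int n))"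
      proof -
        have "unit_exp (- of_int k * (x + of_int n)) = unit_exp (- of_int k * x)" for x n
          using unit_exp_add_int[of "- of_int k * x" "- k * n"] by (simp add: distrib_left)
        thus ?thesis using I[of "{-int N..<int N}"] by (simp add: integral_unique sum_distrib_right)
      qed
      also have "\<dots> = (\<Sum>n\<in>{-int N..<int N}. integral {0..1} (\<lambda>x. ?h (x + of_int n)))"
        by (rule integral_sum) (auto intro!: integrable_continuous_interval continuous_intros gcc)
      also have "\<dots> = (\<Sum>n\<in>{-int N..<int N}. integral {of_int n..of_int (n + 1)} ?h)"
      proof (rule sum.cong[OF refl])
        fix n
        show "integral {0..1} (\<lambda>x. ?h (x + of_int n)) = integral {of_int n..of_int (n + 1)} ?h"
          using integral_shift_Icc_real[of 0 1 ?h "of_int n"]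
          by (simp add: add.commute o_def)
      qed
      also have "\<dots> = integral {-real N..real N} ?h"
      proof -
        have "(\<Sum>n\<in>{-int N..<-int N + int m}. integral {of_int n..of_int (n + 1)} ?h) =
              integral {-real N..-real N + real m} ?h" for m
        proof (induction m)
          case (Suc m)
          have "{-int N..<-int N + int (Suc m)} = insert (-int N + int m) {-int N..<-int N + int m}"
            by auto
          moreover have "integral {-real N..-real N + real m} ?h + integral {-real N + real m..-real N + real (Suc m)} ?h
              = integral {-real N..-real N + real (Suc m)} ?h"
            by (rule Henstock_Kurzweil_Integration.integral_combine)
               (simp, simp, rule integrable_continuous_interval, rule hc)
          ultimately show ?case using Suc by (simp add: add_ac)
        qed auto
        from this[of "2 * N"] show ?thesis by simp
      qed
      finally show ?thesis .
    qed
    from filterlim_compose[OF IJ filterlim_int_intervals] have "(\<lambda>N. integral {-real N..real N} ?h) \<longlonglongrightarrow> J"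
      by (simp only: IK)
    hence "J = gh k" using gh[of k] LIMSEQ_unique by blast
    thus ?thesis using J by simp
  qed
  show "((\<lambda>k. gh k * unit_exp (of_int k * x)) has_sum (\<Sum>\<^sub>\<infinity>n. g (x + of_int n))) UNIV"
    using fourier_series_has_sum[OF Fc F01 coeff sgh x] by (simp add: F_def)
qed

section \<open>Fourier transforms of Gaussians and shifted theta series\<close>

lemma gaussian_fourier_lborel:
  assumes T: "T > 0"
  shows "has_bochner_integral lborel (\<lambda>x. of_real (exp (- pi * T * x\<^sup>2)) * unit_exp (- k * x))
           (of_real (exp (- pi * k\<^sup>2 / T) / sqrt T))"
proof -
  define s where "s = sqrt (2 * pi * T)"
  have s: "s > 0" "s\<^sup>2 = 2 * pi * T" using T by (simp_all add: s_def)
  define t where "t = - 2 * pi * k / s"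
  \<comment> \<open>The Gaussian transform is the characteristic function of the standard normal
    distribution, rescaled by \<open>s\<close> so that the exponent becomes
    \<open>- pi * T * x\<^sup>2\<close>.\<close>
  have "char std_normal_distribution t = (CLBINT x. std_normal_density x *\<^sub>R iexp (t * x))"
    unfolding char_def by (subst integral_density) (auto simp: normal_density_nonneg)
  hence "(CLBINT x. std_normal_density x *\<^sub>R iexp (t * x)) = of_real (exp (- (t\<^sup>2) / 2))"
    by (simp add: char_std_normal_distribution)
  moreover have "integrable lborel (\<lambda>x. std_normal_density x *\<^sub>R iexp (t * x))"
    by (rule Bochner_Integration.integrable_bound[of lborel std_normal_density])
       (auto simp: normal_density_nonneg)
  ultimately have "has_bochner_integral lborel (\<lambda>x. std_normal_density x *\<^sub>R iexp (t * x))
                     (of_real (exp (- (t\<^sup>2) / 2)))"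
    by (simp add: has_bochner_integral_iff)
  hence "has_bochner_integral lborel (\<lambda>x. std_normal_density (0 + s * x) *\<^sub>R iexp (t * (0 + s * x)))
                     (of_real (exp (- (t\<^sup>2) / 2)) /\<^sub>R \<bar>s\<bar>)"
    using s by (subst (asm) lborel_has_bochner_integral_real_affine_iff[where c = s and t = 0]) auto
  also have "(\<lambda>x. std_normal_density (0 + s * x) *\<^sub>R iexp (t * (0 + s * x))) =
             (\<lambda>x. (of_real (exp (- pi * T * x\<^sup>2)) * unit_exp (- k * x)) * of_real (1 / sqrt (2 * pi)))"
  proof
    fix x
    have "std_normal_density (s * x) = exp (- pi * T * x\<^sup>2) * (1 / sqrt (2 * pi))"
      by (simp add: std_normal_density_def power_mult_distrib s)
    moreover have "iexp (t * (s * x)) = unit_exp (- k * x)"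
      using s by (simp add: t_def unit_exp_conv_exp mult_ac)
    ultimately show "std_normal_density (0 + s * x) *\<^sub>R iexp (t * (0 + s * x)) =
       (of_real (exp (- pi * T * x\<^sup>2)) * unit_exp (- k * x)) * of_real (1 / sqrt (2 * pi))"
      by (simp add: scaleR_conv_of_real)
  qed
  finally have "has_bochner_integral lborel
     (\<lambda>x. (of_real (exp (- pi * T * x\<^sup>2)) * unit_exp (- k * x)) * of_real (1 / sqrt (2 * pi)) * of_real (sqrt (2 * pi)))
     (of_real (exp (- (t\<^sup>2) / 2)) /\<^sub>R \<bar>s\<bar> * of_real (sqrt (2 * pi)))"
    by (rule has_bochner_integral_mult_left)
  moreover have "(of_real (exp (- pi * T * x\<^sup>2)) * unit_exp (- k * x)) * of_real (1 / sqrt (2 * pi)) * of_real (sqrt (2 * pi))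
      = of_real (exp (- pi * T * x\<^sup>2)) * unit_exp (- k * x)" for x
    by (simp add: mult.assoc flip: of_real_mult)
  moreover have "(of_real (exp (- (t\<^sup>2) / 2)) /\<^sub>R \<bar>s\<bar> * of_real (sqrt (2 * pi)) :: complex) =
      of_real (exp (- pi * k\<^sup>2 / T) / sqrt T)"
  proof -
    have "t\<^sup>2 / 2 = pi * k\<^sup>2 / T"
      using T by (simp add: t_def power_divide s power_mult_distrib) (simp add: field_simps power2_eq_square)
    moreover have "sqrt (2 * pi) / s = 1 / sqrt T"
      using T by (simp add: s_def real_sqrt_mult)
    moreover have "exp (- (t\<^sup>2) / 2) / s * sqrt (2 * pi) = exp (- (t\<^sup>2 / 2)) * (sqrt (2 * pi) / s)"
      by simp
    ultimately have "exp (- (t\<^sup>2) / 2) / s * sqrt (2 * pi) = exp (- pi * k\<^sup>2 / T) / sqrt T"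
      by simp
    thus ?thesis using s by (simp add: scaleR_conv_of_real field_simps flip: of_real_mult of_real_divide)
  qed
  ultimately show ?thesis by simp
qed

lemma gaussian_fourier_limit:
  assumes T: "T > 0"
  shows "(\<lambda>N::nat. integral {-real N..real N} (\<lambda>x. of_real (exp (- pi * T * x\<^sup>2)) * unit_exp (- k * x)))
           \<longlonglongrightarrow> of_real (exp (- pi * k\<^sup>2 / T) / sqrt T)"
proof -
  let ?f = "\<lambda>x. of_real (exp (- pi * T * x\<^sup>2)) * unit_exp (- k * x) :: complex"
  have f: "integrable lborel ?f" "integral\<^sup>L lborel ?f = of_real (exp (- pi * k\<^sup>2 / T) / sqrt T)"
    using gaussian_fourier_lborel[OF T, of k] by (auto simp: has_bochner_integral_iff)
  have si: "set_integrable lborel {-real N..real N} ?f" for N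
    unfolding set_integrable_def by (rule integrable_mult_indicator) (use f in auto)
  have "(\<lambda>N::nat. integral\<^sup>L lborel (\<lambda>x. indicator {-real N..real N} x *\<^sub>R ?f x)) \<longlonglongrightarrow> integral\<^sup>L lborel ?f"
  proof (rule integral_dominated_convergence)
    show "integrable lborel (\<lambda>x. norm (?f x))" using f by simp
    show "AE x in lborel. (\<lambda>N. indicator {-real N..real N} x *\<^sub>R ?f x) \<longlonglongrightarrow> ?f x"
    proof (rule AE_I2, rule tendsto_eventually)
      fix x :: real
      show "eventually (\<lambda>N. indicator {-real N..real N} x *\<^sub>R ?f x = ?f x) sequentially"
        using eventually_ge_at_top[of "nat \<lceil>\<bar>x\<bar>\<rceil>"]
      proof eventually_elim
        case (elim N)
        hence "\<bar>x\<bar> \<le> real N" by linarith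
        thus ?case by (simp add: indicator_def abs_le_iff)
      qed
    qed
  qed (use f in \<open>auto simp: indicator_def\<close>)
  thus ?thesis
    using set_borel_integral_eq_integral(2)[OF si] f(2) unfolding set_lebesgue_integral_def by simp
qed

text \<open>The derivative of the oscillating Gaussian \<open>f\<close> is a combination of
  \<open>x * f x\<close> and \<open>f x\<close>. Integrating it gives the transform of
  \<open>x * f x\<close> from that of \<open>f\<close>, up to boundary terms that tend to 0.\<close>

lemma gaussian_linear_fourier_limit:
  assumes T: "T > 0"
  shows "(\<lambda>N::nat. integral {-real N..real N}
             (\<lambda>x. of_real (x * exp (- pi * T * x\<^sup>2)) * unit_exp (- k * x)))
           \<longlonglongrightarrow> - \<i> * of_real (k * exp (- pi * k\<^sup>2 / T) / (T * sqrt T))"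
proof -
  define f where "f = (\<lambda>x::real. of_real (exp (- pi * T * x\<^sup>2)) * unit_exp (- k * x) :: complex)"
  have fc: "continuous_on S f" for S unfolding f_def by (intro continuous_intros)
  have deriv: "(f has_vector_derivative
      (of_real (- 2 * pi * T * x) * f x - 2 * pi * \<i> * k * f x)) (at x within S)" for x S
  proof -
    have 1: "((\<lambda>x. exp (- pi * T * x\<^sup>2)) has_real_derivative
           (exp (- pi * T * x\<^sup>2) * (- 2 * pi * T * x))) (at x within S)"
      by (auto intro!: derivative_eq_intros)
    show ?thesis unfolding f_def
      by (rule has_vector_derivative_eq_rhs[OF has_vector_derivative_mult[OF
           has_vector_derivative_of_real[OF 1] has_vector_derivative_unit_exp]])
         (simp add: algebra_simps)
  qed
  have eq: "integral {-real N..real N} (\<lambda>x. of_real x * f x) =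
          - (1 / (2 * pi * T)) * (f (real N) - f (- real N))
          - (\<i> * k / T) * integral {-real N..real N} f" for N :: nat
  proof -
    have "((\<lambda>x. of_real (- 2 * pi * T * x) * f x - 2 * pi * \<i> * k * f x) has_integral
             (f (real N) - f (- real N))) {-real N..real N}"
      by (rule fundamental_theorem_of_calculus) (simp, rule deriv)
    hence "integral {-real N..real N} (\<lambda>x. (- 2 * pi * T) * (of_real x * f x) - (2 * pi * \<i> * k) * f x) =
          f (real N) - f (- real N)"
      by (simp add: integral_unique mult_ac)
    also have "integral {-real N..real N} (\<lambda>x. (- 2 * pi * T) * (of_real x * f x) - (2 * pi * \<i> * k) * f x) =
        (- 2 * pi * T) * integral {-real N..real N} (\<lambda>x. of_real x * f x) -
        (2 * pi * \<i> * k) * integral {-real N..real N} f"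
      by (subst integral_diff)
         (simp_all only: integral_mult_right, auto intro!: integrable_continuous_interval continuous_intros fc)
    finally show ?thesis using T by (simp add: field_simps)
  qed
  have f0: "(\<lambda>N. f (s * real N)) \<longlonglongrightarrow> 0" if "\<bar>s\<bar> = 1" for s :: real
  proof (rule tendsto_norm_zero_cancel)
    have "s\<^sup>2 = 1" using that by (metis one_power2 power2_abs)
    hence "(\<lambda>N. norm (f (s * real N))) = (\<lambda>N. exp (- pi * T * (real N)\<^sup>2))"
      by (simp add: f_def norm_mult power_mult_distrib)
    moreover have "(\<lambda>N. exp (- pi * T * (real N)\<^sup>2)) \<longlonglongrightarrow> 0"
      using T by real_asymp
    ultimately show "(\<lambda>N. norm (f (s * real N))) \<longlonglongrightarrow> 0" by simp
  qed
  have "(\<lambda>N. f (real N) - f (- real N)) \<longlonglongrightarrow> 0 - 0"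
    by (rule tendsto_diff) (use f0[of 1] f0[of "-1"] in simp_all)
  moreover have "(\<lambda>N::nat. integral {-real N..real N} f) \<longlonglongrightarrow> of_real (exp (- pi * k\<^sup>2 / T) / sqrt T)"
    using gaussian_fourier_limit[OF T, of k] unfolding f_def by simp
  ultimately have "(\<lambda>N. - (1 / (2 * pi * T)) * (f (real N) - f (- real N))
          - (\<i> * k / T) * integral {-real N..real N} f) \<longlonglongrightarrow>
        - (1 / (2 * pi * T)) * (0 - 0 :: complex) - (\<i> * k / T) * of_real (exp (- pi * k\<^sup>2 / T) / sqrt T)"
    by (rule tendsto_diff[OF tendsto_mult_left tendsto_mult_left])
  also have "(\<lambda>N. - (1 / (2 * pi * T)) * (f (real N) - f (- real N))
          - (\<i> * k / T) * integral {-real N..real N} f) =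
      (\<lambda>N::nat. integral {-real N..real N}
             (\<lambda>x. of_real (x * exp (- pi * T * x\<^sup>2)) * unit_exp (- k * x)))"
    by (simp only: eq [symmetric]) (simp add: f_def mult.assoc)
  finally show ?thesis by (simp add: mult_ac)
qed

lemma summable_exp_neg_square:
  assumes "c > 0"
  shows "summable (\<lambda>n::nat. exp (- c * real n ^ 2))"
proof (rule summable_comparison_test'[of "\<lambda>n. exp (- c) ^ n" 0])
  show "summable (\<lambda>n. exp (- c) ^ n)" using assms by (intro summable_geometric) simp
  fix n :: nat
  have "real n \<le> real n ^ 2"
    by (metis of_nat_le_iff of_nat_power power2_nat_le_imp_le le_square power2_eq_square)
  hence "c * real n \<le> c * real n ^ 2" using assms by (intro mult_left_mono) auto
  thus "norm (exp (- c * real n ^ 2)) \<le> exp (- c) ^ n"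
    by (simp add: mult_ac flip: exp_of_nat_mult)
qed

text \<open>A majorant uniform in the shift: \<open>(x + n)\<^sup>2 \<ge> n\<^sup>2 / 2 - 1\<close>
  for x between 0 and 1.\<close>

lemma gaussian_shift_bound:
  assumes T: "T > 0" and x: "x \<in> {0..1}"
  shows "exp (- pi * T * (x + of_int n)\<^sup>2) \<le> exp (pi * T) * exp (- (pi * T / 2) * real (nat \<bar>n\<bar>) ^ 2)"
proof -
  have "(of_int n :: real)\<^sup>2 \<le> 2 * (x + of_int n)\<^sup>2 + 2 * x\<^sup>2"
    using zero_le_power2[of "of_int n + 2 * x"] by (simp add: power2_eq_square algebra_simps)
  also have "x\<^sup>2 \<le> 1" using x by (simp add: power_le_one)
  finally have "(of_int n :: real)\<^sup>2 / 2 - 1 \<le> (x + of_int n)\<^sup>2" by simp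
  hence "pi * T * ((of_int n :: real)\<^sup>2 / 2 - 1) \<le> pi * T * (x + of_int n)\<^sup>2"
    using T by (intro mult_left_mono) auto
  thus ?thesis by (simp add: algebra_simps flip: exp_add)
qed

text \<open>Half of the exponent absorbs the linear factor, which reduces the convergence questions
  for odd characters to Gaussian ones with \<open>T / 2\<close>.\<close>

lemma linear_gaussian_bound:
  assumes T: "T > 0"
  shows "\<bar>y\<bar> * exp (- pi * T * y\<^sup>2) \<le> (1 + 1 / T) * exp (- pi * (T / 2) * y\<^sup>2)"
proof -
  have "\<bar>y\<bar> \<le> 1 + y\<^sup>2"
    using zero_le_power2[of "\<bar>y\<bar> - 1/2"] by (simp add: power2_eq_square algebra_simps)
  also have "\<dots> \<le> (1 + 1 / T) * (1 + T * y\<^sup>2)"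
    using T by (simp add: field_simps)
  also have "\<dots> \<le> (1 + 1 / T) * exp (pi * (T / 2) * y\<^sup>2)"
  proof (rule mult_left_mono)
    have "T * y\<^sup>2 \<le> pi * (T / 2) * y\<^sup>2"
      using T pi_gt3 mult_right_mono[of 2 pi "y\<^sup>2"] by simp
    thus "1 + T * y\<^sup>2 \<le> exp (pi * (T / 2) * y\<^sup>2)"
      by (meson add_left_mono dual_order.trans exp_ge_add_one_self)
  qed (use T in auto)
  finally have "\<bar>y\<bar> * exp (- pi * T * y\<^sup>2) \<le> (1 + 1 / T) * exp (pi * (T / 2) * y\<^sup>2) * exp (- pi * T * y\<^sup>2)"
    by (rule mult_right_mono) auto
  also have "\<dots> = (1 + 1 / T) * exp (pi * (T / 2) * y\<^sup>2 + - pi * T * y\<^sup>2)"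
    by (simp only: mult.assoc exp_add)
  also have "pi * (T / 2) * y\<^sup>2 + - pi * T * y\<^sup>2 = - pi * (T / 2) * y\<^sup>2" by (simp add: algebra_simps)
  finally show ?thesis .
qed

theorem theta_shift:
  assumes T: "T > 0" and x: "x \<in> {0..1}"
  shows "((\<lambda>k. of_real (exp (- pi * of_int k ^ 2 / T) / sqrt T) * unit_exp (of_int k * x)) has_sum
            (\<Sum>\<^sub>\<infinity>n::int. of_real (exp (- pi * T * (x + of_int n)\<^sup>2)))) UNIV"
    and "(\<lambda>n::int. of_real (exp (- pi * T * (x + of_int n)\<^sup>2)) :: complex) summable_on UNIV"
proof -
  define M where "M = (\<lambda>n::int. exp (pi * T) * exp (- (pi * T / 2) * real (nat \<bar>n\<bar>) ^ 2))"
  have M: "M summable_on UNIV"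
    unfolding M_def using T
    by (intro summable_on_cmult_right summable_on_int_abs[of "\<lambda>n. exp (- (pi * T / 2) * real n ^ 2)"]
          summable_exp_neg_square) auto
  have "(\<lambda>k::int. exp (- (pi / T) * real (nat \<bar>k\<bar>) ^ 2) * (1 / sqrt T)) summable_on UNIV"
    using T by (intro summable_on_cmult_left summable_on_int_abs[of "\<lambda>n. exp (- (pi / T) * real n ^ 2)"]
          summable_exp_neg_square) auto
  hence s: "(\<lambda>k::int. norm (of_real (exp (- pi * of_int k ^ 2 / T) / sqrt T) :: complex)) summable_on UNIV"
    using T by (simp del: of_real_divide)
  have bound: "norm (of_real (exp (- pi * T * (x + of_int n)\<^sup>2)) :: complex) \<le> M n"
    if "x \<in> {0..1}" for x n
    using gaussian_shift_bound[OF T that, of n] by (simp add: M_def)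
  note * = poisson_summation[where g = "\<lambda>x. of_real (exp (- pi * T * x\<^sup>2))" and M = M
       and gh = "\<lambda>k. of_real (exp (- pi * of_int k ^ 2 / T) / sqrt T)",
       OF _ M bound gaussian_fourier_limit[OF T] s x]
  show "((\<lambda>k. of_real (exp (- pi * of_int k ^ 2 / T) / sqrt T) * unit_exp (of_int k * x)) has_sum
            (\<Sum>\<^sub>\<infinity>n::int. of_real (exp (- pi * T * (x + of_int n)\<^sup>2)))) UNIV"
    "(\<lambda>n::int. of_real (exp (- pi * T * (x + of_int n)\<^sup>2)) :: complex) summable_on UNIV"
    by (rule *; auto intro!: continuous_intros)+
qed

text \<open>The version for odd characters, whose theta series carries an extra factor n. Its factor
  \<open>- \<i>\<close> is later cancelled by the \<open>\<i>\<close> in the Gauss sum of an odd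
  character.\<close>

theorem linear_theta_shift:
  assumes T: "T > 0" and x: "x \<in> {0..1}"
  shows "((\<lambda>k. - \<i> * of_real (of_int k * exp (- pi * of_int k ^ 2 / T) / (T * sqrt T)) * unit_exp (of_int k * x))
            has_sum (\<Sum>\<^sub>\<infinity>n::int. of_real ((x + of_int n) * exp (- pi * T * (x + of_int n)\<^sup>2)))) UNIV"
    and "(\<lambda>n::int. of_real ((x + of_int n) * exp (- pi * T * (x + of_int n)\<^sup>2)) :: complex) summable_on UNIV"
proof -
  define M where "M = (\<lambda>n::int. (1 + 1 / T) * (exp (pi * (T/2)) * exp (- (pi * (T / 2) / 2) * real (nat \<bar>n\<bar>) ^ 2)))"
  have M: "M summable_on UNIV"
    unfolding M_def using T
    by (intro summable_on_cmult_right summable_on_int_abs[of "\<lambda>n. exp (- (pi * (T / 2) / 2) * real n ^ 2)"]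
          summable_exp_neg_square) auto
  have bound: "norm (of_real ((x + of_int n) * exp (- pi * T * (x + of_int n)\<^sup>2)) :: complex) \<le> M n"
    if "x \<in> {0..1}" for x n
  proof -
    have "norm (of_real ((x + of_int n) * exp (- pi * T * (x + of_int n)\<^sup>2)) :: complex) =
          \<bar>x + of_int n\<bar> * exp (- pi * T * (x + of_int n)\<^sup>2)"
      by (simp only: norm_of_real abs_mult abs_exp_cancel)
    also have "\<dots> \<le> (1 + 1 / T) * exp (- pi * (T / 2) * (x + of_int n)\<^sup>2)"
      by (rule linear_gaussian_bound[OF T])
    also have "\<dots> \<le> M n" unfolding M_def
      by (intro mult_left_mono gaussian_shift_bound) (use T that in auto)
    finally show ?thesis .
  qed
  have "(\<lambda>k::int. (1 + 1 / (1/T)) * exp (- (pi * (1 / T / 2)) * real (nat \<bar>k\<bar>) ^ 2) * (1 / (T * sqrt T))) summable_on UNIV"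
    using T by (intro summable_on_cmult_left summable_on_cmult_right
          summable_on_int_abs[of "\<lambda>n. exp (- (pi * (1 / T / 2)) * real n ^ 2)"]
          summable_exp_neg_square) auto
  hence s: "(\<lambda>k::int. norm (- \<i> * of_real (of_int k * exp (- pi * of_int k ^ 2 / T) / (T * sqrt T)) :: complex)) summable_on UNIV"
  proof (rule summable_on_comparison_test)
    fix k :: int
    have "norm (- \<i> * of_real (of_int k * exp (- pi * of_int k ^ 2 / T) / (T * sqrt T)) :: complex) =
       (\<bar>of_int k\<bar> * exp (- pi * (1 / T) * of_int k ^ 2)) * (1 / (T * sqrt T))"
      using T by (simp add: norm_mult norm_divide abs_mult)
    also have "\<dots> \<le> ((1 + 1 / (1/T)) * exp (- pi * (1 / T / 2) * of_int k ^ 2)) * (1 / (T * sqrt T))"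
      by (intro mult_right_mono linear_gaussian_bound) (use T in auto)
    finally show "norm (- \<i> * of_real (of_int k * exp (- pi * of_int k ^ 2 / T) / (T * sqrt T)) :: complex) \<le>
       (1 + 1 / (1/T)) * exp (- (pi * (1 / T / 2)) * real (nat \<bar>k\<bar>) ^ 2) * (1 / (T * sqrt T))"
      by simp
  qed auto
  note * = poisson_summation[where g = "\<lambda>x. of_real (x * exp (- pi * T * x\<^sup>2))" and M = M
       and gh = "\<lambda>k. - \<i> * of_real (of_int k * exp (- pi * of_int k ^ 2 / T) / (T * sqrt T))",
       OF _ M bound gaussian_linear_fourier_limit[OF T] s x]
  show "((\<lambda>k. - \<i> * of_real (of_int k * exp (- pi * of_int k ^ 2 / T) / (T * sqrt T)) * unit_exp (of_int k * x))
            has_sum (\<Sum>\<^sub>\<infinity>n::int. of_real ((x + of_int n) * exp (- pi * T * (x + of_int n)\<^sup>2)))) UNIV"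
    "(\<lambda>n::int. of_real ((x + of_int n) * exp (- pi * T * (x + of_int n)\<^sup>2)) :: complex) summable_on UNIV"
    by (rule *; auto intro!: continuous_intros)+
qed

section \<open>Quadratic Gauss sums\<close>

definition gauss_sum :: "int \<Rightarrow> nat \<Rightarrow> complex" where
  "gauss_sum c N = (\<Sum>n<N. unit_exp (of_int c * of_nat n ^ 2 / of_nat N))"

text \<open>Integration by parts: \<open>unit_exp (y\<^sup>2)\<close> is the derivative of
  \<open>unit_exp (y\<^sup>2) / (4 * pi * \<i> * y)\<close> plus a term of modulus
  \<open>1 / (4 * pi * y\<^sup>2)\<close>. The latter is compared with the derivative of
  \<open>R\<close>.\<close>

lemma fresnel_increment:
  assumes P: "\<And>y. (P has_vector_derivative unit_exp (y\<^sup>2)) (at y)" and AB: "0 < A" "A \<le> B"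
  shows "norm (P B - P A - (unit_exp (B\<^sup>2) / B - unit_exp (A\<^sup>2) / A) / (4 * pi * \<i>)) \<le> (1 / A - 1 / B) / (4 * pi)"
proof (cases "A = B")
  case False
  hence lt: "A < B" using AB by simp
  define Q where "Q = (\<lambda>y. P y - unit_exp (y\<^sup>2) * (1 / (4 * pi * \<i>)) * of_real (1 / y))"
  define R where "R = (\<lambda>y::real. - (1 / y) / (4 * pi))"
  have E: "((\<lambda>y. unit_exp (y\<^sup>2)) has_vector_derivative (4 * pi * \<i> * y * unit_exp (y\<^sup>2))) (at y)" for y
  proof -
    have 1: "((\<lambda>x. unit_exp (1 * x)) has_vector_derivative (2 * pi * \<i> * 1 * unit_exp (1 * (y\<^sup>2)))) (at (y\<^sup>2))"
      using has_vector_derivative_unit_exp[of 1 "y\<^sup>2" UNIV] by simp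
    have 2: "((\<lambda>x::real. x\<^sup>2) has_vector_derivative (2 * y)) (at y)"
      by (auto intro!: derivative_eq_intros simp flip: has_real_derivative_iff_has_vector_derivative)
    show ?thesis
      using vector_diff_chain_at[OF 2 1] by (simp add: o_def scaleR_conv_of_real mult_ac)
  qed
  have Q: "(Q has_vector_derivative (unit_exp (y\<^sup>2) * (1 / (4 * pi * \<i>)) * of_real (1 / y\<^sup>2))) (at y)" if "y > 0" for y
  proof -
    have 1: "((\<lambda>y. 1 / y) has_real_derivative (- (1 / y\<^sup>2))) (at y)"
      using that by (auto intro!: derivative_eq_intros simp: power2_eq_square)
    show ?thesis unfolding Q_def
      by (rule has_vector_derivative_eq_rhs[OF has_vector_derivative_diff[OF P
            has_vector_derivative_mult[OF has_vector_derivative_mult_left[OF E]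
             has_vector_derivative_of_real[OF 1]]]])
         (use that in \<open>simp add: field_simps\<close>)
  qed
  have R: "(R has_vector_derivative (1 / y\<^sup>2 / (4 * pi))) (at y)" if "y > 0" for y
    unfolding R_def has_real_derivative_iff_has_vector_derivative [symmetric]
    using that by (auto intro!: derivative_eq_intros simp: power2_eq_square)
  have "norm (Q B - Q A) \<le> R B - R A"
  proof (rule differentiable_bound_general[OF lt])
    show "continuous_on {A..B} Q" "continuous_on {A..B} R"
      by (intro continuous_at_imp_continuous_on ballI has_vector_derivative_continuous[OF Q]
            has_vector_derivative_continuous[OF R]; use AB in simp)+
    fix x assume x: "A < x" "x < B"
    show "(Q has_vector_derivative (unit_exp (x\<^sup>2) * (1 / (4 * pi * \<i>)) * of_real (1 / x\<^sup>2))) (at x)"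
         "(R has_vector_derivative (1 / x\<^sup>2 / (4 * pi))) (at x)"
      using x AB by (intro Q R; simp)+
    show "norm (unit_exp (x\<^sup>2) * (1 / (4 * pi * \<i>)) * of_real (1 / x\<^sup>2)) \<le> 1 / x\<^sup>2 / (4 * pi)"
      by (simp add: norm_mult norm_divide norm_power mult.commute)
  qed
  also have "R B - R A = (1 / A - 1 / B) / (4 * pi)" by (simp add: R_def field_simps)
  also have "Q B - Q A = P B - P A - (unit_exp (B\<^sup>2) / B - unit_exp (A\<^sup>2) / A) / (4 * pi * \<i>)"
    by (simp add: Q_def field_simps)
  finally show ?thesis .
qed auto

text \<open>When the phases at the ends agree, the two boundary terms combine into a difference of
  reciprocals. The saving over \<open>1 / A\<close> is what makes the Fourier coefficients in
  Dirichlet's argument absolutely summable.\<close>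

lemma fresnel_increment_equal_phase:
  assumes P: "\<And>y. (P has_vector_derivative unit_exp (y\<^sup>2)) (at y)" and AB: "0 < A" "A \<le> B"
    and eq: "unit_exp (A\<^sup>2) = unit_exp (B\<^sup>2)"
  shows "norm (P B - P A) \<le> (B - A) / (A * B)"
proof -
  have "norm (P B - P A) \<le> norm (P B - P A - (unit_exp (B\<^sup>2) / B - unit_exp (A\<^sup>2) / A) / (4 * pi * \<i>))
          + norm ((unit_exp (B\<^sup>2) / B - unit_exp (A\<^sup>2) / A) / (4 * pi * \<i>))"
    by (metis diff_add_cancel norm_triangle_ineq)
  also have "\<dots> \<le> (1 / A - 1 / B) / (4 * pi) + (1 / A - 1 / B) / (4 * pi)"
  proof (intro add_mono fresnel_increment[OF P AB])
    have "unit_exp (B\<^sup>2) / B - unit_exp (A\<^sup>2) / A = unit_exp (B\<^sup>2) * of_real (1 / B - 1 / A)"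
      by (simp add: eq algebra_simps)
    hence "norm (unit_exp (B\<^sup>2) / B - unit_exp (A\<^sup>2) / A) = \<bar>1 / B - 1 / A\<bar>"
      by (simp only: norm_mult norm_unit_exp norm_of_real mult_1_left)
    also have "\<dots> = 1 / A - 1 / B" using AB by (simp add: field_simps)
    finally show "norm ((unit_exp (B\<^sup>2) / B - unit_exp (A\<^sup>2) / A) / (4 * pi * \<i>)) \<le> (1 / A - 1 / B) / (4 * pi)"
      by (simp add: norm_divide norm_mult)
  qed
  also have "\<dots> = (1 / A - 1 / B) * (2 / (4 * pi))" by (simp add: field_simps)
  also have "\<dots> \<le> (1 / A - 1 / B) * 1"
    using pi_gt3 AB by (intro mult_left_mono) (auto simp: field_simps)
  finally show ?thesis using AB by (simp add: field_simps)
qed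

text \<open>Estimates proved for positive arguments thereby apply to the negative half-line as
  well.\<close>

lemma fresnel_reflect:
  assumes "\<And>y. (P has_vector_derivative unit_exp (y\<^sup>2)) (at y)"
  shows "((\<lambda>y. - P (- y)) has_vector_derivative unit_exp (y\<^sup>2)) (at y)"
proof -
  have 1: "((\<lambda>x. - x :: real) has_vector_derivative -1) (at y)" by (auto intro!: derivative_eq_intros)
  show ?thesis using has_vector_derivative_minus[OF vector_diff_chain_at[OF 1 assms]] by (simp add: o_def)
qed

text \<open>Only existence of the limit is established here; the value of the Fresnel integral comes
  out of the Gauss sum with \<open>N = 1\<close>.\<close>

lemma fresnel_limit:
  assumes P: "\<And>y. (P has_vector_derivative unit_exp (y\<^sup>2)) (at y)"
  obtains l where "(P \<longlongrightarrow> l) at_top"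
proof -
  have inc: "norm (P B - P A) \<le> 1 / A" if AB: "0 < A" "A \<le> B" for A B
  proof -
    have "norm (P B - P A) \<le> norm (P B - P A - (unit_exp (B\<^sup>2) / B - unit_exp (A\<^sup>2) / A) / (4 * pi * \<i>))
            + norm ((unit_exp (B\<^sup>2) / B - unit_exp (A\<^sup>2) / A) / (4 * pi * \<i>))"
      by (metis diff_add_cancel norm_triangle_ineq)
    also have "\<dots> \<le> (1 / A - 1 / B) / (4 * pi) + (1 / B + 1 / A) / (4 * pi)"
    proof (intro add_mono fresnel_increment[OF P AB])
      have "norm (unit_exp (B\<^sup>2) / B - unit_exp (A\<^sup>2) / A) \<le> 1 / B + 1 / A"
        by (rule order_trans[OF norm_triangle_ineq4]) (use AB in \<open>simp add: norm_divide\<close>)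
      thus "norm ((unit_exp (B\<^sup>2) / B - unit_exp (A\<^sup>2) / A) / (4 * pi * \<i>)) \<le> (1 / B + 1 / A) / (4 * pi)"
        by (simp add: norm_divide norm_mult divide_right_mono)
    qed
    also have "\<dots> = 1 / A * (2 / (4 * pi))" by (simp add: field_simps)
    also have "\<dots> \<le> 1 / A * 1"
      using pi_gt3 AB by (intro mult_left_mono) auto
    finally show ?thesis by simp
  qed
  have "Cauchy (\<lambda>n. P (real (Suc n)))"
  proof (rule CauchyI')
    fix e :: real assume e: "e > 0"
    obtain M where M: "1 / real (Suc M) < e" using nat_approx_posE[OF e] by auto
    show "\<exists>M. \<forall>m\<ge>M. \<forall>n>m. dist (P (real (Suc m))) (P (real (Suc n))) < e"
    proof (intro exI[of _ M] allI impI)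
      fix m n assume mn: "m \<ge> M" "n > m"
      have "norm (P (real (Suc m)) - P (real (Suc n))) \<le> 1 / real (Suc m)"
        using inc[of "real (Suc m)" "real (Suc n)"] mn by (simp add: norm_minus_commute)
      also have "\<dots> \<le> 1 / real (Suc M)" using mn by (intro divide_left_mono) auto
      finally show "dist (P (real (Suc m))) (P (real (Suc n))) < e" using M by (simp add: dist_norm)
    qed
  qed
  then obtain l where l: "(\<lambda>n. P (real (Suc n))) \<longlonglongrightarrow> l"
    using Cauchy_convergent_iff convergent_def by blast
  have "norm (P x - l) \<le> 1 / x" if x: "x > 0" for x
  proof (rule LIMSEQ_le_const2)
    show "(\<lambda>n. norm (P x - P (real (Suc n)))) \<longlonglongrightarrow> norm (P x - l)"
      by (intro tendsto_intros l)
    show "\<exists>N. \<forall>n\<ge>N. norm (P x - P (real (Suc n))) \<le> 1 / x"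
    proof (intro exI allI impI)
      fix n assume "n \<ge> nat \<lceil>x\<rceil>"
      hence "x \<le> real (Suc n)" by linarith
      thus "norm (P x - P (real (Suc n))) \<le> 1 / x" using inc[OF x] by (metis norm_minus_commute)
    qed
  qed
  hence "eventually (\<lambda>x. norm (P x - l) \<le> 1 / x) at_top"
    by (intro eventually_mono[OF eventually_gt_at_top[of 0]])
  moreover have "((\<lambda>x::real. 1 / x) \<longlongrightarrow> 0) at_top" by real_asymp
  ultimately have "((\<lambda>x. norm (P x - l)) \<longlongrightarrow> 0) at_top"
    by (intro tendsto_sandwich[of "\<lambda>_. 0" "\<lambda>x. norm (P x - l)" _ "\<lambda>x. 1 / x"]) auto
  hence "(P \<longlongrightarrow> l) at_top"
    by (rule LIM_zero_cancel[OF tendsto_norm_zero_cancel])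
  thus ?thesis by (rule that)
qed

lemma fresnel_primitive:
  obtains P :: "real \<Rightarrow> complex" where "\<And>y. (P has_vector_derivative unit_exp (y\<^sup>2)) (at y)"
proof -
  have "(\<lambda>z. exp (2 * pi * \<i> * z\<^sup>2)) holomorphic_on UNIV" by (intro holomorphic_intros)
  from holomorphic_convex_primitive'[OF convex_UNIV open_UNIV this]
  obtain g where g: "\<And>z. z \<in> UNIV \<Longrightarrow> (g has_field_derivative exp (2 * pi * \<i> * z\<^sup>2)) (at z within UNIV)"
    by blast
  have "((\<lambda>x. g (of_real x)) has_vector_derivative unit_exp (y\<^sup>2)) (at y)" for y
    using has_vector_derivative_real_field[OF g[OF UNIV_I, of "of_real y"]] by (simp add: unit_exp_conv_exp)
  thus ?thesis by (rule that)
qed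

lemma unit_exp_quarter: "unit_exp (1/4) = \<i>" "unit_exp (-(1/4)) = -\<i>" "unit_exp (1/2) = -1"
proof -
  have "2 * pi * (1/4) = pi / 2" "2 * pi * (1/2) = pi" by simp_all
  thus "unit_exp (1/4) = \<i>" "unit_exp (1/2) = -1"
    unfolding unit_exp_def by (simp_all only: cis_pi_half cis_pi)
  thus "unit_exp (-(1/4)) = -\<i>" by (simp only: unit_exp_minus) simp
qed

text \<open>Dirichlet's argument: \<open>F\<close> interpolates the Gauss sum periodically and its
  Fourier series is evaluated at 0. Completing the square turns coefficient k into a piece of the
  Fresnel integral times a phase depending only on the parity of k. The pieces with even k tile the
  line, and so do those with odd k, which gives the factor
  \<open>1 + unit_exp (- N / 4)\<close>.\<close>

lemma gauss_sum_fresnel: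
  assumes N: "N > 0" and P: "\<And>y. (P has_vector_derivative unit_exp (y\<^sup>2)) (at y)"
    and p: "(P \<longlongrightarrow> p) at_top" and p': "((\<lambda>y. P (- y)) \<longlongrightarrow> p') at_top"
  shows "gauss_sum 1 N = of_real (sqrt N) * (1 + unit_exp (- N / 4)) * (p - p')"
proof -
  define s where "s = sqrt N / 2"
  have s: "s > 0" "s\<^sup>2 = N / 4" using N by (simp_all add: s_def power_divide)
  have sN: "sqrt N = 2 * s" by (simp add: s_def)
  define F where "F = (\<lambda>x. \<Sum>n<N. unit_exp ((of_nat n + x)\<^sup>2 / N))"
  \<comment> \<open>With \<open>s = sqrt N / 2\<close> the variable
    \<open>y / (2 * s) - k * s\<close> completes the square in \<open>y\<^sup>2 / N - k * y\<close>;
    y from 0 to N then runs over an interval of length \<open>2 * s\<close>.\<close>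
  define c where "c = (\<lambda>k::int. unit_exp (- (of_int k ^ 2) * N / 4) * of_real (2 * s) *
                         (P ((2 - of_int k) * s) - P (- of_int k * s)))"
  have Fc: "continuous_on {0..1} F" unfolding F_def by (intro continuous_intros) (use N in auto)
  have F0: "F 0 = gauss_sum 1 N" by (simp add: F_def gauss_sum_def)
  have F1: "F 1 = gauss_sum 1 N"
  proof -
    have "F 1 + unit_exp (of_nat 0 ^ 2 / N) = (\<Sum>n<Suc N. unit_exp (of_nat n ^ 2 / N))"
      by (subst sum.lessThan_Suc_shift) (simp add: F_def add.commute)
    also have "\<dots> = gauss_sum 1 N + unit_exp (of_nat N)"
      using N by (simp add: gauss_sum_def power2_eq_square)
    finally show ?thesis by simp
  qed
  have coeff: "((\<lambda>x. F x * unit_exp (- of_int k * x)) has_integral c k) {0..1}" for k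
  proof -
    let ?r = "\<lambda>y. y / (2 * s) - of_int k * s"
    define W where "W = (\<lambda>y. unit_exp (- (of_int k ^ 2) * N / 4) * of_real (2 * s) * P (?r y))"
    have W: "(W has_vector_derivative unit_exp (y\<^sup>2 / N - of_int k * y)) (at y within S)" for y S
    proof -
      have 1: "(?r has_vector_derivative (1 / (2 * s))) (at y within S)"
        unfolding has_real_derivative_iff_has_vector_derivative [symmetric]
        using s by (auto intro!: derivative_eq_intros)
      have 2: "((\<lambda>y. P (?r y)) has_vector_derivative ((1 / (2 * s)) *\<^sub>R unit_exp ((?r y)\<^sup>2))) (at y within S)"
        using vector_diff_chain_within[OF 1 has_vector_derivative_at_within[OF P]] by (simp add: o_def)
      have 3: "(W has_vector_derivative (unit_exp (- (of_int k ^ 2) * N / 4) * of_real (2 * s) *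
                ((1 / (2 * s)) *\<^sub>R unit_exp ((?r y)\<^sup>2)))) (at y within S)"
        unfolding W_def by (rule has_vector_derivative_mult_right[OF 2])
      have "- (of_int k ^ 2) * N / 4 + (?r y)\<^sup>2 = y\<^sup>2 / N - of_int k * y"
      proof -
        have "real N = 4 * s\<^sup>2" using s by simp
        moreover have "(?r y)\<^sup>2 = y\<^sup>2 / (4 * s\<^sup>2) - of_int k * y + of_int k ^ 2 * s\<^sup>2"
          unfolding power2_diff power_divide power_mult_distrib using s by simp
        ultimately show ?thesis by simp
      qed
      hence "unit_exp (- (of_int k ^ 2) * N / 4) * unit_exp ((?r y)\<^sup>2) = unit_exp (y\<^sup>2 / N - of_int k * y)"
        by (simp only: unit_exp_add [symmetric])
      hence "unit_exp (- (of_int k ^ 2) * N / 4) * of_real (2 * s) *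
                ((1 / (2 * s)) *\<^sub>R unit_exp ((?r y)\<^sup>2)) = unit_exp (y\<^sup>2 / N - of_int k * y)"
        using s by (simp add: scaleR_conv_of_real field_simps)
      thus ?thesis using 3 by simp
    qed
    have "((\<lambda>x. unit_exp ((of_nat n + x)\<^sup>2 / N) * unit_exp (- of_int k * x)) has_integral
              (W (of_nat (Suc n)) - W (of_nat n))) {0..1}" for n
    proof -
      have "((\<lambda>x. unit_exp ((of_nat n + x)\<^sup>2 / N - of_int k * (of_nat n + x))) has_integral
              (W (of_nat n + 1) - W (of_nat n + 0))) {0..1}"
      proof (rule fundamental_theorem_of_calculus)
        fix x :: real
        have 1: "((\<lambda>x. of_nat n + x) has_vector_derivative 1) (at x within {0..1})"
          by (auto intro!: derivative_eq_intros)
        show "((\<lambda>x. W (of_nat n + x)) has_vector_derivative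
                unit_exp ((of_nat n + x)\<^sup>2 / N - of_int k * (of_nat n + x))) (at x within {0..1})"
          using vector_diff_chain_within[OF 1 W] by (simp add: o_def)
      qed simp
      moreover have "unit_exp ((of_nat n + x)\<^sup>2 / N - of_int k * (of_nat n + x)) =
          unit_exp ((of_nat n + x)\<^sup>2 / N) * unit_exp (- of_int k * x)" for x
        using unit_exp_add_int[of "(of_nat n + x)\<^sup>2 / N - of_int k * x" "- k * int n"]
        by (simp add: algebra_simps flip: unit_exp_add)
      ultimately show ?thesis by (simp add: add.commute)
    qed
    hence "((\<lambda>x. \<Sum>n<N. unit_exp ((of_nat n + x)\<^sup>2 / N) * unit_exp (- of_int k * x)) has_integral
              (\<Sum>n<N. W (of_nat (Suc n)) - W (of_nat n))) {0..1}"
      by (intro has_integral_sum) auto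
    also have "(\<Sum>n<N. W (of_nat (Suc n)) - W (of_nat n)) = W N - W 0"
      by (subst sum_lessThan_telescope) simp
    also have "W N - W 0 = c k"
    proof -
      have "N / (2 * s) = 2 * s" using s by (simp add: field_simps power2_eq_square)
      thus ?thesis by (simp add: W_def c_def algebra_simps)
    qed
    finally show ?thesis by (simp add: F_def sum_distrib_right)
  qed
  note P' = fresnel_reflect[OF P]
  \<comment> \<open>The squares of the two ends differ by the integer \<open>(k + 1) * N\<close>, so
    the equal-phase estimate applies and yields decay like \<open>1 / k\<^sup>2\<close>.\<close>
  have per: "unit_exp ((of_int k * s)\<^sup>2) = unit_exp (((of_int k + 2) * s)\<^sup>2)" for k
  proof -
    have "((of_int k + 2) * s)\<^sup>2 = (of_int k * s)\<^sup>2 + of_int ((k + 1) * int N)"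
    proof -
      have "((of_int k + 2) * s)\<^sup>2 = (of_int k * s)\<^sup>2 + (of_int k + 1) * (4 * s\<^sup>2)"
        by (simp add: power2_eq_square algebra_simps)
      thus ?thesis using s by simp
    qed
    thus ?thesis by (simp only: unit_exp_add_int)
  qed
  have cb: "norm (c k) \<le> 32 / real (nat \<bar>k\<bar>) ^ 2" if k: "\<bar>k\<bar> \<ge> 4" for k
  proof -
    have main: "norm (R ((real m + 2) * s) - R (real m * s)) * (2 * s) \<le> 16 / real (m + 2) ^ 2"
      if R: "\<And>y. (R has_vector_derivative unit_exp (y\<^sup>2)) (at y)" and m: "m \<ge> 2" for R and m :: nat
    proof -
      have "norm (R ((real m + 2) * s) - R (real m * s)) \<le>
             ((real m + 2) * s - real m * s) / ((real m * s) * ((real m + 2) * s))"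
        using s m per[of "int m"] by (intro fresnel_increment_equal_phase R) auto
      also have "\<dots> = (2 * s) / (s * (s * (real m * (real m + 2))))" by (simp add: algebra_simps)
      also have "\<dots> = 2 / s / (real m * (real m + 2))" using s by simp
      also have "\<dots> \<le> 2 / s / ((real (m + 2) / 2) * (real m + 2))"
        using s m by (intro divide_left_mono mult_right_mono mult_pos_pos) auto
      also have "\<dots> = 4 / s / real (m + 2) ^ 2"
        using s m by (simp add: power2_eq_square divide_simps)
      finally have "norm (R ((real m + 2) * s) - R (real m * s)) * (2 * s) \<le> 4 / s / real (m + 2) ^ 2 * (2 * s)"
        using s by (intro mult_right_mono) auto
      also have "\<dots> = 8 / real (m + 2) ^ 2" using s by simp
      also have "\<dots> \<le> 16 / real (m + 2) ^ 2" by (intro divide_right_mono) auto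
      finally show ?thesis .
    qed
    have nc: "norm (c k) = norm (P ((2 - of_int k) * s) - P (- of_int k * s)) * (2 * s)"
      using s by (simp add: c_def norm_mult)
    show ?thesis
    proof (cases "k \<ge> 0")
      case True
      define m where "m = nat (k - 2)"
      have m: "m \<ge> 2" "k = int m + 2" using k True by (auto simp: m_def)
      have "norm (c k) \<le> 16 / real (m + 2) ^ 2"
        using main[OF P' m(1)] unfolding nc by (simp add: m(2) algebra_simps)
      also have "\<dots> \<le> 32 / real (m + 2) ^ 2" by (intro divide_right_mono) auto
      finally show ?thesis using m by (simp add: nat_add_distrib)
    next
      case False
      define m where "m = nat (- k)"
      have m: "m \<ge> 4" "k = - int m" using k False by (auto simp: m_def)
      have "norm (c k) \<le> 16 / real (m + 2) ^ 2"
        using main[OF P] m(1) unfolding nc by (simp add: m(2) algebra_simps)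
      also have "\<dots> \<le> 32 / real m ^ 2"
        using m by (intro frac_le power_mono) auto
      finally show ?thesis using m by simp
    qed
  qed
  have csum: "(\<lambda>k. norm (c k)) summable_on UNIV"
  proof -
    have "summable (\<lambda>n. 32 * (1 / real n ^ 2))"
      by (intro summable_mult) (use inverse_power_summable[of 2, where 'a = real] in \<open>simp add: inverse_eq_divide\<close>)
    hence "(\<lambda>k::int. 32 * (1 / real (nat \<bar>k\<bar>) ^ 2)) summable_on UNIV"
      by (rule summable_on_int_abs) auto
    hence "(\<lambda>k::int. 32 * (1 / real (nat \<bar>k\<bar>) ^ 2)) summable_on {k. \<bar>k\<bar> \<ge> 4}"
      by (rule summable_on_subset_banach) auto
    hence "(\<lambda>k. norm (c k)) summable_on {k. \<bar>k\<bar> \<ge> 4}"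
      by (rule summable_on_comparison_test) (use cb in auto)
    moreover have "(\<lambda>k. norm (c k)) summable_on {k. \<bar>k\<bar> < 4}"
    proof (rule summable_on_finite)
      have "{k::int. \<bar>k\<bar> < 4} \<subseteq> {-4..4}" by auto
      thus "finite {k::int. \<bar>k\<bar> < 4}" by (rule finite_subset) auto
    qed
    ultimately have "(\<lambda>k. norm (c k)) summable_on ({k. \<bar>k\<bar> \<ge> 4} \<union> {k. \<bar>k\<bar> < 4})"
      by (rule summable_on_union)
    also have "{k::int. \<bar>k\<bar> \<ge> 4} \<union> {k. \<bar>k\<bar> < 4} = UNIV" by auto
    finally show ?thesis .
  qed
  have G: "(c has_sum gauss_sum 1 N) UNIV"
    using fourier_series_has_sum[OF Fc _ coeff csum, of 0] F0 F1 by simp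
  have cs: "c summable_on S" for S
    by (rule summable_on_subset_banach[OF has_sum_imp_summable[OF G]]) auto
  let ?Ev = "range (\<lambda>j::int. 2 * j)" and ?Od = "range (\<lambda>j::int. 2 * j + 1)"
  have U: "UNIV = ?Ev \<union> ?Od" and disj: "?Ev \<inter> ?Od = {}"
  proof -
    show "UNIV = ?Ev \<union> ?Od"
    proof (rule UNIV_eq_I)
      fix x :: int
      have "x = 2 * (x div 2) \<or> x = 2 * (x div 2) + 1" by presburger
      thus "x \<in> ?Ev \<union> ?Od" by blast
    qed
    have "2 * i \<noteq> 2 * j + 1" for i j :: int by presburger
    thus "?Ev \<inter> ?Od = {}" by auto
  qed
  have "(c has_sum (infsum c ?Ev + infsum c ?Od)) (?Ev \<union> ?Od)"
    by (rule has_sum_Un_disjoint[OF has_sum_infsum[OF cs] has_sum_infsum[OF cs] disj])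
  hence "(c has_sum (infsum c ?Ev + infsum c ?Od)) UNIV"
    unfolding U [symmetric] .
  hence split: "gauss_sum 1 N = infsum c ?Ev + infsum c ?Od"
    by (rule has_sum_unique[OF G])
  define d where "d = (\<lambda>a::real. of_real (2 * s) * (P ((2 - a) * s) - P (- a * s)))"
  \<comment> \<open>Frequencies of one parity move the interval by its own length, so the sum
    telescopes to an integral over one long interval.\<close>
  have tele: "(\<Sum>j\<in>{-int M..<int M}. d (2 * of_int j + r)) =
      of_real (2 * s) * (P ((2 * real M + 2 - r) * s) - P (- (2 * real M - 2 + r) * s))" for M and r :: real
  proof -
    have "(\<Sum>j\<in>{-int M..<-int M + int m}. d (2 * of_int j + r)) =
      of_real (2 * s) * (P ((2 * real M + 2 - r) * s) - P ((2 * real M + 2 - 2 * real m - r) * s))" for m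
    proof (induction m)
      case (Suc m)
      have "{-int M..<-int M + int (Suc m)} = insert (-int M + int m) {-int M..<-int M + int m}"
        by auto
      thus ?case using Suc by (simp add: d_def algebra_simps)
    qed auto
    from this[of "2 * M"] show ?thesis by (simp add: algebra_simps)
  qed
  have lim: "(\<lambda>M. \<Sum>j\<in>{-int M..<int M}. d (2 * of_int j + r)) \<longlonglongrightarrow> of_real (2 * s) * (p - p')" for r
  proof -
    have "filterlim (\<lambda>M. (2 * real M + 2 - r) * s) at_top sequentially"
      by (rule filterlim_at_top_mult_tendsto_pos[OF tendsto_const s(1)]) real_asymp
    moreover have "filterlim (\<lambda>M. (2 * real M - 2 + r) * s) at_top sequentially"
      by (rule filterlim_at_top_mult_tendsto_pos[OF tendsto_const s(1)]) real_asymp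
    ultimately show ?thesis unfolding tele
      by (intro tendsto_mult_left tendsto_diff filterlim_compose[OF p] filterlim_compose[OF p', of "\<lambda>M. (2 * real M - 2 + r) * s", simplified minus_mult_left])
  qed
  have Ev: "infsum c ?Ev = of_real (2 * s) * (p - p')"
  proof -
    have "(c has_sum infsum c ?Ev) ?Ev" by (rule has_sum_infsum[OF cs])
    hence "((\<lambda>j. c (2 * j)) has_sum infsum c ?Ev) UNIV"
      by (subst (asm) has_sum_reindex) (auto simp: o_def inj_on_def)
    moreover have "c (2 * j) = d (2 * of_int j + 0)" for j
    proof -
      have "- (of_int (2 * j) ^ 2) * real N / 4 = of_int (- (j\<^sup>2) * int N)" by (simp add: power_mult_distrib)
      hence "unit_exp (- (of_int (2 * j) ^ 2) * real N / 4) = 1" by (simp only: unit_exp_of_int)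
      thus ?thesis by (simp add: c_def d_def)
    qed
    ultimately have "((\<lambda>j. d (2 * of_int j + 0)) has_sum infsum c ?Ev) UNIV" by simp
    hence "(\<lambda>M. \<Sum>j\<in>{-int M..<int M}. d (2 * of_int j + 0)) \<longlonglongrightarrow> infsum c ?Ev"
      unfolding has_sum_def by (rule filterlim_compose[OF _ filterlim_int_intervals])
    thus ?thesis using lim LIMSEQ_unique by blast
  qed
  have Od: "infsum c ?Od = unit_exp (- N / 4) * (of_real (2 * s) * (p - p'))"
  proof -
    have "(c has_sum infsum c ?Od) ?Od" by (rule has_sum_infsum[OF cs])
    hence "((\<lambda>j. c (2 * j + 1)) has_sum infsum c ?Od) UNIV"
      by (subst (asm) has_sum_reindex) (auto simp: o_def inj_on_def)
    moreover have "c (2 * j + 1) = unit_exp (- N / 4) * d (2 * of_int j + 1)" for j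
    proof -
      have "- (of_int (2 * j + 1) ^ 2) * real N / 4 = - N / 4 + of_int (- (j\<^sup>2 + j) * int N)"
        by (simp add: power2_eq_square field_simps)
      hence "unit_exp (- (of_int (2 * j + 1) ^ 2) * real N / 4) = unit_exp (- N / 4)"
        by (simp only: unit_exp_add_int)
      thus ?thesis by (simp add: c_def d_def mult.assoc)
    qed
    ultimately have "((\<lambda>j. unit_exp (- N / 4) * d (2 * of_int j + 1)) has_sum infsum c ?Od) UNIV" by simp
    hence "(\<lambda>M. \<Sum>j\<in>{-int M..<int M}. unit_exp (- N / 4) * d (2 * of_int j + 1)) \<longlonglongrightarrow> infsum c ?Od"
      unfolding has_sum_def by (rule filterlim_compose[OF _ filterlim_int_intervals])
    moreover have "(\<lambda>M. \<Sum>j\<in>{-int M..<int M}. unit_exp (- N / 4) * d (2 * of_int j + 1)) \<longlonglongrightarrow>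
        unit_exp (- N / 4) * (of_real (2 * s) * (p - p'))"
      unfolding sum_distrib_left [symmetric] by (intro tendsto_mult_left lim)
    ultimately show ?thesis using LIMSEQ_unique by blast
  qed
  show ?thesis unfolding split Ev Od sN by (simp add: algebra_simps)
qed

theorem gauss_sum_eval:
  assumes N: "N > 0"
  shows "gauss_sum 1 N = of_real (sqrt N) * (1 + unit_exp (- N / 4)) * (1 + \<i>) / 2"
proof -
  obtain P :: "real \<Rightarrow> complex" where P: "\<And>y. (P has_vector_derivative unit_exp (y\<^sup>2)) (at y)"
    by (rule fresnel_primitive) blast
  note P' = fresnel_reflect[OF P]
  obtain p where p: "(P \<longlongrightarrow> p) at_top" by (rule fresnel_limit[OF P])
  obtain p' where p'_lim: "((\<lambda>y. - P (- y)) \<longlongrightarrow> p') at_top" by (rule fresnel_limit[OF P'])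
  have p': "((\<lambda>y. P (- y)) \<longlongrightarrow> - p') at_top" using tendsto_minus[OF p'_lim] by simp
  \<comment> \<open>The Gauss sum with \<open>N = 1\<close> is 1, and this fixes the value of the
    Fresnel integral for all N.\<close>
  have "1 = (1 - \<i>) * (p + p')"
    using gauss_sum_fresnel[OF _ P p p', of 1] by (simp add: gauss_sum_def unit_exp_quarter)
  hence "(1 + \<i>) * 1 = (1 + \<i>) * ((1 - \<i>) * (p + p'))" by simp
  also have "\<dots> = 2 * (p + p')" by (simp add: algebra_simps)
  finally have "p + p' = (1 + \<i>) / 2" by simp
  thus ?thesis using gauss_sum_fresnel[OF N P p p'] by (simp add: mult.assoc)
qed

section \<open>Gauss sums of real primitive characters\<close>

definition add_char :: "nat \<Rightarrow> int \<Rightarrow> complex" where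
  "add_char q a = unit_exp (of_int a / of_nat q)"

lemma add_char_add: "add_char q (a + b) = add_char q a * add_char q b"
  by (simp add: add_char_def add_divide_distrib unit_exp_add)

lemma add_char_0 [simp]: "add_char q 0 = 1"
  by (simp add: add_char_def)

lemma add_char_mult_modulus [simp]: "q > 0 \<Longrightarrow> add_char q (int q * k) = 1"
  by (simp add: add_char_def)

lemma add_char_cong:
  assumes "[a = b] (mod int q)"
  shows "add_char q a = add_char q b"
proof (cases "q = 0")
  case False
  obtain k where "a = b + int q * k"
    using assms by (metis cong_iff_lin cong_sym)
  thus ?thesis using False by (simp add: add_char_add)
qed (use assms in \<open>simp add: cong_def add_char_def\<close>)

lemma cnj_add_char: "cnj (add_char q a) = add_char q (- a)"
  using unit_exp_minus[of "of_int a / of_nat q"] by (simp add: add_char_def)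

lemma sum_add_char:
  assumes q: "q > 0"
  shows "(\<Sum>k\<in>{0..<int q}. add_char q (a * k)) = (if int q dvd a then of_nat q else 0)"
proof -
  have "(\<Sum>k\<in>{0..<int q}. add_char q (a * k)) = (\<Sum>k<q. add_char q a ^ k)"
  proof (rule sum.reindex_bij_witness[of _ int nat])
    fix x assume "x \<in> {0..<int q}"
    thus "add_char q a ^ nat x = add_char q (a * x)"
      by (simp add: add_char_def unit_exp_power mult_ac)
  qed auto
  also have "\<dots> = (if int q dvd a then of_nat q else 0)"
  proof (cases "int q dvd a")
    case True
    then obtain k where "a = int q * k" by auto
    hence "add_char q a = 1" using q by simp
    thus ?thesis using True by simp
  next
    case False
    have "add_char q a \<noteq> 1"
    proof
      assume "add_char q a = 1"
      hence "cos (2 * pi * (of_int a / of_nat q)) = 1"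
        by (simp add: add_char_def unit_exp_def complex_eq_iff)
      then obtain j :: int where "2 * pi * (of_int a / of_nat q) = of_int j * 2 * pi"
        using cos_one_2pi_int by blast
      hence "of_int a = (of_int (j * int q) :: real)" using q by (simp add: field_simps)
      hence "a = j * int q" by (simp only: of_int_eq_iff)
      thus False using False by simp
    qed
    moreover have "add_char q a ^ q = 1"
      using q by (simp add: add_char_def unit_exp_power)
    ultimately show ?thesis using False by (simp add: sum_gp_strict)
  qed
  finally show ?thesis .
qed

lemma sum_residues_mult:
  fixes f :: "int \<Rightarrow> complex"
  assumes q: "q > 0" and f: "\<And>a b. [a = b] (mod int q) \<Longrightarrow> f a = f b" and u: "coprime u (int q)"
  shows "(\<Sum>a\<in>{0..<int q}. f (a * u)) = (\<Sum>a\<in>{0..<int q}. f a)"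
proof -
  obtain v where v: "[u * v = 1] (mod int q)" using u by (metis coprime_iff_invertible_int)
  \<comment> \<open>Multiplication by the unit \<open>u\<close> permutes the residues; the two
    inverse laws feed the reindexing below.\<close>
  have inv: "(a * u mod int q) * v mod int q = a" if "a \<in> {0..<int q}" for a
  proof -
    have "[a * u mod int q * v = a * u * v] (mod int q)" by (simp add: cong_def mod_mult_left_eq)
    also have "[a * u * v = a * 1] (mod int q)"
      unfolding mult.assoc by (intro cong_mult v cong_refl)
    finally show ?thesis using that by (simp add: cong_def)
  qed
  have inv': "(a * v mod int q) * u mod int q = a" if "a \<in> {0..<int q}" for a
  proof -
    have "[a * v mod int q * u = a * (u * v)] (mod int q)"
      by (simp add: cong_def mod_mult_left_eq mult.assoc mult.commute[of v u])
    also have "[a * (u * v) = a * 1] (mod int q)"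
      by (intro cong_mult v cong_refl)
    finally show ?thesis using that by (simp add: cong_def)
  qed
  show ?thesis
    by (rule sum.reindex_bij_witness[of _ "\<lambda>a. a * v mod int q" "\<lambda>a. a * u mod int q"])
       (use inv inv' q in \<open>auto intro!: f simp: cong_def\<close>)
qed

section \<open>Multiplicative relations between quadratic Gauss sums\<close>

lemma gauss_sum_altdef:
  "gauss_sum c N = (\<Sum>n\<in>{0..<int N}. add_char N (c * n\<^sup>2))"
  unfolding gauss_sum_def
  by (rule sum.reindex_bij_witness[of _ nat int]) (auto simp: add_char_def)

lemma gauss_sum_cong: "[c = d] (mod int N) \<Longrightarrow> gauss_sum c N = gauss_sum d N"
  unfolding gauss_sum_altdef by (intro sum.cong refl add_char_cong cong_mult cong_refl)

lemma add_char_product: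
  assumes "m > 0" "n > 0"
  shows "add_char (m * n) (c * (x * int n + y * int m)\<^sup>2) =
         add_char m (c * int n * x\<^sup>2) * add_char n (c * int m * y\<^sup>2)"
proof -
  have "of_int (c * (x * int n + y * int m)\<^sup>2) / of_nat (m * n) =
        (of_int (c * int n * x\<^sup>2) / of_nat m + of_int (c * int m * y\<^sup>2) / of_nat n) +
        (of_int (2 * c * x * y) :: real)"
    using assms by (simp add: power2_eq_square field_simps)
  thus ?thesis unfolding add_char_def by (simp only: unit_exp_add_int) (simp only: unit_exp_add)
qed

text \<open>By the Chinese remainder theorem the residues modulo \<open>m * n\<close> are
  \<open>x * n + y * m\<close>. The cross term of the square is divisible by the modulus, so the sum
  factors.\<close>

lemma gauss_sum_coprime_product:
  assumes mn: "coprime m n" "m > 0" "n > 0"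
  shows "gauss_sum c (m * n) = gauss_sum (c * int n) m * gauss_sum (c * int m) n"
proof -
  let ?A = "{0..<int m} \<times> {0..<int n}"
  let ?f = "\<lambda>(x, y). (x * int n + y * int m) mod int (m * n)"
  have cop: "coprime (int m) (int n)" using mn by simp
  have inj: "inj_on ?f ?A"
  proof (rule inj_onI, clarify)
    fix x y x' y' assume r: "x \<in> {0..<int m}" "y \<in> {0..<int n}" "x' \<in> {0..<int m}" "y' \<in> {0..<int n}"
      and eq: "(x * int n + y * int m) mod int (m * n) = (x' * int n + y' * int m) mod int (m * n)"
    have c: "[x * int n + y * int m = x' * int n + y' * int m] (mod int m * int n)"
      using eq by (simp add: cong_def)
    have "[x * int n = x' * int n] (mod int m)"
      using cong_modulus_mult[OF c] by (metis cong_add_rcancel_0 cong_add cong_def mod_mult_self1)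
    hence "[x = x'] (mod int m)" using cop by (simp add: cong_mult_rcancel coprime_commute)
    moreover have "[y * int m = y' * int m] (mod int n)"
      using cong_modulus_mult[of _ _ "int n" "int m"] c
      by (metis cong_def mod_mult_self3 mult.commute)
    hence "[y = y'] (mod int n)" using cop by (simp add: cong_mult_rcancel coprime_commute)
    ultimately show "x = x' \<and> y = y'" using r by (auto simp: cong_def)
  qed
  have im: "?f ` ?A = {0..<int (m * n)}"
  proof (rule card_subset_eq)
    show "?f ` ?A \<subseteq> {0..<int (m * n)}" using mn by (auto simp del: of_nat_mult)
    show "card (?f ` ?A) = card {0..<int (m * n)}"
      using card_image[OF inj] by (simp add: nat_mult_distrib)
  qed auto
  have "gauss_sum c (m * n) = (\<Sum>z\<in>?A. add_char (m * n) (c * (?f z)\<^sup>2))"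
    unfolding gauss_sum_altdef im [symmetric] sum.reindex[OF inj] by (simp only: o_def)
  also have "\<dots> = (\<Sum>(x,y)\<in>?A. add_char m (c * int n * x\<^sup>2) * add_char n (c * int m * y\<^sup>2))"
  proof (rule sum.cong[OF refl])
    fix z :: "int \<times> int"
    obtain x y where z: "z = (x, y)" by force
    have "add_char (m * n) (c * (?f z)\<^sup>2) = add_char (m * n) (c * (x * int n + y * int m)\<^sup>2)"
      unfolding z prod.case by (intro add_char_cong cong_mult cong_pow cong_refl) (simp add: cong_def)
    thus "add_char (m * n) (c * (?f z)\<^sup>2) =
      (case z of (x, y) \<Rightarrow> add_char m (c * int n * x\<^sup>2) * add_char n (c * int m * y\<^sup>2))"
      using add_char_product[OF mn(2,3)] by (simp only: z prod.case)
  qed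
  also have "\<dots> = gauss_sum (c * int n) m * gauss_sum (c * int m) n"
    unfolding gauss_sum_altdef sum_product by (simp add: sum.cartesian_product)
  finally show ?thesis .
qed

text \<open>The pigeonhole principle: each side takes \<open>(p + 1) / 2\<close> values modulo \<open>p\<close>.\<close>

lemma binary_diagonal_form_represents_one:
  fixes c d :: int
  assumes p: "prime p" "odd p" and cd: "coprime c (int p)" "coprime d (int p)"
  shows "\<exists>x y. [c * x\<^sup>2 + d * y\<^sup>2 = 1] (mod int p)"
proof -
  let ?H = "{0..(int p - 1) div 2}"
  have pi: "prime (int p)" using p by simp
  have p2: "int p > 2" using p prime_ge_2_nat[of p] by (cases "p = 2") auto
  define A where "A = (\<lambda>x. c * x\<^sup>2 mod int p) ` ?H"
  define B where "B = (\<lambda>y. (1 - d * y\<^sup>2) mod int p) ` ?H"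
  have sq: "x = y" if "x \<in> ?H" "y \<in> ?H" "[x\<^sup>2 = y\<^sup>2] (mod int p)" for x y
  proof -
    have "int p dvd (x + y) * (x - y)"
      using that(3) by (simp add: cong_iff_dvd_diff power2_eq_square algebra_simps)
    hence "int p dvd x + y \<or> int p dvd x - y" using pi by (simp add: prime_dvd_mult_iff)
    thus ?thesis
    proof
      assume "int p dvd x + y"
      hence "x + y = 0" using zdvd_imp_le[of "int p" "x + y"] that(1,2) p2 by force
      thus ?thesis using that(1,2) by auto
    next
      assume "int p dvd x - y"
      hence "\<bar>x - y\<bar> = 0" using zdvd_imp_le[of "int p" "\<bar>x - y\<bar>"] that(1,2) p2 by force
      thus ?thesis by simp
    qed
  qed
  have "inj_on (\<lambda>x. c * x\<^sup>2 mod int p) ?H"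
  proof (rule inj_onI)
    fix x y assume H: "x \<in> ?H" "y \<in> ?H" "c * x\<^sup>2 mod int p = c * y\<^sup>2 mod int p"
    hence "[c * x\<^sup>2 = c * y\<^sup>2] (mod int p)" by (simp add: cong_def)
    hence "[x\<^sup>2 = y\<^sup>2] (mod int p)" using cd(1) by (simp add: cong_mult_lcancel)
    thus "x = y" using sq H by blast
  qed
  hence cA: "card A = card ?H" unfolding A_def by (rule card_image)
  have "inj_on (\<lambda>y. (1 - d * y\<^sup>2) mod int p) ?H"
  proof (rule inj_onI)
    fix x y assume H: "x \<in> ?H" "y \<in> ?H" "(1 - d * x\<^sup>2) mod int p = (1 - d * y\<^sup>2) mod int p"
    hence "[1 - d * x\<^sup>2 = 1 - d * y\<^sup>2] (mod int p)" by (simp add: cong_def)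
    from cong_diff[OF cong_refl[of 1] this]
    have "[d * x\<^sup>2 = d * y\<^sup>2] (mod int p)" by simp
    hence "[x\<^sup>2 = y\<^sup>2] (mod int p)" using cd(2) by (simp add: cong_mult_lcancel)
    thus "x = y" using sq H by blast
  qed
  hence cB: "card B = card ?H" unfolding B_def by (rule card_image)
  have cH: "2 * card ?H > p"
  proof -
    obtain t where "int p = 2 * t + 1" using p(2) by (metis even_of_nat oddE)
    thus ?thesis by simp
  qed
  have sub: "A \<union> B \<subseteq> {0..<int p}" using p2 by (auto simp: A_def B_def)
  have "A \<inter> B \<noteq> {}"
  proof
    assume "A \<inter> B = {}"
    hence "card (A \<union> B) = card A + card B"
      by (intro card_Un_disjoint) (auto simp: A_def B_def)
    moreover have "card (A \<union> B) \<le> p" using card_mono[OF _ sub] by simp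
    ultimately show False using cA cB cH by simp
  qed
  then obtain x y where "c * x\<^sup>2 mod int p = (1 - d * y\<^sup>2) mod int p"
    unfolding A_def B_def by auto
  hence "[c * x\<^sup>2 + d * y\<^sup>2 = (1 - d * y\<^sup>2) + d * y\<^sup>2] (mod int p)"
    by (intro cong_add cong_refl) (simp add: cong_def)
  thus ?thesis by auto
qed

text \<open>If \<open>c x\<^sup>2 + d y\<^sup>2\<close> represents 1 modulo \<open>N\<close>, it is equivalent to \<open>X\<^sup>2 + c d Y\<^sup>2\<close>.\<close>

lemma gauss_sum_mult:
  assumes N: "N > 0" and xy: "[c * x0\<^sup>2 + d * y0\<^sup>2 = 1] (mod int N)"
  shows "gauss_sum c N * gauss_sum d N = gauss_sum 1 N * gauss_sum (c * d) N"
proof -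
  let ?R = "{0..<int N}"
  have one: "[(c * x0\<^sup>2 + d * y0\<^sup>2) * z = z] (mod int N)" for z
    using cong_mult[OF xy cong_refl[of z]] by simp
  have red: "z mod int N = z" if "z \<in> ?R" for z using that by simp
  have "gauss_sum c N * gauss_sum d N = (\<Sum>(x,y)\<in>?R \<times> ?R. add_char N (c * x\<^sup>2 + d * y\<^sup>2))"
    unfolding gauss_sum_altdef sum_product by (simp add: sum.cartesian_product add_char_add)
  also have "\<dots> = (\<Sum>(x,y)\<in>?R \<times> ?R. add_char N (1 * x\<^sup>2 + c * d * y\<^sup>2))"
  \<comment> \<open>The substitution \<open>X = c * x0 * x + d * y0 * y\<close>,
    \<open>Y = x0 * y - y0 * x\<close> has determinant
    \<open>c * x0\<^sup>2 + d * y0\<^sup>2\<close>, which is 1 modulo N. Moreover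
    \<open>X\<^sup>2 + c * d * Y\<^sup>2\<close> is that determinant times
    \<open>c * x\<^sup>2 + d * y\<^sup>2\<close>.\<close>
  proof (rule sum.reindex_bij_witness[of _
      "\<lambda>(X,Y). ((x0 * X - d * y0 * Y) mod int N, (y0 * X + c * x0 * Y) mod int N)"
      "\<lambda>(x,y). ((c * x0 * x + d * y0 * y) mod int N, (x0 * y - y0 * x) mod int N)"])
    fix z assume z: "z \<in> ?R \<times> ?R"
    obtain x y where zxy: "z = (x, y)" by force
    let ?X = "c * x0 * x + d * y0 * y" and ?Y = "x0 * y - y0 * x"
    have X: "[?X mod int N = ?X] (mod int N)" and Y: "[?Y mod int N = ?Y] (mod int N)" by (simp_all add: cong_def)
    have "[x0 * (?X mod int N) - d * y0 * (?Y mod int N) = x0 * ?X - d * y0 * ?Y] (mod int N)"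
      by (intro cong_diff cong_mult cong_refl X Y)
    also have "x0 * ?X - d * y0 * ?Y = (c * x0\<^sup>2 + d * y0\<^sup>2) * x"
      by (simp add: power2_eq_square algebra_simps)
    also have "[\<dots> = x] (mod int N)" by (rule one)
    finally have 1: "(x0 * (?X mod int N) - d * y0 * (?Y mod int N)) mod int N = x"
      using z zxy red by (simp add: cong_def)
    have "[y0 * (?X mod int N) + c * x0 * (?Y mod int N) = y0 * ?X + c * x0 * ?Y] (mod int N)"
      by (intro cong_add cong_mult cong_refl X Y)
    also have "y0 * ?X + c * x0 * ?Y = (c * x0\<^sup>2 + d * y0\<^sup>2) * y"
      by (simp add: power2_eq_square algebra_simps)
    also have "[\<dots> = y] (mod int N)" by (rule one)
    finally have 2: "(y0 * (?X mod int N) + c * x0 * (?Y mod int N)) mod int N = y"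
      using z zxy red by (simp add: cong_def)
    show "(\<lambda>(X,Y). ((x0 * X - d * y0 * Y) mod int N, (y0 * X + c * x0 * Y) mod int N))
        ((\<lambda>(x,y). ((c * x0 * x + d * y0 * y) mod int N, (x0 * y - y0 * x) mod int N)) z) = z"
      using 1 2 by (simp add: zxy)
    show "(\<lambda>(x,y). ((c * x0 * x + d * y0 * y) mod int N, (x0 * y - y0 * x) mod int N)) z \<in> ?R \<times> ?R"
      using N by (auto simp: zxy)
    have "[1 * (?X mod int N)\<^sup>2 + c * d * (?Y mod int N)\<^sup>2 = 1 * ?X\<^sup>2 + c * d * ?Y\<^sup>2] (mod int N)"
      by (intro cong_add cong_mult cong_pow cong_refl X Y)
    also have "1 * ?X\<^sup>2 + c * d * ?Y\<^sup>2 = (c * x0\<^sup>2 + d * y0\<^sup>2) * (c * x\<^sup>2 + d * y\<^sup>2)"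
      by (simp add: power2_eq_square algebra_simps)
    also have "[\<dots> = c * x\<^sup>2 + d * y\<^sup>2] (mod int N)" by (rule one)
    finally show "(case (\<lambda>(x,y). ((c * x0 * x + d * y0 * y) mod int N, (x0 * y - y0 * x) mod int N)) z of
        (x, y) \<Rightarrow> add_char N (1 * x\<^sup>2 + c * d * y\<^sup>2)) = (case z of (x, y) \<Rightarrow> add_char N (c * x\<^sup>2 + d * y\<^sup>2))"
      by (simp only: zxy prod.case) (rule add_char_cong)
  next
    fix z assume z: "z \<in> ?R \<times> ?R"
    obtain X Y where zxy: "z = (X, Y)" by force
    let ?x = "x0 * X - d * y0 * Y" and ?y = "y0 * X + c * x0 * Y"
    have x: "[?x mod int N = ?x] (mod int N)" and y: "[?y mod int N = ?y] (mod int N)" by (simp_all add: cong_def)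
    have "[c * x0 * (?x mod int N) + d * y0 * (?y mod int N) = c * x0 * ?x + d * y0 * ?y] (mod int N)"
      by (intro cong_add cong_mult cong_refl x y)
    also have "c * x0 * ?x + d * y0 * ?y = (c * x0\<^sup>2 + d * y0\<^sup>2) * X"
      by (simp add: power2_eq_square algebra_simps)
    also have "[\<dots> = X] (mod int N)" by (rule one)
    finally have 1: "(c * x0 * (?x mod int N) + d * y0 * (?y mod int N)) mod int N = X"
      using z zxy red by (simp add: cong_def)
    have "[x0 * (?y mod int N) - y0 * (?x mod int N) = x0 * ?y - y0 * ?x] (mod int N)"
      by (intro cong_diff cong_mult cong_refl x y)
    also have "x0 * ?y - y0 * ?x = (c * x0\<^sup>2 + d * y0\<^sup>2) * Y"
      by (simp add: power2_eq_square algebra_simps)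
    also have "[\<dots> = Y] (mod int N)" by (rule one)
    finally have 2: "(x0 * (?y mod int N) - y0 * (?x mod int N)) mod int N = Y"
      using z zxy red by (simp add: cong_def)
    show "(\<lambda>(x,y). ((c * x0 * x + d * y0 * y) mod int N, (x0 * y - y0 * x) mod int N))
        ((\<lambda>(X,Y). ((x0 * X - d * y0 * Y) mod int N, (y0 * X + c * x0 * Y) mod int N)) z) = z"
      using 1 2 by (simp add: zxy)
    show "(\<lambda>(X,Y). ((x0 * X - d * y0 * Y) mod int N, (y0 * X + c * x0 * Y) mod int N)) z \<in> ?R \<times> ?R"
      using N by (auto simp: zxy)
  qed
  also have "\<dots> = gauss_sum 1 N * gauss_sum (c * d) N"
    unfolding gauss_sum_altdef sum_product by (simp add: sum.cartesian_product add_char_add)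
  finally show ?thesis .
qed

text \<open>It says that \<open>gauss_sum c m / gauss_sum 1 m\<close> is multiplicative on units.
  The relation holds for each prime by the pigeonhole lemma and is carried to m by splitting off one
  prime at a time.\<close>

lemma gauss_sum_mult_squarefree:
  assumes "squarefree m" "odd m" "coprime c (int m)" "coprime d (int m)"
  shows "gauss_sum c m * gauss_sum d m = gauss_sum 1 m * gauss_sum (c * d) m"
  using assms
proof (induction m arbitrary: c d rule: less_induct)
  case (less m)
  have m0: "m > 0" using less.prems by (auto intro!: Nat.gr0I)
  show ?case
  proof (cases "m = 1")
    case True
    thus ?thesis by (simp add: gauss_sum_def)
  next
    case False
    then obtain p where p: "prime p" "p dvd m" using prime_factor_nat by blast
    then obtain n where n: "m = p * n" by blast
    have n0: "n > 0" and p0: "p > 0" using m0 n by auto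
    have "coprime p n"
    proof (rule ccontr)
      assume "\<not> coprime p n"
      hence "p dvd n" using p(1) prime_imp_coprime by blast
      hence "p\<^sup>2 dvd m" by (simp add: n power2_eq_square)
      hence "p dvd 1" using less.prems(1) by (auto simp: squarefree_def)
      thus False using p(1) by simp
    qed
    have lt: "n < m" using p n n0 prime_gt_1_nat[of p] by simp
    have sqn: "squarefree n" using less.prems(1) n by (metis dvd_triv_right squarefree_mono)
    have odd: "odd p" "odd n" using less.prems(2) n by auto
    have cop: "coprime c (int p)" "coprime d (int p)" "coprime c (int n)" "coprime d (int n)"
       "coprime (int n) (int p)" "coprime (int p) (int n)"
      using less.prems(3,4) n \<open>coprime p n\<close> by (auto simp: coprime_commute)
    have H: "gauss_sum a p * gauss_sum b p = gauss_sum 1 p * gauss_sum (a * b) p"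
      if "coprime a (int p)" "coprime b (int p)" for a b
      using binary_diagonal_form_represents_one[OF p(1) odd(1) that] gauss_sum_mult[OF p0] by blast
    have K: "gauss_sum a n * gauss_sum b n = gauss_sum 1 n * gauss_sum (a * b) n"
      if "coprime a (int n)" "coprime b (int n)" for a b
      using less.IH[OF lt sqn odd(2) that] .
    have "gauss_sum c m * gauss_sum d m =
          (gauss_sum (c * int n) p * gauss_sum (d * int n) p) * (gauss_sum (c * int p) n * gauss_sum (d * int p) n)"
      unfolding n by (simp add: gauss_sum_coprime_product[OF \<open>coprime p n\<close> p0 n0])
    also have "gauss_sum (c * int n) p * gauss_sum (d * int n) p = gauss_sum 1 p * gauss_sum ((c * int n) * (d * int n)) p"
      by (rule H) (use cop in auto)
    also have "(c * int n) * (d * int n) = int n * (c * d * int n)" by simp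
    \<comment> \<open>The relation is now used backwards with the factorisation
      \<open>n * (c * d * n)\<close>. This restores the multipliers under which the sums modulo p
      and n recombine to sums modulo m.\<close>
    also have "gauss_sum 1 p * gauss_sum \<dots> p = gauss_sum (int n) p * gauss_sum (c * d * int n) p"
      by (rule H [symmetric]) (use cop in auto)
    also have "gauss_sum (c * int p) n * gauss_sum (d * int p) n = gauss_sum 1 n * gauss_sum ((c * int p) * (d * int p)) n"
      by (rule K) (use cop in auto)
    also have "(c * int p) * (d * int p) = int p * (c * d * int p)" by simp
    also have "gauss_sum 1 n * gauss_sum \<dots> n = gauss_sum (int p) n * gauss_sum (c * d * int p) n"
      by (rule K [symmetric]) (use cop in auto)
    also have "gauss_sum (int n) p * gauss_sum (c * d * int n) p * (gauss_sum (int p) n * gauss_sum (c * d * int p) n) =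
       gauss_sum 1 m * gauss_sum (c * d) m"
      unfolding n by (simp add: gauss_sum_coprime_product[OF \<open>coprime p n\<close> p0 n0])
    finally show ?thesis .
  qed
qed

section \<open>Conductors and Gauss sums of primitive real characters\<close>

lemma dirichlet_character_cong:
  assumes chi: "dirichlet_character q chi" and ab: "[a = b] (mod int q)"
  shows "chi a = chi b"
proof -
  have per: "chi (x + int q) = chi x" for x using chi by (auto simp: dirichlet_character_def)
  have nat: "chi (x + int n * int q) = chi x" for x n
  proof (induction n)
    case (Suc n)
    thus ?case using per[of "x + int n * int q"] by (simp add: algebra_simps)
  qed auto
  have "chi (x + k * int q) = chi x" for x k
  proof (cases "k \<ge> 0")
    case True
    thus ?thesis using nat[of x "nat k"] by simp
  next
    case False
    thus ?thesis using nat[of "x + k * int q" "nat (-k)"] by simp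
  qed
  moreover obtain k where "a = b + int q * k"
    using ab by (metis cong_iff_lin cong_sym)
  ultimately show ?thesis by (simp add: mult.commute)
qed

locale primitive_quadratic =
  fixes q :: nat and chi :: "int \<Rightarrow> complex"
  assumes char: "dirichlet_character q chi" and q_pos: "q > 0"
    and chi_values: "chi a \<in> {-1, 0, 1}"
    and primitive: "d dvd q \<Longrightarrow> d < q \<Longrightarrow> \<exists>n. coprime n (int q) \<and> [n = 1] (mod int d) \<and> chi n \<noteq> 1"
begin

lemma chi_mult: "chi (a * b) = chi a * chi b"
  using char by (auto simp: dirichlet_character_def)

lemma chi_eq_0_iff: "chi a = 0 \<longleftrightarrow> \<not> coprime a (int q)"
  using char by (auto simp: dirichlet_character_def)

lemmas chi_cong = dirichlet_character_cong[OF char]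

lemma chi_1 [simp]: "chi 1 = 1"
  using chi_mult[of 1 1] chi_eq_0_iff[of 1] by simp

lemma chi_square: "coprime a (int q) \<Longrightarrow> chi a * chi a = 1"
  using chi_values[of a] chi_eq_0_iff[of a] by auto

lemma chi_minus_1: "chi (-1) = 1 \<or> chi (-1) = -1"
  using chi_values[of "-1"] chi_eq_0_iff[of "-1"] by auto

lemma chi_minus: "chi (- a) = chi (-1) * chi a"
  using chi_mult[of "-1" a] by simp

definition tau :: complex where
  "tau = (\<Sum>a\<in>{0..<int q}. chi a * add_char q a)"

text \<open>For k prime to q this is a change of variable. Otherwise k is fixed modulo q by every n
  congruent to 1 modulo \<open>q / gcd k q\<close>, and primitivity supplies such an n with
  \<open>chi n\<close> different from 1, so the sum vanishes.\<close>

lemma twisted_gauss_sum: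
  "(\<Sum>a\<in>{0..<int q}. chi a * add_char q (a * k)) = chi k * tau"
proof (cases "coprime k (int q)")
  case True
  have "chi k * (\<Sum>a\<in>{0..<int q}. chi (a * k) * add_char q (a * k)) = chi k * tau"
    unfolding tau_def
    by (subst sum_residues_mult[OF q_pos _ True, of "\<lambda>a. chi a * add_char q a"])
       (auto simp: chi_cong add_char_cong)
  also have "chi k * (\<Sum>a\<in>{0..<int q}. chi (a * k) * add_char q (a * k)) =
     (\<Sum>a\<in>{0..<int q}. (chi k * chi k) * (chi a * add_char q (a * k)))"
    by (simp add: chi_mult sum_distrib_left mult_ac)
  finally show ?thesis by (simp add: chi_square[OF True])
next
  case False
  define g where "g = gcd k (int q)"
  define d where "d = q div nat g"
  have g: "g > 1"
  proof -
    have "g > 0" using q_pos by (simp add: g_def)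
    moreover have "g \<noteq> 1" using False by (auto simp: g_def coprime_iff_gcd_eq_1)
    ultimately show ?thesis by linarith
  qed
  obtain k' where k': "k = g * k'" by (metis g_def gcd_dvd1 dvdE)
  have "int (nat g) dvd int q" using g by (simp add: g_def)
  hence "nat g dvd q" by (simp only: int_dvd_int_iff)
  hence qd: "q = nat g * d" by (simp add: d_def)
  hence qd': "int q = g * int d" using g by simp
  have "d < q" using qd q_pos g by (cases "d = 0") auto
  moreover have "d dvd q" using qd by simp
  ultimately obtain n where n: "coprime n (int q)" "[n = 1] (mod int d)" "chi n \<noteq> 1"
    using primitive by blast
  have nk: "[n * k = k] (mod int q)"
  proof -
    obtain j where "n = 1 + int d * j" using n(2) by (metis cong_iff_lin cong_sym)
    hence "n * k = k + int q * (j * k')" by (simp add: k' qd' algebra_simps)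
    thus ?thesis by (simp add: cong_def)
  qed
  let ?T = "\<Sum>a\<in>{0..<int q}. chi a * add_char q (a * k)"
  have "?T = (\<Sum>a\<in>{0..<int q}. chi (a * n) * add_char q (a * n * k))"
    by (rule sum_residues_mult[OF q_pos _ n(1), symmetric, of "\<lambda>a. chi a * add_char q (a * k)"])
       (metis chi_cong add_char_cong cong_mult cong_refl)
  also have "\<dots> = (\<Sum>a\<in>{0..<int q}. chi n * (chi a * add_char q (a * k)))"
  proof (rule sum.cong[OF refl])
    fix a
    have "add_char q (a * n * k) = add_char q (a * k)"
      unfolding mult.assoc by (intro add_char_cong cong_mult cong_refl nk)
    thus "chi (a * n) * add_char q (a * n * k) = chi n * (chi a * add_char q (a * k))"
      by (simp add: chi_mult)
  qed
  also have "\<dots> = chi n * ?T" by (simp add: sum_distrib_left)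
  finally have "?T = 0" using n(3) by (metis mult_cancel_right1)
  thus ?thesis using False by (simp add: chi_eq_0_iff)
qed

text \<open>If \<open>tau\<close> vanished, so would all finite Fourier coefficients of
  \<open>chi\<close>, whereas Fourier inversion at the residue 1 gives q.\<close>

lemma tau_nonzero: "tau \<noteq> 0"
proof
  assume "tau = 0"
  hence "0 = (\<Sum>k\<in>{0..<int q}. add_char q (- k) * (\<Sum>a\<in>{0..<int q}. chi a * add_char q (a * k)))"
    by (simp add: twisted_gauss_sum)
  also have "\<dots> = (\<Sum>a\<in>{0..<int q}. chi a * (\<Sum>k\<in>{0..<int q}. add_char q ((a - 1) * k)))"
    unfolding sum_distrib_left
    by (subst sum.swap, intro sum.cong refl) (simp add: algebra_simps flip: add_char_add)
  also have "\<dots> = (\<Sum>a\<in>{0..<int q}. if a = 1 mod int q then of_nat q else 0)"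
  proof (rule sum.cong[OF refl])
    fix a assume a: "a \<in> {0..<int q}"
    have "int q dvd a - 1 \<longleftrightarrow> a = 1 mod int q"
      using a by (auto simp: mod_eq_dvd_iff [symmetric])
    moreover have "chi (1 mod int q) = chi 1" by (rule chi_cong) (simp add: cong_def)
    ultimately show "chi a * (\<Sum>k\<in>{0..<int q}. add_char q ((a - 1) * k)) = (if a = 1 mod int q then of_nat q else 0)"
      by (simp add: sum_add_char[OF q_pos])
  qed
  also have "\<dots> = of_nat q" using q_pos by simp
  finally show False using q_pos by simp
qed

lemma cnj_chi: "cnj (chi a) = chi a"
  using chi_values[of a] by auto

lemma cnj_tau: "cnj tau = chi (-1) * tau"
  using twisted_gauss_sum[of "-1"] by (simp add: tau_def cnj_chi cnj_add_char)

text \<open>Euler's totient of q, written through \<open>chi\<close> so that it appears directly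
  when characters are summed.\<close>

definition phi :: complex where
  "phi = (\<Sum>n\<in>{0..<int q}. chi n * chi n)"

lemma phi_nonzero: "phi \<noteq> 0"
proof -
  have "chi n * chi n = of_real (if coprime n (int q) then 1 else 0)" for n
    using chi_square[of n] chi_eq_0_iff[of n] by auto
  hence "phi = of_real (\<Sum>n\<in>{0..<int q}. if coprime n (int q) then 1 else 0)"
    by (simp add: phi_def)
  moreover have "(\<Sum>n\<in>{0..<int q}. if coprime n (int q) then 1 else 0 :: real) \<ge>
                 (\<Sum>n\<in>{1 mod int q}. if coprime n (int q) then 1 else 0)"
    by (rule sum_mono2) (use q_pos in auto)
  moreover have "coprime (1 mod int q) (int q)" by (cases "q = 1") (use q_pos in auto)
  ultimately show ?thesis by (auto simp: of_real_eq_0_iff simp del: of_real_sum)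
qed

text \<open>Each unit n contributes \<open>chi (n\<^sup>2) * tau = tau\<close>. Hence
  \<open>tau\<close> is known as soon as the dependence of \<open>gauss_sum c q\<close> on c
  is.\<close>

lemma sum_chi_gauss_sum:
  "(\<Sum>c\<in>{0..<int q}. chi c * gauss_sum c q) = phi * tau"
proof -
  have "(\<Sum>c\<in>{0..<int q}. chi c * gauss_sum c q) =
        (\<Sum>n\<in>{0..<int q}. \<Sum>c\<in>{0..<int q}. chi c * add_char q (c * n\<^sup>2))"
    unfolding gauss_sum_altdef sum_distrib_left by (rule sum.swap)
  also have "\<dots> = phi * tau"
    by (simp add: twisted_gauss_sum phi_def chi_mult power2_eq_square sum_distrib_right)
  finally show ?thesis .
qed

text \<open>Orthogonality for a function \<open>w\<close> that is multiplicative only on units; the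
  factor \<open>chi a * chi a\<close> is the indicator of the units.\<close>

lemma sum_unit_character:
  assumes cong: "\<And>a b. [a = b] (mod int q) \<Longrightarrow> w a = w b"
    and mult: "\<And>a u. coprime u (int q) \<Longrightarrow> coprime a (int q) \<Longrightarrow> w (a * u) = w a * w u"
  shows "(\<Sum>a\<in>{0..<int q}. chi a * chi a * w a) \<in> {0, phi}"
proof (cases "\<exists>u. coprime u (int q) \<and> w u \<noteq> 1")
  case True
  then obtain u where u: "coprime u (int q)" "w u \<noteq> 1" by blast
  let ?T = "\<Sum>a\<in>{0..<int q}. chi a * chi a * w a"
  have "?T = (\<Sum>a\<in>{0..<int q}. chi (a * u) * chi (a * u) * w (a * u))"
    by (rule sum_residues_mult[OF q_pos _ u(1), symmetric, of "\<lambda>a. chi a * chi a * w a"])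
       (metis chi_cong cong)
  also have "\<dots> = (\<Sum>a\<in>{0..<int q}. w u * (chi a * chi a * w a))"
  proof (rule sum.cong[OF refl])
    fix a
    show "chi (a * u) * chi (a * u) * w (a * u) = w u * (chi a * chi a * w a)"
    proof (cases "coprime a (int q)")
      case True
      have "chi (a * u) * chi (a * u) = (chi a * chi a) * (chi u * chi u)"
        by (simp add: chi_mult)
      thus ?thesis using True u mult[OF u(1) True] by (simp add: chi_square)
    next
      case False
      hence "chi a = 0" by (simp add: chi_eq_0_iff)
      thus ?thesis by (simp add: chi_mult)
    qed
  qed
  also have "\<dots> = w u * ?T" by (simp add: sum_distrib_left)
  finally have "?T = 0" using u(2) by (metis mult_cancel_right1)
  thus ?thesis by simp
next
  case False
  hence "chi a * chi a * w a = chi a * chi a" for a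
    by (cases "coprime a (int q)") (auto simp: chi_eq_0_iff)
  hence "(\<Sum>a\<in>{0..<int q}. chi a * chi a * w a) = phi"
    unfolding phi_def by (intro sum.cong refl)
  thus ?thesis by simp
qed

text \<open>A unit congruent to 1 modulo \<open>q / p\<close> has p-th power congruent to 1 modulo q
  when \<open>p\<^sup>2\<close> divides q. For odd p this excludes the value -1, contradicting
  primitivity.\<close>

lemma prime_square_not_dvd:
  assumes "prime p" "odd p" "p\<^sup>2 dvd q"
  shows False
proof -
  obtain t where t: "q = p\<^sup>2 * t" using assms(3) by blast
  have p0: "p > 1" using assms(1) prime_gt_1_nat by blast
  have t0: "t > 0" using t q_pos by (auto intro!: Nat.gr0I)
  have "p * t dvd q" "p * t < q" using t t0 p0 by (auto simp: power2_eq_square)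
  then obtain n where n: "coprime n (int q)" "[n = 1] (mod int (p * t))" "chi n \<noteq> 1"
    using primitive by blast
  obtain j where j: "n = 1 + int (p * t) * j" using n(2) by (metis cong_iff_lin cong_sym)
  have "[n ^ k = 1 + int (p * t) * j * int k] (mod int q)" for k
  proof (induction k)
    case (Suc k)
    have "[n ^ Suc k = n * (1 + int (p * t) * j * int k)] (mod int q)"
      using cong_mult[OF cong_refl[of n] Suc] by simp
    also have "n * (1 + int (p * t) * j * int k) =
        1 + int (p * t) * j * int (Suc k) + int q * (int t * j\<^sup>2 * int k)"
      by (simp add: j t power2_eq_square algebra_simps)
    also have "[\<dots> = 1 + int (p * t) * j * int (Suc k)] (mod int q)" by (simp add: cong_def)
    finally show ?case .
  qed auto
  from this[of p] have "[n ^ p = 1 + int q * j] (mod int q)"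
    by (simp add: t power2_eq_square mult_ac)
  hence "[n ^ p = 1] (mod int q)" by (simp add: cong_def)
  hence "chi (n ^ p) = 1" using chi_cong by fastforce
  moreover have "chi (n ^ k) = chi n ^ k" for k by (induction k) (auto simp: chi_mult)
  ultimately have "chi n ^ p = 1" by simp
  moreover have "chi n = -1" using n chi_values[of n] chi_eq_0_iff[of n] by auto
  ultimately show False using assms(2) by simp
qed

text \<open>If 16 divides q, every unit congruent to 1 modulo \<open>q / 2\<close> is a square
  modulo q, so \<open>chi\<close> is 1 there.\<close>

lemma not_dvd_16: "\<not> 16 dvd q"
proof
  assume "16 dvd q"
  then obtain t where t: "q = 16 * t" by blast
  have "8 * t dvd q" "8 * t < q" using t q_pos by auto
  then obtain n where n: "coprime n (int q)" "[n = 1] (mod int (8 * t))" "chi n \<noteq> 1"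
    using primitive by blast
  obtain j where j: "n = 1 + int (8 * t) * j" using n(2) by (metis cong_iff_lin cong_sym)
  let ?m = "1 + int (4 * t) * j"
  have "?m * ?m = n + int q * (int t * j\<^sup>2)" by (simp add: j t power2_eq_square algebra_simps)
  hence "[?m * ?m = n] (mod int q)" by (simp add: cong_def)
  hence "chi ?m * chi ?m = chi n" using chi_cong chi_mult by metis
  thus False using n chi_values[of ?m] chi_eq_0_iff[of n] by auto
qed

text \<open>Units are odd, so congruence to 1 modulo the odd number \<open>q / 2\<close> already
  gives congruence to 1 modulo q.\<close>

lemma not_2_mod_4: "q mod 4 \<noteq> 2"
proof
  assume "q mod 4 = 2"
  hence "q = 2 * (2 * (q div 4) + 1)" by presburger
  then obtain t where t: "q = 2 * t" "odd t" by (intro that[of "2 * (q div 4) + 1"]) simp_all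
  have "t dvd q" "t < q" using t q_pos by auto
  then obtain n where n: "coprime n (int q)" "[n = 1] (mod int t)" "chi n \<noteq> 1"
    using primitive by blast
  have "odd n"
  proof
    assume "even n"
    moreover have "even (int q)" using t by simp
    ultimately have "is_unit (2 :: int)" using n(1) coprime_common_divisor by blast
    thus False by simp
  qed
  hence "[n = 1] (mod 2)" by (simp add: cong_def odd_iff_mod_2_eq_one)
  moreover have "coprime (2::int) (int t)" using t(2) by simp
  ultimately have "[n = 1] (mod 2 * int t)" using n(2) coprime_cong_mult by blast
  hence "chi n = chi 1" using t by (intro chi_cong) simp
  thus False using n(3) by simp
qed

end

section \<open>Explicit quadratic Gauss sums, in particular for the moduli 4 and 8\<close>

lemma gauss_sum_1_mod_4:
  assumes N: "N > 0"
  shows "N mod 4 = 0 \<Longrightarrow> gauss_sum 1 N = of_real (sqrt N) * (1 + \<i>)"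
    and "N mod 4 = 1 \<Longrightarrow> gauss_sum 1 N = of_real (sqrt N)"
    and "N mod 4 = 3 \<Longrightarrow> gauss_sum 1 N = \<i> * of_real (sqrt N)"
proof -
  define t where "t = N div 4"
  have e: "unit_exp (- real N / 4) = unit_exp (- (real (N mod 4) / 4))"
  proof -
    have "real N = 4 * real t + real (N mod 4)"
      unfolding t_def by (metis mult_div_mod_eq of_nat_add of_nat_mult of_nat_numeral)
    hence "- real N / 4 = - (real (N mod 4) / 4) + of_int (- int t)" by simp
    thus ?thesis by (simp only: unit_exp_add_int)
  qed
  have g: "gauss_sum 1 N = of_real (sqrt N) * (1 + unit_exp (- (real (N mod 4) / 4))) * (1 + \<i>) / 2"
    using gauss_sum_eval[OF N] by (simp only: e)
  have "unit_exp (- (3 / 4)) = \<i>"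
    using unit_exp_add_int[of "- (3 / 4)" 1] unit_exp_quarter(1) by simp
  thus "N mod 4 = 0 \<Longrightarrow> gauss_sum 1 N = of_real (sqrt N) * (1 + \<i>)"
    "N mod 4 = 1 \<Longrightarrow> gauss_sum 1 N = of_real (sqrt N)"
    "N mod 4 = 3 \<Longrightarrow> gauss_sum 1 N = \<i> * of_real (sqrt N)"
    unfolding g by (simp_all add: unit_exp_quarter algebra_simps)
qed

lemma gauss_sum_1_odd_nonzero: "odd N \<Longrightarrow> gauss_sum 1 N \<noteq> 0"
proof -
  assume "odd N"
  hence "N > 0" "N mod 4 = 1 \<or> N mod 4 = 3" by (auto elim: oddE intro: Nat.gr0I) presburger
  thus ?thesis using gauss_sum_1_mod_4[of N] by auto
qed

lemma gauss_sum_4: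
  "[a = 1] (mod 4) \<Longrightarrow> gauss_sum a 4 = 2 + 2 * \<i>"
  "[a = 3] (mod 4) \<Longrightarrow> gauss_sum a 4 = 2 - 2 * \<i>"
proof -
  have s: "{..<4::nat} = {0, 1, 2, 3}" by auto
  have [simp]: "unit_exp (9 / 4) = \<i>"
    using unit_exp_add_int[of "1/4" 2] by (simp add: unit_exp_quarter)
  have [simp]: "unit_exp (3 / 4) = - \<i>" "unit_exp (27 / 4) = - \<i>"
    using unit_exp_add_int[of "-(1/4)" 1] unit_exp_add_int[of "-(1/4)" 7] by (simp_all add: unit_exp_quarter)
  have [simp]: "unit_exp 3 = 1" using unit_exp_of_int[of 3] by simp
  have 1: "gauss_sum 1 4 = 2 + 2 * \<i>" and 3: "gauss_sum 3 4 = 2 - 2 * \<i>"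
    by (simp_all add: gauss_sum_def s unit_exp_quarter)
  show "[a = 1] (mod 4) \<Longrightarrow> gauss_sum a 4 = 2 + 2 * \<i>"
    using gauss_sum_cong[of a 1 4] 1 by simp
  show "[a = 3] (mod 4) \<Longrightarrow> gauss_sum a 4 = 2 - 2 * \<i>"
    using gauss_sum_cong[of a 3 4] 3 by simp
qed

lemma gauss_sum_8_odd:
  assumes "odd a"
  shows "gauss_sum a 8 = 4 * add_char 8 a"
proof -
  have s: "{0..<int 8} = {0, 1, 2, 3, 4, 5, 6, 7}" by auto
  obtain t where t: "a = 2 * t + 1" using assms by (elim oddE)
  have c1: "add_char 8 (a * 9) = add_char 8 a" "add_char 8 (a * 25) = add_char 8 a"
    "add_char 8 (a * 49) = add_char 8 a" "add_char 8 (a * 36) = add_char 8 (a * 4)"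
    by (auto intro!: add_char_cong simp: cong_iff_dvd_diff)
  have c2: "add_char 8 (a * 16) = 1"
    using add_char_mult_modulus[of 8 "2 * a"] by (simp add: mult.commute)
  have "[a * 4 = 4] (mod int 8)" by (simp add: t cong_iff_dvd_diff algebra_simps)
  hence "add_char 8 (a * 4) = add_char 8 4" by (rule add_char_cong)
  also have "\<dots> = -1" by (simp add: add_char_def unit_exp_quarter)
  finally have "add_char 8 (a * 4) = -1" .
  thus ?thesis unfolding gauss_sum_altdef s by (simp add: c1 c2)
qed

lemma unit_exp_eighths:
  "add_char 8 3 = \<i> * add_char 8 1" "add_char 8 5 = - add_char 8 1" "add_char 8 7 = - \<i> * add_char 8 1"
proof -
  have "add_char 8 (1 + 2) = add_char 8 1 * \<i>" "add_char 8 (1 + 4) = add_char 8 1 * (-1)"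
    unfolding add_char_add by (simp_all add: add_char_def unit_exp_quarter)
  moreover have "add_char 8 (1 + 6) = add_char 8 1 * (- \<i>)"
    unfolding add_char_add
    using unit_exp_add_int[of "-(1/4)" 1] by (simp add: add_char_def unit_exp_quarter)
  ultimately show "add_char 8 3 = \<i> * add_char 8 1" "add_char 8 5 = - add_char 8 1"
    "add_char 8 7 = - \<i> * add_char 8 1" by simp_all
qed

lemma gauss_sum_8:
  assumes "a mod 8 \<in> {1, 3, 5, 7}"
  shows "gauss_sum a 8 = 4 * add_char 8 1 *
    (if a mod 8 = 1 then 1 else if a mod 8 = 3 then \<i> else if a mod 8 = 5 then -1 else -\<i>)"
proof -
  have "a mod 8 = 1 \<or> a mod 8 = 3 \<or> a mod 8 = 5 \<or> a mod 8 = 7" using assms by auto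
  hence "odd a" by presburger
  moreover have "add_char 8 a = add_char 8 (a mod 8)" by (rule add_char_cong) simp
  ultimately show ?thesis using assms unit_exp_eighths by (auto simp: gauss_sum_8_odd)
qed

text \<open>On odd arguments these are the nontrivial character modulo 4 and the Kronecker symbols
  of 2 and -2. The value -1 at even arguments is a filler; only odd arguments matter.\<close>

definition sign4 :: "int \<Rightarrow> complex" where "sign4 a = (if a mod 4 = 1 then 1 else -1)"
definition sign8 :: "int \<Rightarrow> complex" where "sign8 a = (if a mod 8 \<in> {1, 7} then 1 else -1)"
definition sign8' :: "int \<Rightarrow> complex" where "sign8' a = (if a mod 8 \<in> {1, 3} then 1 else -1)"

lemma odd_mod_8: "odd (a :: int) \<Longrightarrow> a mod 8 = 1 \<or> a mod 8 = 3 \<or> a mod 8 = 5 \<or> a mod 8 = 7"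
  by presburger

lemma odd_mod_4: "odd (a :: int) \<Longrightarrow> a mod 4 = 1 \<or> a mod 4 = 3"
  by presburger

lemma sign_mult:
  assumes "odd a" "odd b"
  shows "sign4 (a * b) = sign4 a * sign4 b" "sign8 (a * b) = sign8 a * sign8 b"
    "sign8' (a * b) = sign8' a * sign8' b"
proof -
  have 4: "(a * b) mod 4 = ((a mod 4) * (b mod 4)) mod 4" by (simp add: mod_mult_eq)
  have 8: "(a * b) mod 8 = ((a mod 8) * (b mod 8)) mod 8" by (simp add: mod_mult_eq)
  show "sign4 (a * b) = sign4 a * sign4 b"
    unfolding sign4_def 4 using odd_mod_4[OF assms(1)] odd_mod_4[OF assms(2)] by auto
  show "sign8 (a * b) = sign8 a * sign8 b"
    unfolding sign8_def 8 using odd_mod_8[OF assms(1)] odd_mod_8[OF assms(2)] by auto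
  show "sign8' (a * b) = sign8' a * sign8' b"
    unfolding sign8'_def 8 using odd_mod_8[OF assms(1)] odd_mod_8[OF assms(2)] by auto
qed

lemma sign_cong:
  "4 dvd q \<Longrightarrow> [a = b] (mod q) \<Longrightarrow> sign4 a = sign4 b"
  "8 dvd q \<Longrightarrow> [a = b] (mod q) \<Longrightarrow> sign8 a = sign8 b"
  "8 dvd q \<Longrightarrow> [a = b] (mod q) \<Longrightarrow> sign8' a = sign8' b"
  unfolding sign4_def sign8_def sign8'_def cong_def by (metis mod_mod_cancel)+

text \<open>For even moduli the ratio of Gauss sums is not itself a character of c. Multiplied by
  \<open>1 + \<i>\<close> it splits as \<open>A c + \<i> * B c\<close> with two characters A and B,
  which depend on m modulo 4.\<close>

lemma gauss_sum_4_ratio: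
  assumes "odd c" "odd m"
  shows "(1 + \<i>) * gauss_sum (c * m) 4 =
    ((if m mod 4 = 1 then 1 else sign4 c) + \<i> * (if m mod 4 = 1 then sign4 c else 1)) * gauss_sum m 4"
proof -
  have "(c * m) mod 4 = ((c mod 4) * (m mod 4)) mod 4" by (simp add: mod_mult_eq)
  thus ?thesis
    using odd_mod_4[OF assms(1)] odd_mod_4[OF assms(2)]
    by (elim disjE) (simp_all add: gauss_sum_4 cong_def sign4_def algebra_simps)
qed

lemma gauss_sum_8_ratio:
  assumes "odd c" "odd m"
  shows "(1 + \<i>) * gauss_sum (c * m) 8 =
    ((if m mod 4 = 1 then sign8 c else sign8' c) + \<i> * (if m mod 4 = 1 then sign8' c else sign8 c)) * gauss_sum m 8"
proof -
  have cm: "(c * m) mod 8 = ((c mod 8) * (m mod 8)) mod 8" by (simp add: mod_mult_eq)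
  have m4: "m mod 4 = (m mod 8) mod 4" by (simp add: mod_mod_cancel)
  show ?thesis
    unfolding m4
    using odd_mod_8[OF assms(1)] odd_mod_8[OF assms(2)] cm
    by (elim disjE) (simp_all add: gauss_sum_8 sign8_def sign8'_def algebra_simps)
qed

section \<open>The sign of the Gauss sum of a primitive real character\<close>

context primitive_quadratic
begin

lemma squarefree_odd_part:
  assumes "m dvd q" "odd m"
  shows "squarefree m"
proof (rule squarefreeI)
  fix x assume x: "x\<^sup>2 dvd m"
  show "x dvd 1"
  proof (rule ccontr)
    assume "\<not> x dvd 1"
    hence "x \<noteq> 1" by auto
    then obtain p where p: "prime p" "p dvd x" using prime_factor_nat by blast
    have "p\<^sup>2 dvd m" using p(2) x by (meson dvd_power_same dvd_trans)
    hence "p\<^sup>2 dvd q" "odd p" using assms by (auto elim: dvd_trans)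
    thus False using prime_square_not_dvd p(1) by blast
  qed
qed

lemma odd_coprime_even: "even q \<Longrightarrow> coprime a (int q) \<Longrightarrow> odd a"
  using coprime_common_divisor[of a "int q" 2] by auto

text \<open>For squarefree odd q the ratio \<open>J\<close> is a character, so
  \<open>phi * tau\<close> is \<open>gauss_sum 1 q\<close> times 0 or \<open>phi\<close>, and 0 is
  excluded by \<open>tau_nonzero\<close>.\<close>

lemma tau_odd:
  assumes q: "odd q"
  shows "tau = gauss_sum 1 q"
proof -
  define J where "J = (\<lambda>c. gauss_sum c q / gauss_sum 1 q)"
  have G: "gauss_sum 1 q \<noteq> 0" by (rule gauss_sum_1_odd_nonzero[OF q])
  have J: "J (c * d) = J c * J d" if "coprime c (int q)" "coprime d (int q)" for c d
    using gauss_sum_mult_squarefree[OF squarefree_odd_part q that] q G by (simp add: J_def field_simps)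
  have "phi * tau = (\<Sum>c\<in>{0..<int q}. chi c * gauss_sum c q)" by (simp add: sum_chi_gauss_sum)
  also have "\<dots> = (\<Sum>c\<in>{0..<int q}. gauss_sum 1 q * (chi c * chi c * (chi c * J c)))"
  proof (rule sum.cong[OF refl])
    fix c
    have "chi c * chi c * chi c = chi c" using chi_values[of c] by auto
    hence "chi c * chi c * (chi c * J c) = chi c * J c" by (simp add: mult.assoc [symmetric])
    thus "chi c * gauss_sum c q = gauss_sum 1 q * (chi c * chi c * (chi c * J c))"
      using G by (simp add: J_def)
  qed
  also have "\<dots> = gauss_sum 1 q * (\<Sum>c\<in>{0..<int q}. chi c * chi c * (chi c * J c))"
    by (simp add: sum_distrib_left)
  finally have eq: "phi * tau = gauss_sum 1 q * (\<Sum>c\<in>{0..<int q}. chi c * chi c * (chi c * J c))" .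
  have "(\<Sum>c\<in>{0..<int q}. chi c * chi c * (chi c * J c)) \<in> {0, phi}"
  proof (rule sum_unit_character)
    show "chi a * J a = chi b * J b" if "[a = b] (mod int q)" for a b
      using chi_cong[OF that] gauss_sum_cong[OF that] by (simp add: J_def)
  qed (simp add: chi_mult J)
  thus ?thesis using eq phi_nonzero tau_nonzero by auto
qed

text \<open>The two characters in the ratio of Gauss sums contribute independently. Each of the two
  sums is 0 or \<open>phi\<close>, which leaves \<open>tau\<close> equal to \<open>sqrt q\<close>
  times 0, 1, \<open>\<i>\<close> or \<open>1 + \<i>\<close>.\<close>

lemma tau_even:
  assumes q: "4 dvd q"
  shows "tau = of_real (sqrt q) \<or> tau = \<i> * of_real (sqrt q)"
proof -
  obtain r m where rm: "q = r * m" "odd m" "r = 4 \<or> r = 8"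
  proof (cases "8 dvd q")
    case True
    then obtain m where m: "q = 8 * m" by blast
    have "odd m" using not_dvd_16 m by auto
    thus ?thesis using that[of 8 m] m by simp
  next
    case False
    obtain m where m: "q = 4 * m" using q by blast
    have "odd m" using False m by auto
    thus ?thesis using that[of 4 m] m by simp
  qed
  have m0: "m > 0" using rm by (auto intro: Nat.gr0I)
  have cop: "coprime r m" using rm(2,3) coprime_power_left_iff[of 2 2 m] coprime_power_left_iff[of 2 3 m] by auto
  define A where "A = (\<lambda>c. if r = 4 then (if int m mod 4 = 1 then 1 else sign4 c)
                          else (if int m mod 4 = 1 then sign8 c else sign8' c))"
  define B where "B = (\<lambda>c. if r = 4 then (if int m mod 4 = 1 then sign4 c else 1)
                          else (if int m mod 4 = 1 then sign8' c else sign8 c))"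
  have AB: "(1 + \<i>) * gauss_sum (c * int m) r = (A c + \<i> * B c) * gauss_sum (int m) r" if "odd c" for c
    using gauss_sum_4_ratio[OF that, of "int m"] gauss_sum_8_ratio[OF that, of "int m"] rm
    by (auto simp: A_def B_def)
  have Amult: "A (c * d) = A c * A d" and Bmult: "B (c * d) = B c * B d" if "odd c" "odd d" for c d
    using sign_mult[OF that] by (simp_all add: A_def B_def)
  have Acong: "A c = A d" and Bcong: "B c = B d" if "[c = d] (mod int q)" for c d
  proof -
    have "r = 4 \<Longrightarrow> sign4 c = sign4 d" "r = 8 \<Longrightarrow> sign8 c = sign8 d" "r = 8 \<Longrightarrow> sign8' c = sign8' d"
      using that rm by (auto intro!: sign_cong[of "int q"])
    thus "A c = A d" "B c = B d" using rm(3) by (auto simp: A_def B_def)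
  qed
  define J where "J = (\<lambda>c. gauss_sum c m / gauss_sum 1 m)"
  have G: "gauss_sum 1 m \<noteq> 0" by (rule gauss_sum_1_odd_nonzero[OF rm(2)])
  have sq: "squarefree m" using squarefree_odd_part[OF _ rm(2)] rm(1) by simp
  have copm: "coprime c (int m)" if "coprime c (int q)" for c using that rm by auto
  have J: "J (c * d) = J c * J d" if "coprime c (int m)" "coprime d (int m)" for c d
    using gauss_sum_mult_squarefree[OF sq rm(2) that] G by (simp add: J_def field_simps)
  have evq: "even q" using q by auto
  have r0: "r > 0" using rm(3) by auto
  have Jm: "gauss_sum (c * int r) m = J c * gauss_sum (int r) m" if "coprime c (int q)" for c
  proof -
    have "coprime (int r) (int m)" using cop by simp
    from J[OF copm[OF that] this] show ?thesis using G by (simp add: J_def field_simps)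
  qed
  have main: "(1 + \<i>) * gauss_sum c q = (A c + \<i> * B c) * J c * gauss_sum 1 q" if "coprime c (int q)" for c
  proof -
    have "(1 + \<i>) * gauss_sum c q = ((1 + \<i>) * gauss_sum (c * int m) r) * gauss_sum (c * int r) m"
      unfolding rm(1) by (simp add: gauss_sum_coprime_product[OF cop r0 m0])
    also have "\<dots> = (A c + \<i> * B c) * J c * (gauss_sum (1 * int m) r * gauss_sum (1 * int r) m)"
      using AB[OF odd_coprime_even[OF evq that]] Jm[OF that] by simp
    also have "gauss_sum (1 * int m) r * gauss_sum (1 * int r) m = gauss_sum 1 q"
      unfolding rm(1) by (rule gauss_sum_coprime_product[OF cop r0 m0, symmetric])
    finally show ?thesis .
  qed
  let ?S = "\<lambda>w. \<Sum>c\<in>{0..<int q}. chi c * chi c * (chi c * J c * w c)"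
  have "(1 + \<i>) * (phi * tau) = (\<Sum>c\<in>{0..<int q}. chi c * ((1 + \<i>) * gauss_sum c q))"
    by (simp add: sum_chi_gauss_sum [symmetric] sum_distrib_left mult_ac)
  also have "\<dots> = (\<Sum>c\<in>{0..<int q}. gauss_sum 1 q * (chi c * chi c * (chi c * J c * A c)) +
                       \<i> * gauss_sum 1 q * (chi c * chi c * (chi c * J c * B c)))"
  proof (rule sum.cong[OF refl])
    fix c
    have "chi c * chi c * (chi c * z) = chi c * z" for z using chi_values[of c] by auto
    moreover have "chi c * ((1 + \<i>) * gauss_sum c q) = chi c * ((A c + \<i> * B c) * J c * gauss_sum 1 q)"
      using main[of c] by (cases "coprime c (int q)") (auto simp: chi_eq_0_iff)
    ultimately show "chi c * ((1 + \<i>) * gauss_sum c q) =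
        gauss_sum 1 q * (chi c * chi c * (chi c * J c * A c)) +
        \<i> * gauss_sum 1 q * (chi c * chi c * (chi c * J c * B c))"
      by (simp only: mult.assoc) (simp add: algebra_simps)
  qed
  also have "\<dots> = gauss_sum 1 q * (?S A + \<i> * ?S B)"
    by (simp add: sum.distrib sum_distrib_left algebra_simps)
  also have "gauss_sum 1 q = of_real (sqrt q) * (1 + \<i>)"
    using gauss_sum_1_mod_4(1)[OF q_pos] q by simp
  finally have "(1 + \<i>) * (phi * tau) = (1 + \<i>) * (of_real (sqrt q) * (?S A + \<i> * ?S B))"
    by (simp add: mult_ac)
  moreover have "1 + \<i> \<noteq> 0" by (simp add: complex_eq_iff)
  ultimately have eq: "phi * tau = of_real (sqrt q) * (?S A + \<i> * ?S B)"
    using mult_left_cancel[of "1 + \<i>"] by blast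
  have SA: "?S A \<in> {0, phi}"
  proof (rule sum_unit_character)
    show "chi a * J a * A a = chi b * J b * A b" if "[a = b] (mod int q)" for a b
    proof -
      have "[a = b] (mod int m)" using that rm cong_modulus_mult[of a b "int m" "int r"] by (simp add: mult.commute)
      thus ?thesis using chi_cong[OF that] gauss_sum_cong Acong[OF that] by (simp add: J_def)
    qed
  qed (simp add: chi_mult J copm Amult odd_coprime_even[OF evq])
  have SB: "?S B \<in> {0, phi}"
  proof (rule sum_unit_character)
    show "chi a * J a * B a = chi b * J b * B b" if "[a = b] (mod int q)" for a b
    proof -
      have "[a = b] (mod int m)" using that rm cong_modulus_mult[of a b "int m" "int r"] by (simp add: mult.commute)
      thus ?thesis using chi_cong[OF that] gauss_sum_cong Bcong[OF that] by (simp add: J_def)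
    qed
  qed (simp add: chi_mult J copm Bmult odd_coprime_even[OF evq])
  have sq0: "sqrt q > 0" using q_pos by simp
  obtain a where a: "a \<in> {0, 1}" "?S A = phi * a" using SA by (intro that[of "?S A / phi"]) (use phi_nonzero in auto)
  obtain b where b: "b \<in> {0, 1}" "?S B = phi * b" using SB by (intro that[of "?S B / phi"]) (use phi_nonzero in auto)
  have "phi * tau = phi * (of_real (sqrt q) * (a + \<i> * b))"
    unfolding eq a(2) b(2) by (simp add: algebra_simps)
  hence "tau = of_real (sqrt q) * (a + \<i> * b)"
    by (rule mult_left_cancel[OF phi_nonzero, THEN iffD1])
  then consider "tau = 0" | "tau = of_real (sqrt q)" | "tau = \<i> * of_real (sqrt q)" | "tau = of_real (sqrt q) * (1 + \<i>)"
    using a(1) b(1) by auto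
  thus ?thesis
  proof cases
    case 4
    \<comment> \<open>The value \<open>1 + \<i>\<close> is ruled out because \<open>tau\<close> is
      real or purely imaginary by \<open>cnj_tau\<close>.\<close>
    hence "cnj tau \<noteq> tau" "cnj tau \<noteq> - tau" using sq0 by (auto simp: complex_eq_iff)
    thus ?thesis using cnj_tau chi_minus_1 by auto
  qed (use tau_nonzero in auto)
qed

theorem tau_eq:
  "tau = (if chi (-1) = 1 then of_real (sqrt q) else \<i> * of_real (sqrt q))"
proof -
  have "tau = of_real (sqrt q) \<or> tau = \<i> * of_real (sqrt q)"
  proof (cases "odd q")
    case True
    hence "q mod 4 = 1 \<or> q mod 4 = 3" by presburger
    thus ?thesis using tau_odd[OF True] gauss_sum_1_mod_4[OF q_pos] by auto
  next
    case False
    hence "4 dvd q" using not_2_mod_4 by presburger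
    thus ?thesis by (rule tau_even)
  qed
  moreover have "sqrt q > 0" using q_pos by simp
  \<comment> \<open>The parity of \<open>chi\<close> decides between the two candidates:
    \<open>cnj_tau\<close> makes \<open>tau\<close> real for even and imaginary for odd
    characters.\<close>
  ultimately show ?thesis
    using cnj_tau chi_minus_1 by (auto simp: complex_eq_iff)
qed

end

section \<open>Theta series\<close>

lemma has_sum_finite_sum:
  fixes f :: "'a \<Rightarrow> 'b \<Rightarrow> complex"
  assumes "finite R" "\<And>r. r \<in> R \<Longrightarrow> (f r has_sum A r) S"
  shows "((\<lambda>k. \<Sum>r\<in>R. f r k) has_sum (\<Sum>r\<in>R. A r)) S"
  using assms by (induction R rule: finite_induct) (auto intro!: has_sum_add has_sum_0)

lemma infsum_residue_split:
  fixes f :: "int \<Rightarrow> complex"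
  assumes q: "q > 0" and f: "f summable_on UNIV"
  shows "infsum f UNIV = (\<Sum>r\<in>{0..<int q}. \<Sum>\<^sub>\<infinity>m. f (r + int q * m))"
proof -
  let ?g = "\<lambda>(r, m). r + int q * m"
  have bij: "bij_betw ?g ({0..<int q} \<times> UNIV) UNIV"
    by (rule bij_betw_byWitness[where f' = "\<lambda>n. (n mod int q, n div int q)"]) (use q in auto)
  have s: "((\<lambda>z. f (?g z)) has_sum infsum f UNIV) ({0..<int q} \<times> UNIV)"
    by (subst has_sum_reindex_bij_betw[OF bij]) (rule has_sum_infsum[OF f])
  have "((\<lambda>m. f (?g (r, m))) has_sum (\<Sum>\<^sub>\<infinity>m. f (r + int q * m))) UNIV" for r
  proof -
    have "f summable_on range (\<lambda>m. r + int q * m)"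
      by (rule summable_on_subset_banach[OF f]) auto
    hence "(\<lambda>m. f (r + int q * m)) summable_on UNIV"
      by (subst (asm) summable_on_reindex) (use q in \<open>auto simp: o_def inj_on_def\<close>)
    thus ?thesis using has_sum_infsum by simp
  qed
  hence "((\<lambda>r. \<Sum>\<^sub>\<infinity>m. f (r + int q * m)) has_sum infsum f UNIV) {0..<int q}"
    by (intro has_sum_SigmaD[OF s])
  moreover have "((\<lambda>r. \<Sum>\<^sub>\<infinity>m. f (r + int q * m)) has_sum (\<Sum>r\<in>{0..<int q}. \<Sum>\<^sub>\<infinity>m. f (r + int q * m))) {0..<int q}"
    by (rule has_sum_finite) simp
  ultimately show ?thesis using has_sum_unique by blast
qed

definition psi :: "real \<Rightarrow> real" where
  "psi x = (\<Sum>n. exp (- pi * x * real (Suc n) ^ 2))"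

lemma summable_psi: "x > 0 \<Longrightarrow> summable (\<lambda>n. exp (- pi * x * real (Suc n) ^ 2))"
  using summable_exp_neg_square[of "pi * x"]
  by (subst summable_Suc_iff) simp

lemma psi_pos: "x > 0 \<Longrightarrow> psi x > 0"
  unfolding psi_def by (intro suminf_pos summable_psi) auto

lemma psi_nonneg: "x > 0 \<Longrightarrow> psi x \<ge> 0"
  using psi_pos[of x] by simp

lemma psi_le_geometric:
  assumes "x > 0"
  shows "psi x \<le> exp (- pi * x) / (1 - exp (- pi * x))"
proof -
  let ?r = "exp (- pi * x)"
  have r: "0 < ?r" "?r < 1" using assms by auto
  have "psi x \<le> (\<Sum>n. ?r * ?r ^ n)"
    unfolding psi_def
  proof (intro suminf_le summable_psi assms summable_mult summable_geometric)
    fix n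
    have "real (Suc n) \<le> real (Suc n) ^ 2" by (rule self_le_power) auto
    hence "pi * x * real (Suc n) \<le> pi * x * real (Suc n) ^ 2" using assms by (intro mult_left_mono) auto
    thus "exp (- pi * x * real (Suc n) ^ 2) \<le> ?r * ?r ^ n"
      by (simp add: algebra_simps flip: exp_of_nat_mult exp_add)
  qed (use r in auto)
  also have "\<dots> = ?r / (1 - ?r)"
    using r by (subst suminf_mult) (auto simp: suminf_geometric summable_geometric)
  finally show ?thesis .
qed

lemma psi_functional_equation:
  assumes x: "x > 0"
  shows "psi (1 / x) = sqrt x * psi x + sqrt x / 2 - 1 / 2"
proof -
  have theta: "(\<Sum>\<^sub>\<infinity>n::int. of_real (exp (- pi * y * of_int n ^ 2)) :: complex) = of_real (1 + 2 * psi y)"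
    if y: "y > 0" for y
  proof -
    let ?f = "\<lambda>n::int. of_real (exp (- pi * y * of_int n ^ 2)) :: complex"
    have "(?f has_sum infsum ?f UNIV) UNIV"
      using theta_shift(2)[OF y, of 0] by (intro has_sum_infsum) simp
    from has_sum_int_even[OF this]
    have "((\<lambda>n. ?f (int (Suc n))) has_sum ((infsum ?f UNIV - 1) / 2)) UNIV" by simp
    hence "(\<lambda>n. ?f (int (Suc n))) sums ((infsum ?f UNIV - 1) / 2)" by (rule has_sum_imp_sums)
    moreover have "(\<lambda>n. ?f (int (Suc n))) sums of_real (psi y)"
      unfolding psi_def using sums_of_real[OF summable_sums[OF summable_psi[OF y]], where 'a = complex]
      by (simp del: of_nat_Suc)
    ultimately have "(infsum ?f UNIV - 1) / 2 = of_real (psi y)" by (rule sums_unique2)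
    thus ?thesis by (simp add: field_simps)
  qed
  have "((\<lambda>k. of_real (exp (- pi * of_int k ^ 2 / x) / sqrt x)) has_sum
            (\<Sum>\<^sub>\<infinity>n::int. of_real (exp (- pi * x * of_int n ^ 2)) :: complex)) UNIV"
    using theta_shift(1)[OF x, of 0] by simp
  hence "((\<lambda>k::int. of_real (sqrt x) * of_real (exp (- pi * of_int k ^ 2 / x) / sqrt x)) has_sum
            (of_real (sqrt x) * of_real (1 + 2 * psi x) :: complex)) UNIV"
    unfolding theta[OF x] by (rule has_sum_cmult_right)
  moreover have "(\<lambda>k::int. of_real (sqrt x) * of_real (exp (- pi * of_int k ^ 2 / x) / sqrt x) :: complex) =
     (\<lambda>n. of_real (exp (- pi * (1 / x) * of_int n ^ 2)))"
  proof
    fix k :: int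
    have "sqrt x * (exp (- pi * of_int k ^ 2 / x) / sqrt x) = exp (- pi * (1 / x) * of_int k ^ 2)"
      using x by simp
    thus "of_real (sqrt x) * of_real (exp (- pi * of_int k ^ 2 / x) / sqrt x) =
        (of_real (exp (- pi * (1 / x) * of_int k ^ 2)) :: complex)"
      by (simp only: of_real_mult [symmetric])
  qed
  ultimately have "(\<Sum>\<^sub>\<infinity>n::int. of_real (exp (- pi * (1 / x) * of_int n ^ 2)) :: complex) =
     of_real (sqrt x) * of_real (1 + 2 * psi x)"
    by (simp only: infsumI)
  hence "(of_real (1 + 2 * psi (1 / x)) :: complex) = of_real (sqrt x * (1 + 2 * psi x))"
    using theta[of "1 / x"] x by simp
  hence "1 + 2 * psi (1 / x) = sqrt x * (1 + 2 * psi x)" by (simp only: of_real_eq_iff)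
  thus ?thesis by (simp add: algebra_simps)
qed

locale nontrivial_primitive_quadratic = primitive_quadratic +
  assumes q_gt_1: "q > 1"
begin

definition X :: "nat \<Rightarrow> real" where "X n = Re (chi (int n))"

lemma of_real_X: "of_real (X n) = chi (int n)"
  using chi_values[of "int n"] by (auto simp: X_def)

lemma X_values: "X n \<in> {-1, 0, 1}"
  using chi_values[of "int n"] by (auto simp: X_def)

lemma abs_X_le: "\<bar>X n\<bar> \<le> 1"
  using X_values[of n] by auto

lemma X_mult: "X (m * n) = X m * X n"
  using chi_mult[of "int m" "int n"] by (simp add: of_real_eq_iff [symmetric, where 'a = complex] of_real_X del: of_real_eq_iff)

lemma X_1 [simp]: "X (Suc 0) = 1"
  by (simp add: X_def)

lemma chi_0: "chi 0 = 0"
  using chi_eq_0_iff[of 0] q_gt_1 by simp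

definition par :: nat where "par = (if chi (-1) = 1 then 0 else 1)"

lemma par_cases: "par = 0 \<or> par = 1"
  by (simp add: par_def)

lemma chi_minus_par: "chi (- a) = (-1) ^ par * chi a"
  using chi_minus[of a] chi_minus_1 by (auto simp: par_def)

lemma tau_par: "tau = \<i> ^ par * of_real (sqrt q)"
  by (simp add: tau_eq par_def)

text \<open>The factor \<open>y ^ par\<close> makes \<open>chi n * kern (n * t)\<close> even in n
  for both parities. It also gives both theta series the same factor \<open>sqrt x\<close> in the
  functional equation.\<close>

definition kern :: "real \<Rightarrow> real" where "kern y = y ^ par * exp (- pi * y\<^sup>2)"

definition vtheta :: "real \<Rightarrow> real" where
  "vtheta x = (\<Sum>n. X (Suc n) * kern (real (Suc n) * sqrt (x / q)))"

lemma abs_kern_le: "\<bar>kern y\<bar> \<le> 2 * exp (- pi * (1 / 2) * y\<^sup>2)"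
proof (cases "par = 0")
  case True
  have "exp (- pi * y\<^sup>2) \<le> exp (- pi * (1 / 2) * y\<^sup>2)" by (simp add: mult_le_cancel_right1)
  also have "\<dots> \<le> 2 * exp (- pi * (1 / 2) * y\<^sup>2)" by simp
  finally show ?thesis using True by (simp add: kern_def)
next
  case False
  hence "par = 1" by (auto simp: par_def split: if_splits)
  thus ?thesis using linear_gaussian_bound[of 1 y] by (simp add: kern_def abs_mult)
qed

lemma kern_term_bound:
  assumes "x > 0"
  shows "\<bar>X (Suc n) * kern (real (Suc n) * sqrt (x / q))\<bar> \<le> 2 * exp (- pi * (x / (2 * q)) * real (Suc n) ^ 2)"
proof -
  have "\<bar>X (Suc n) * kern (real (Suc n) * sqrt (x / q))\<bar> \<le> 1 * (2 * exp (- pi * (1 / 2) * (real (Suc n) * sqrt (x / q))\<^sup>2))"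
    unfolding abs_mult by (intro mult_mono abs_X_le abs_kern_le) auto
  also have "(real (Suc n) * sqrt (x / q))\<^sup>2 = real (Suc n) ^ 2 * (x / q)"
    using assms by (simp add: power_mult_distrib del: of_nat_Suc)
  finally show ?thesis by (simp add: field_simps del: of_nat_Suc)
qed

lemma summable_vtheta_abs:
  assumes "x > 0"
  shows "summable (\<lambda>n. \<bar>X (Suc n) * kern (real (Suc n) * sqrt (x / q))\<bar>)"
proof (rule summable_comparison_test')
  show "summable (\<lambda>n. 2 * exp (- pi * (x / (2 * q)) * real (Suc n) ^ 2))"
    using assms q_pos by (intro summable_mult summable_psi) auto
qed (use kern_term_bound[OF assms] in auto)

lemma abs_vtheta_le:
  assumes "x > 0"
  shows "\<bar>vtheta x\<bar> \<le> 2 * psi (x / (2 * q))"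
proof -
  have "\<bar>vtheta x\<bar> \<le> (\<Sum>n. \<bar>X (Suc n) * kern (real (Suc n) * sqrt (x / q))\<bar>)"
    unfolding vtheta_def by (rule summable_rabs[OF summable_vtheta_abs[OF assms]])
  also have "\<dots> \<le> (\<Sum>n. 2 * exp (- pi * (x / (2 * q)) * real (Suc n) ^ 2))"
    using assms q_pos by (intro suminf_le kern_term_bound summable_vtheta_abs summable_mult summable_psi) auto
  also have "\<dots> = 2 * psi (x / (2 * q))"
    unfolding psi_def using assms q_pos by (intro suminf_mult summable_psi) auto
  finally show ?thesis .
qed

lemma infsum_chi_kern:
  assumes x: "x > 0" and s: "(\<lambda>n::int. chi n * of_real (kern (of_int n * sqrt (x / q)))) summable_on UNIV"
  shows "(\<Sum>\<^sub>\<infinity>n::int. chi n * of_real (kern (of_int n * sqrt (x / q)))) = of_real (2 * vtheta x)"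
proof -
  let ?f = "\<lambda>n::int. chi n * of_real (kern (of_int n * sqrt (x / q)))"
  have even: "?f (- n) = ?f n" for n
    using par_cases by (auto simp: chi_minus_par kern_def)
  have "((\<lambda>n. ?f (int (Suc n))) has_sum ((infsum ?f UNIV - ?f 0) / 2)) UNIV"
    by (rule has_sum_int_even[OF has_sum_infsum[OF s] even])
  hence "(\<lambda>n. ?f (int (Suc n))) sums (infsum ?f UNIV / 2)"
    by (simp add: chi_0 has_sum_imp_sums)
  moreover have "(\<lambda>n. ?f (int (Suc n))) sums of_real (vtheta x)"
  proof -
    have "(\<lambda>n. X (Suc n) * kern (real (Suc n) * sqrt (x / q))) sums vtheta x"
      unfolding vtheta_def by (rule summable_sums[OF summable_rabs_cancel[OF summable_vtheta_abs[OF x]]])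
    hence "(\<lambda>n. of_real (X (Suc n) * kern (real (Suc n) * sqrt (x / q))) :: complex) sums of_real (vtheta x)"
      by (rule sums_of_real)
    thus ?thesis by (simp add: of_real_X del: of_nat_Suc)
  qed
  ultimately have "infsum ?f UNIV / 2 = of_real (vtheta x)" by (rule sums_unique2)
  thus ?thesis by simp
qed

text \<open>Weighting the dual series of the residue classes by \<open>chi r\<close> produces the
  twisted Gauss sum at each frequency k, hence \<open>chi k * tau\<close>.\<close>

lemma twisted_dual_sum:
  assumes "\<And>r. r \<in> {0..<int q} \<Longrightarrow> ((\<lambda>k. g k * unit_exp (of_int k * (of_int r / q))) has_sum A r) UNIV"
  shows "((\<lambda>k. g k * (chi k * tau)) has_sum (\<Sum>r\<in>{0..<int q}. chi r * A r)) UNIV"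
proof -
  have "((\<lambda>k. \<Sum>r\<in>{0..<int q}. chi r * (g k * unit_exp (of_int k * (of_int r / q)))) has_sum
          (\<Sum>r\<in>{0..<int q}. chi r * A r)) UNIV"
    by (intro has_sum_finite_sum has_sum_cmult_right assms) auto
  moreover have "(\<Sum>r\<in>{0..<int q}. chi r * (g k * unit_exp (of_int k * (of_int r / q)))) = g k * (chi k * tau)" for k
    by (simp add: twisted_gauss_sum [symmetric] sum_distrib_left add_char_def mult_ac)
  ultimately show ?thesis by simp
qed

lemma abs_summable_chi_mult:
  fixes f :: "int \<Rightarrow> complex"
  assumes "f summable_on UNIV"
  shows "(\<lambda>n. chi n * f n) summable_on UNIV"
proof (rule abs_summable_summable, rule summable_on_comparison_test)
  show "(\<lambda>n. norm (f n)) summable_on UNIV"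
    using assms by (simp add: summable_on_iff_abs_summable_on_complex)
  fix n :: int
  have "norm (chi n) \<le> 1" using chi_values[of n] by auto
  thus "norm (chi n * f n) \<le> norm (f n)" by (simp add: norm_mult mult_left_le_one_le)
qed auto

theorem vtheta_functional_equation:
  assumes x: "x > 0"
  shows "vtheta (1 / x) = sqrt x * vtheta x"
proof -
  \<comment> \<open>For \<open>n = r + q * m\<close> one has
    \<open>n\<^sup>2 * x / q = T * (r / q + m)\<^sup>2\<close>, so Poisson summation is applied in
    each class with shift \<open>r / q\<close>.\<close>
  define T where "T = q * x"
  have T: "T > 0" using x q_pos by (simp add: T_def)
  have r01: "of_int r / real q \<in> {0..1}" if "r \<in> {0..<int q}" for r using that by auto
  define w where "w = (\<lambda>y. of_real (kern (y * sqrt T)) :: complex)"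
  have sqT: "sqrt (x / q) * q = sqrt T"
    using q_pos by (simp add: T_def real_sqrt_mult real_sqrt_divide field_simps)
  have summ: "(\<lambda>n::int. of_real (kern (of_int n * sqrt y)) :: complex) summable_on UNIV" if "y > 0" for y
  proof (cases "par = 0")
    case True
    thus ?thesis using theta_shift(2)[OF that, of 0] that
      by (simp add: kern_def power_mult_distrib mult_ac)
  next
    case False
    hence p: "par = 1" by (auto simp: par_def split: if_splits)
    have "(\<lambda>n::int. of_real (sqrt y) * of_real ((0 + of_int n) * exp (- pi * y * (0 + of_int n)\<^sup>2)) :: complex) summable_on UNIV"
      by (intro summable_on_cmult_right linear_theta_shift(2)) (use that in auto)
    thus ?thesis using that by (simp add: kern_def p power_mult_distrib mult_ac)
  qed
  have "of_real (2 * vtheta x) = (\<Sum>\<^sub>\<infinity>n::int. chi n * of_real (kern (of_int n * sqrt (x / q))))"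
    using x q_pos by (intro infsum_chi_kern [symmetric] abs_summable_chi_mult summ) auto
  also have "\<dots> = (\<Sum>r\<in>{0..<int q}. \<Sum>\<^sub>\<infinity>m. chi (r + int q * m) * of_real (kern (of_int (r + int q * m) * sqrt (x / q))))"
    using x q_pos by (intro infsum_residue_split abs_summable_chi_mult summ) auto
  also have "\<dots> = (\<Sum>r\<in>{0..<int q}. chi r * (\<Sum>\<^sub>\<infinity>m::int. w (of_int r / q + of_int m)))"
  proof (rule sum.cong[OF refl])
    fix r
    have "chi (r + int q * m) = chi r" for m by (rule chi_cong) (simp add: cong_def)
    moreover have "of_int (r + int q * m) * sqrt (x / q) = (of_int r / q + of_int m) * sqrt T" for m
      using q_pos unfolding sqT [symmetric] by (simp add: field_simps)
    ultimately show "(\<Sum>\<^sub>\<infinity>m. chi (r + int q * m) * of_real (kern (of_int (r + int q * m) * sqrt (x / q)))) =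
        chi r * (\<Sum>\<^sub>\<infinity>m::int. w (of_int r / q + of_int m))"
      by (simp add: w_def infsum_cmult_right')
  qed
  also have "\<dots> = (\<Sum>\<^sub>\<infinity>k::int. ((-\<i>) ^ par / of_real (sqrt T) * of_real (kern (of_int k * sqrt ((1 / x) / q)))) * (chi k * tau))"
  proof (rule infsumI [symmetric], rule twisted_dual_sum)
    fix r assume r: "r \<in> {0..<int q}"
    have sq: "(sqrt (1 / x / q))\<^sup>2 = 1 / T" using x q_pos by (simp add: T_def)
    have sq2: "(sqrt (1 / (x * q)))\<^sup>2 = 1 / T" using sq by simp
    have sq': "sqrt (1 / x / q) = 1 / sqrt T" using x q_pos by (simp add: T_def real_sqrt_divide real_sqrt_mult)
    show "((\<lambda>k. (-\<i>) ^ par / of_real (sqrt T) * of_real (kern (of_int k * sqrt ((1 / x) / q))) * unit_exp (of_int k * (of_int r / q)))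
        has_sum (\<Sum>\<^sub>\<infinity>m::int. w (of_int r / q + of_int m))) UNIV"
    proof (cases "par = 0")
      case True
      have "w y = of_real (exp (- pi * T * y\<^sup>2))" for y
        using T True by (simp add: w_def kern_def power_mult_distrib mult_ac)
      thus ?thesis using theta_shift(1)[OF T r01[OF r]] True
        by (simp add: kern_def power_mult_distrib sq2 mult_ac)
    next
      case False
      hence p: "par = 1" by (auto simp: par_def split: if_splits)
      have w: "w y = of_real (sqrt T) * of_real (y * exp (- pi * T * y\<^sup>2))" for y
        using T p by (simp add: w_def kern_def power_mult_distrib mult_ac)
      have "((\<lambda>k. of_real (sqrt T) * (- \<i> * of_real (of_int k * exp (- pi * of_int k ^ 2 / T) / (T * sqrt T)) * unit_exp (of_int k * (of_int r / q))))
            has_sum of_real (sqrt T) * (\<Sum>\<^sub>\<infinity>n::int. of_real ((of_int r / q + of_int n) * exp (- pi * T * (of_int r / q + of_int n)\<^sup>2)))) UNIV"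
        by (intro has_sum_cmult_right linear_theta_shift(1) T r01 r)
      moreover have "of_real (sqrt T) * (- \<i> * of_real (of_int k * exp (- pi * of_int k ^ 2 / T) / (T * sqrt T)) * z) =
          (-\<i>) ^ par / of_real (sqrt T) * of_real (kern (of_int k * sqrt ((1 / x) / q))) * z" for k :: int and z
      proof -
        have "sqrt T * (of_int k * exp (- pi * of_int k ^ 2 / T) / (T * sqrt T)) =
              1 / sqrt T * kern (of_int k * sqrt (1 / x / q))"
        proof -
          have "sqrt (1 / (x * q)) = 1 / sqrt T" using sq' by simp
          moreover have "T = sqrt T * sqrt T" using T by simp
          ultimately show ?thesis using T by (simp add: kern_def p power_mult_distrib power_divide)
        qed
        hence "- \<i> * of_real (sqrt T * (of_int k * exp (- pi * of_int k ^ 2 / T) / (T * sqrt T))) * z =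
              - \<i> * of_real (1 / sqrt T * kern (of_int k * sqrt (1 / x / q))) * z" by (simp only:)
        thus ?thesis using T by (simp add: p mult_ac)
      qed
      ultimately show ?thesis unfolding w by (simp only: infsum_cmult_right')
    qed
  qed
  also have "\<dots> = (\<Sum>\<^sub>\<infinity>k::int. of_real (1 / sqrt x) * (chi k * of_real (kern (of_int k * sqrt ((1 / x) / q)))))"
  proof (rule infsum_cong)
    fix k :: int
    \<comment> \<open>Here the exact value of \<open>tau\<close> enters: its factor
      \<open>\<i> ^ par\<close> cancels that of the Fourier transform, so no sign remains.\<close>
    have "(-\<i>) ^ par * \<i> ^ par = 1" by (simp add: par_def)
    moreover have "sqrt q / sqrt T = 1 / sqrt x" using x q_pos by (simp add: T_def real_sqrt_mult)
    hence "(of_real (sqrt q) / of_real (sqrt T) :: complex) = of_real (1 / sqrt x)"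
      by (simp only: of_real_divide [symmetric])
    moreover have "(-\<i>) ^ par / of_real (sqrt T) * tau =
        ((-\<i>) ^ par * \<i> ^ par) * (of_real (sqrt q) / of_real (sqrt T))"
      by (simp add: tau_par)
    ultimately have "(-\<i>) ^ par / of_real (sqrt T) * tau = of_real (1 / sqrt x)"
      by (simp only: mult_1_left)
    moreover have "(-\<i>) ^ par / of_real (sqrt T) * of_real (kern (of_int k * sqrt ((1 / x) / q))) * (chi k * tau) =
       ((-\<i>) ^ par / of_real (sqrt T) * tau) * (chi k * of_real (kern (of_int k * sqrt ((1 / x) / q))))"
      by simp
    ultimately show "(-\<i>) ^ par / of_real (sqrt T) * of_real (kern (of_int k * sqrt ((1 / x) / q))) * (chi k * tau) =
       of_real (1 / sqrt x) * (chi k * of_real (kern (of_int k * sqrt ((1 / x) / q))))"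
      by (simp only:)
  qed
  also have "\<dots> = of_real (1 / sqrt x) * (\<Sum>\<^sub>\<infinity>k::int. chi k * of_real (kern (of_int k * sqrt ((1 / x) / q))))"
    by (rule infsum_cmult_right')
  also have "(\<Sum>\<^sub>\<infinity>k::int. chi k * of_real (kern (of_int k * sqrt ((1 / x) / q)))) = of_real (2 * vtheta (1 / x))"
    using x q_pos by (intro infsum_chi_kern abs_summable_chi_mult summ) auto
  finally have "(of_real (2 * vtheta x) :: complex) = of_real (1 / sqrt x * (2 * vtheta (1 / x)))" by simp
  hence "2 * vtheta x = 1 / sqrt x * (2 * vtheta (1 / x))" by (simp only: of_real_eq_iff)
  thus ?thesis using x by (simp add: field_simps)
qed

end

section \<open>L-functions of primitive characters\<close>

lemma integrable_exp_neg_abs: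
  assumes K: "K > 0"
  shows "integrable lborel (\<lambda>u::real. exp (- K * \<bar>u\<bar>))"
proof -
  have "(\<integral>\<^sup>+u. ennreal (exp (- K * u)) * indicator {0..} u \<partial>lborel) = 0 - (- (1 / K) * exp (- K * 0))"
  proof (rule nn_integral_FTC_atLeast)
    show "((\<lambda>u. - (1 / K) * exp (- K * u)) \<longlongrightarrow> 0) at_top"
      using K by real_asymp
  qed (use K in \<open>auto intro!: derivative_eq_intros\<close>)
  hence *: "integrable lborel (\<lambda>u. exp (- K * u) * indicator {0..} u)"
    by (intro integrableI_nn_integral_finite[where x = "1 / K"])
       (auto simp: ennreal_mult' ennreal_indicator)
  moreover have "integrable lborel (\<lambda>u. exp (- K * (- u)) * indicator {0..} (- u))"
    using lborel_integrable_real_affine[OF *, of "-1" 0] by simp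
  ultimately have "integrable lborel (\<lambda>u. exp (- K * u) * indicator {0..} u + exp (- K * (- u)) * indicator {0..} (- u))"
    by (rule Bochner_Integration.integrable_add)
  thus ?thesis
    by (rule Bochner_Integration.integrable_bound) (auto simp: indicator_def abs_if)
qed

lemma exp_neg_exp_decay:
  fixes c K :: real
  assumes c: "c > 0"
  shows "\<exists>C\<ge>0. \<forall>u\<ge>0. exp (- c * exp u) \<le> C * exp (- K * u)"
proof -
  define k where "k = max 1 K"
  have k: "k > 0" by (simp add: k_def)
  have "exp (- c * exp u) \<le> exp (k * ln (k / c) - k) * exp (- K * u)" if "u \<ge> 0" for u
  proof -
    \<comment> \<open>The inequality \<open>ln z \<le> z - 1\<close> at
      \<open>z = c * exp u / k\<close> gives decay like \<open>exp (- k * u)\<close>; taking k at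
      least 1 allows every real K.\<close>
    have "ln (c * exp u / k) \<le> c * exp u / k - 1" using c k by (intro ln_le_minus_one) auto
    hence "k * ln (c * exp u / k) \<le> k * (c * exp u / k - 1)" using k by (intro mult_left_mono) auto
    also have "\<dots> = c * exp u - k" using k by (simp add: field_simps)
    also have "ln (c * exp u / k) = u - ln (k / c)" using c k by (simp add: ln_div ln_mult)
    finally have "- c * exp u \<le> (k * ln (k / c) - k) + - k * u" by (simp add: algebra_simps)
    also have "\<dots> \<le> (k * ln (k / c) - k) + - K * u"
      using that by (intro add_left_mono mult_right_mono) (auto simp: k_def)
    finally show ?thesis by (simp flip: exp_add)
  qed
  thus ?thesis by (intro exI[of _ "exp (k * ln (k / c) - k)"]) auto
qed

lemma psi_exp_decay:
  assumes b: "b > 0"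
  shows "\<exists>C\<ge>0. \<forall>u\<ge>0. psi (b * exp u) \<le> C * exp (- K * u)"
proof -
  obtain C where C: "C \<ge> 0" "\<And>u. u \<ge> 0 \<Longrightarrow> exp (- (pi * b) * exp u) \<le> C * exp (- K * u)"
    using exp_neg_exp_decay[of "pi * b" K] b by auto
  have d: "1 - exp (- pi * b) > 0" using b by simp
  have "psi (b * exp u) \<le> C / (1 - exp (- pi * b)) * exp (- K * u)" if u: "u \<ge> 0" for u
  proof -
    have "psi (b * exp u) \<le> exp (- pi * (b * exp u)) / (1 - exp (- pi * (b * exp u)))"
      using b by (intro psi_le_geometric) auto
    also have "\<dots> \<le> (C * exp (- K * u)) / (1 - exp (- pi * b))"
    proof (rule frac_le)
      show "exp (- pi * (b * exp u)) \<le> C * exp (- K * u)" using C(2)[OF u] by (simp add: mult_ac)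
      have "b * 1 \<le> b * exp u" using b u by (intro mult_left_mono) auto
      thus "1 - exp (- pi * b) \<le> 1 - exp (- pi * (b * exp u))" by simp
    qed (use C d in auto)
    finally show ?thesis by simp
  qed
  thus ?thesis using C d by (intro exI[of _ "C / (1 - exp (- pi * b))"]) auto
qed

lemma psi_measurable [measurable]: "psi \<in> borel_measurable borel"
  unfolding psi_def by measurable

text \<open>Expanding the exponential and integrating termwise gives a power series convergent
  everywhere; the integrability of \<open>h\<close> against every exponential dominates the partial
  sums.\<close>

lemma laplace_transform_entire:
  fixes h :: "real \<Rightarrow> real"
  assumes [measurable]: "h \<in> borel_measurable borel"
    and h: "\<And>K. integrable lborel (\<lambda>u. \<bar>h u\<bar> * exp (K * \<bar>u\<bar>))"
  shows "(\<lambda>s :: complex. \<integral>u. of_real (h u) * exp (s * of_real u) \<partial>lborel) holomorphic_on UNIV"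
proof -
  define a where "a = (\<lambda>k. \<integral>u. of_real (h u * u ^ k / fact k) \<partial>lborel :: complex)"
  have sums: "(\<lambda>k. a k * s ^ k) sums (\<integral>u. of_real (h u) * exp (s * of_real u) \<partial>lborel)" for s :: complex
  proof -
    define f where "f = (\<lambda>k u. of_real (h u * u ^ k / fact k) * s ^ k)"
    have nf: "norm (f k u) = \<bar>h u\<bar> * ((norm s * \<bar>u\<bar>) ^ k / fact k)" for k u
      by (simp add: f_def norm_mult norm_divide norm_power abs_mult power_mult_distrib power_abs)
    have exp_sums: "(\<lambda>k. (norm s * \<bar>u\<bar>) ^ k / fact k) sums exp (norm s * \<bar>u\<bar>)" for u
      using exp_converges[of "norm s * \<bar>u\<bar>"] by (simp add: field_simps)
    have partial: "(\<Sum>k<n. norm (f k u)) \<le> \<bar>h u\<bar> * exp (norm s * \<bar>u\<bar>)" for n u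
      unfolding nf sum_distrib_left [symmetric]
    proof (intro mult_left_mono)
      have "(\<Sum>k<n. (norm s * \<bar>u\<bar>) ^ k / fact k) \<le> (\<Sum>k. (norm s * \<bar>u\<bar>) ^ k / fact k)"
        by (rule sum_le_suminf[OF sums_summable[OF exp_sums]]) auto
      thus "(\<Sum>k<n. (norm s * \<bar>u\<bar>) ^ k / fact k) \<le> exp (norm s * \<bar>u\<bar>)"
        using sums_unique[OF exp_sums] by simp
    qed auto
    have int: "integrable lborel (f k)" for k
    proof (rule Bochner_Integration.integrable_bound[OF h[of "norm s"]])
      show "f k \<in> borel_measurable lborel" unfolding f_def by measurable
      have "norm (f k u) \<le> (\<Sum>j<Suc k. norm (f j u))" for u
        by (rule member_le_sum) auto
      hence "norm (f k u) \<le> \<bar>h u\<bar> * exp (norm s * \<bar>u\<bar>)" for u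
        by (rule order_trans[OF _ partial])
      thus "AE u in lborel. norm (f k u) \<le> norm (\<bar>h u\<bar> * exp (norm s * \<bar>u\<bar>))"
        by (intro AE_I2) (simp add: abs_mult)
    qed
    have "summable (\<lambda>k. \<integral>u. norm (f k u) \<partial>lborel)"
    proof (rule summableI_nonneg_bounded)
      fix n
      have "(\<Sum>k<n. \<integral>u. norm (f k u) \<partial>lborel) = (\<integral>u. (\<Sum>k<n. norm (f k u)) \<partial>lborel)"
        by (rule Bochner_Integration.integral_sum [symmetric]) (use int in auto)
      also have "\<dots> \<le> (\<integral>u. \<bar>h u\<bar> * exp (norm s * \<bar>u\<bar>) \<partial>lborel)"
        by (intro integral_mono h partial Bochner_Integration.integrable_sum integrable_norm int)
      finally show "(\<Sum>k<n. \<integral>u. norm (f k u) \<partial>lborel) \<le> (\<integral>u. \<bar>h u\<bar> * exp (norm s * \<bar>u\<bar>) \<partial>lborel)" .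
    qed auto
    moreover have "summable (\<lambda>k. norm (f k u))" for u
      unfolding nf by (intro summable_mult sums_summable[OF exp_sums])
    ultimately have "(\<lambda>k. integral\<^sup>L lborel (f k)) sums (\<integral>u. (\<Sum>k. f k u) \<partial>lborel)"
      by (intro sums_integral int AE_I2)
    moreover have "integral\<^sup>L lborel (f k) = a k * s ^ k" for k
      unfolding f_def a_def by (rule integral_mult_left_zero)
    moreover have "(\<Sum>k. f k u) = of_real (h u) * exp (s * of_real u)" for u
    proof -
      have "(\<lambda>k. of_real (h u) * ((s * of_real u) ^ k /\<^sub>R fact k)) sums (of_real (h u) * exp (s * of_real u))"
        by (intro sums_mult exp_converges)
      also have "(\<lambda>k. of_real (h u) * ((s * of_real u) ^ k /\<^sub>R fact k)) = (\<lambda>k. f k u)"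
        by (simp add: f_def fun_eq_iff scaleR_conv_of_real field_simps power_mult_distrib)
      finally show ?thesis by (rule sums_unique [symmetric])
    qed
    ultimately show ?thesis by simp
  qed
  have ball: "(\<lambda>s :: complex. \<integral>u. of_real (h u) * exp (s * of_real u) \<partial>lborel) holomorphic_on ball 0 r" for r
    by (rule power_series_holomorphic[where a = a]) (use sums in simp)
  have "(\<lambda>s :: complex. \<integral>u. of_real (h u) * exp (s * of_real u) \<partial>lborel) field_differentiable at z" for z
    by (rule holomorphic_on_imp_differentiable_at[OF ball[of "norm z + 1"] open_ball]) simp
  thus ?thesis by (simp add: holomorphic_on_def field_differentiable_at_within)
qed

lemma not_nonpos_Ints_complex:
  assumes "Re z > 0"
  shows "z \<notin> \<int>\<^sub>\<le>\<^sub>0"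
proof
  assume "z \<in> \<int>\<^sub>\<le>\<^sub>0"
  then obtain n :: int where "z = of_int n" "n \<le> 0" by (elim nonpos_Ints_cases)
  thus False using assms by simp
qed

text \<open>Euler's integral with \<open>t = exp u\<close>, followed by the translation of u by
  \<open>ln c\<close>.\<close>

lemma gamma_integral_exp:
  fixes z :: complex
  assumes z: "Re z > 0" and c: "c > 0"
  shows "has_bochner_integral lborel (\<lambda>u. exp (z * of_real u) * of_real (exp (- c * exp u)))
            (Gamma z * exp (- z * of_real (ln c)))"
proof -
  let ?f = "\<lambda>t. of_real t powr (z - 1) / of_real (exp t) :: complex"
  let ?g = "\<lambda>u. exp (z * of_real u) * of_real (exp (- exp u)) :: complex"
  have eq: "\<bar>exp u\<bar> *\<^sub>R ?f (exp u) = ?g u" for u :: real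
    by (simp add: powr_def scaleR_conv_of_real exp_minus exp_diff algebra_simps Ln_of_real divide_inverse flip: exp_of_real)
  have "((\<lambda>u. \<bar>exp u\<bar> *\<^sub>R ?f (exp u)) absolutely_integrable_on UNIV) \<and>
        integral UNIV (\<lambda>u. \<bar>exp u\<bar> *\<^sub>R ?f (exp u)) = Gamma z"
  proof (subst has_absolute_integral_change_of_variables_real)
    have "range (exp :: real \<Rightarrow> real) = {0<..}"
    proof (intro equalityI subsetI)
      fix x :: real assume "x \<in> {0<..}"
      hence "x = exp (ln x)" by simp
      thus "x \<in> range exp" by (rule range_eqI)
    qed auto
    thus "?f absolutely_integrable_on range exp \<and> integral (range exp) ?f = Gamma z"
      using absolutely_integrable_Gamma_integral'[OF z] Gamma_integral_complex'[OF z]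
      by (simp add: integral_unique)
  qed (auto intro!: derivative_eq_intros simp: inj_on_def)
  hence g: "?g absolutely_integrable_on UNIV" "integral UNIV ?g = Gamma z" unfolding eq by simp_all
  have m: "?g \<in> borel_measurable lborel" by measurable
  have "integrable lebesgue ?g" using g(1) by (simp add: set_integrable_def)
  hence i: "integrable lborel ?g" using integrable_completion[OF m] by simp
  have "integral\<^sup>L lborel ?g = Gamma z" using integral_lborel[OF i] g(2) by simp
  hence "has_bochner_integral lborel ?g (Gamma z)" using i by (simp add: has_bochner_integral_iff)
  hence "has_bochner_integral lborel (\<lambda>u. ?g (ln c + 1 * u)) (Gamma z /\<^sub>R \<bar>1\<bar>)"
    by (subst (asm) lborel_has_bochner_integral_real_affine_iff[where c = 1 and t = "ln c"]) auto
  hence "has_bochner_integral lborel (\<lambda>u. exp (- z * of_real (ln c)) * ?g (ln c + 1 * u))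
           (exp (- z * of_real (ln c)) * Gamma z)"
    by (intro has_bochner_integral_mult_right) simp
  also have "(\<lambda>u. exp (- z * of_real (ln c)) * ?g (ln c + 1 * u)) = (\<lambda>u. exp (z * of_real u) * of_real (exp (- c * exp u)))"
  proof
    fix u
    have "exp (- z * of_real (ln c)) * exp (z * of_real (ln c + 1 * u)) = exp (z * of_real u)"
      by (simp add: distrib_left flip: exp_add)
    moreover have "exp (- exp (ln c + 1 * u)) = exp (- c * exp u)" using c by (simp add: exp_add)
    ultimately show "exp (- z * of_real (ln c)) * ?g (ln c + 1 * u) = exp (z * of_real u) * of_real (exp (- c * exp u))"
      by (simp only: mult.assoc [symmetric])
  qed
  finally show ?thesis by (simp add: mult.commute)
qed

context nontrivial_primitive_quadratic
begin

definition h :: "real \<Rightarrow> real" where "h u = vtheta (exp u)"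

lemma vtheta_measurable [measurable]: "vtheta \<in> borel_measurable borel"
  unfolding vtheta_def kern_def by measurable

lemma h_measurable [measurable]: "h \<in> borel_measurable borel"
  unfolding h_def by measurable

lemma h_minus: "h (- u) = exp (u / 2) * h u"
proof -
  have "sqrt (exp u) = exp (u / 2)" by (rule real_sqrt_unique) (auto simp flip: exp_of_nat_mult)
  thus ?thesis using vtheta_functional_equation[of "exp u"] by (simp add: h_def exp_minus inverse_eq_divide)
qed

lemma h_decay: "\<exists>C\<ge>0. \<forall>u. \<bar>h u\<bar> \<le> C * exp (- K * \<bar>u\<bar>)"
proof -
  \<comment> \<open>The rate \<open>\<bar>K\<bar> + 1\<close> leaves room for the factor
    \<open>exp (v / 2)\<close> that the functional equation costs on the negative side.\<close>
  obtain C where C: "C \<ge> 0" "\<And>u. u \<ge> 0 \<Longrightarrow> psi (1 / (2 * q) * exp u) \<le> C * exp (- (\<bar>K\<bar> + 1) * u)"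
    using psi_exp_decay[of "1 / (2 * q)" "\<bar>K\<bar> + 1"] q_pos by auto
  have pos: "\<bar>h u\<bar> \<le> 2 * C * exp (- (\<bar>K\<bar> + 1) * u)" if "u \<ge> 0" for u
    using abs_vtheta_le[of "exp u"] C(2)[OF that] by (simp add: h_def)
  have "\<bar>h u\<bar> \<le> 2 * C * exp (- K * \<bar>u\<bar>)" for u
  proof (cases "u \<ge> 0")
    case True
    have "- (\<bar>K\<bar> + 1) * u \<le> - K * u" using True by (intro mult_right_mono) auto
    hence "2 * C * exp (- (\<bar>K\<bar> + 1) * u) \<le> 2 * C * exp (- K * u)" using C by (intro mult_left_mono) auto
    thus ?thesis using pos[OF True] True by simp
  next
    case False
    define v where "v = - u"
    have v: "v \<ge> 0" "u = - v" using False by (auto simp: v_def)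
    have "\<bar>h u\<bar> = exp (v / 2) * \<bar>h v\<bar>" by (simp add: v h_minus abs_mult)
    also have "\<dots> \<le> exp (v / 2) * (2 * C * exp (- (\<bar>K\<bar> + 1) * v))"
      by (intro mult_left_mono pos v) auto
    also have "\<dots> = 2 * C * (exp (v / 2) * exp (- (\<bar>K\<bar> + 1) * v))" by simp
    also have "exp (v / 2) * exp (- (\<bar>K\<bar> + 1) * v) = exp (v / 2 - (\<bar>K\<bar> + 1) * v)"
      by (simp add: algebra_simps flip: exp_add)
    also have "v / 2 - (\<bar>K\<bar> + 1) * v \<le> - K * v"
    proof -
      have "K * v \<le> \<bar>K\<bar> * v" using v by (intro mult_right_mono) auto
      thus ?thesis using v by (simp add: algebra_simps)
    qed
    hence "2 * C * exp (v / 2 - (\<bar>K\<bar> + 1) * v) \<le> 2 * C * exp (- K * v)" using C by (intro mult_left_mono) auto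
    finally show ?thesis using v by simp
  qed
  thus ?thesis using C by (intro exI[of _ "2 * C"]) auto
qed

lemma integrable_h_exp: "integrable lborel (\<lambda>u. \<bar>h u\<bar> * exp (K * \<bar>u\<bar>))"
proof -
  obtain C where C: "C \<ge> 0" "\<And>u. \<bar>h u\<bar> \<le> C * exp (- (K + 1) * \<bar>u\<bar>)" using h_decay by blast
  show ?thesis
  proof (rule Bochner_Integration.integrable_bound)
    show "integrable lborel (\<lambda>u::real. C * exp (- 1 * \<bar>u\<bar>))"
      by (intro integrable_mult_right integrable_exp_neg_abs) auto
    show "AE u in lborel. norm (\<bar>h u\<bar> * exp (K * \<bar>u\<bar>)) \<le> norm (C * exp (- 1 * \<bar>u\<bar>))"
    proof (rule AE_I2)
      fix u :: real
      have "\<bar>h u\<bar> * exp (K * \<bar>u\<bar>) \<le> C * exp (- (K + 1) * \<bar>u\<bar>) * exp (K * \<bar>u\<bar>)"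
        by (intro mult_right_mono C) auto
      also have "\<dots> = C * exp (- 1 * \<bar>u\<bar>)" by (simp add: algebra_simps flip: exp_add)
      finally show "norm (\<bar>h u\<bar> * exp (K * \<bar>u\<bar>)) \<le> norm (C * exp (- 1 * \<bar>u\<bar>))" using C by (simp add: abs_mult)
    qed
  qed measurable
qed

definition D :: "complex \<Rightarrow> complex" where
  "D s = (\<integral>u. of_real (h u) * exp (s * of_real u) \<partial>lborel)"

definition L_factor :: "complex \<Rightarrow> complex" where
  "L_factor s = of_real (sqrt q) ^ par * exp ((s + of_nat par) / 2 * of_real (ln (pi / q)))"

text \<open>The completed L-function divided by its Gamma factor; writing the division with the
  entire function \<open>rGamma\<close> makes the continuation entire at once.\<close>

definition L_entire :: "complex \<Rightarrow> complex" where
  "L_entire s = D (s / 2) * L_factor s * rGamma ((s + of_nat par) / 2)"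

lemma D_entire: "D holomorphic_on UNIV"
  unfolding D_def by (rule laplace_transform_entire) (auto intro: integrable_h_exp)

lemma L_entire_holomorphic: "L_entire holomorphic_on UNIV"
proof -
  have "(\<lambda>s. D (s / 2)) holomorphic_on UNIV"
    using holomorphic_on_compose_gen[OF _ D_entire, of "\<lambda>s. s / 2" UNIV] by (simp add: o_def holomorphic_intros)
  thus ?thesis unfolding L_entire_def L_factor_def by (intro holomorphic_intros) simp_all
qed

lemma L_factor_nonzero: "L_factor s \<noteq> 0"
  using q_pos by (simp add: L_factor_def)

lemma kern_mellin:
  assumes s: "Re s > 0"
  shows "has_bochner_integral lborel
     (\<lambda>u. of_real (kern (real (Suc n) * sqrt (exp u / q))) * exp (s / 2 * of_real u))
     (Gamma ((s + of_nat par) / 2) / L_factor s * of_nat (Suc n) powr (- s))"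
proof -
  define z where "z = (s + of_nat par) / 2"
  have z: "Re z > 0" using s by (simp add: z_def)
  define c where "c = pi / q * real (Suc n) ^ 2"
  have c: "c > 0" using q_pos by (simp add: c_def del: of_nat_Suc)
  define r where "r = real (Suc n) / sqrt q"
  define g where "g = (\<lambda>u. of_real (kern (real (Suc n) * sqrt (exp u / q))) * exp (s / 2 * of_real u) :: complex)"
  have kern_eq: "kern (real (Suc n) * sqrt (exp u / q)) = r ^ par * exp (real par * u / 2) * exp (- c * exp u)" for u
  proof -
    have e: "sqrt (exp u) = exp (u / 2)" by (rule real_sqrt_unique) (auto simp flip: exp_of_nat_mult)
    have 1: "real (Suc n) * sqrt (exp u / q) = r * exp (u / 2)" by (simp add: r_def real_sqrt_divide e)
    have 2: "(r * exp (u / 2))\<^sup>2 = real (Suc n) ^ 2 / q * exp u"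
      by (simp add: r_def power_mult_distrib power_divide flip: exp_of_nat_mult)
    have 3: "exp (u / 2) ^ par = exp (real par * u / 2)" by (simp flip: exp_of_nat_mult)
    show ?thesis unfolding kern_def 1 2 unfolding power_mult_distrib 3 by (simp add: c_def)
  qed
  have "g = (\<lambda>u. of_real r ^ par * (exp (z * of_real u) * of_real (exp (- c * exp u))))"
  proof
    fix u
    have "of_real (exp (real par * u / 2)) * exp (s / 2 * of_real u) = exp (z * of_real u)"
      unfolding exp_of_real [symmetric] exp_add [symmetric]
      by (rule arg_cong[where f = exp]) (simp add: z_def field_simps)
    moreover have "g u = of_real r ^ par * ((of_real (exp (real par * u / 2)) * exp (s / 2 * of_real u)) * of_real (exp (- c * exp u)))"
      unfolding g_def kern_eq by simp
    ultimately show "g u = of_real r ^ par * (exp (z * of_real u) * of_real (exp (- c * exp u)))"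
      by simp
  qed
  hence g: "has_bochner_integral lborel g (of_real r ^ par * (Gamma z * exp (- z * of_real (ln c))))"
    by (simp only:) (intro has_bochner_integral_mult_right gamma_integral_exp z c)
  have ln: "ln c = ln (pi / q) + 2 * ln (real (Suc n))"
    unfolding c_def using q_pos by (subst ln_mult_pos) (auto simp: ln_realpow)
  have "of_real r ^ par * (Gamma z * exp (- z * of_real (ln c))) * L_factor s =
     Gamma z * ((of_real r ^ par * of_real (sqrt q) ^ par) * (exp (- z * of_real (ln c)) * exp (z * of_real (ln (pi / q)))))"
    by (simp add: L_factor_def z_def)
  also have "exp (- z * of_real (ln c)) * exp (z * of_real (ln (pi / q))) = exp (- (2 * z) * of_real (ln (real (Suc n))))"
    unfolding exp_add [symmetric] by (rule arg_cong[where f = exp]) (simp add: ln algebra_simps)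
  also have "(of_real r :: complex) ^ par * of_real (sqrt q) ^ par = of_nat (Suc n) ^ par"
    using q_pos by (simp add: r_def power_divide del: of_nat_Suc)
  also have "(of_nat (Suc n) :: complex) ^ par = exp (of_nat par * of_real (ln (real (Suc n))))"
    by (simp add: exp_of_nat_mult exp_of_real del: of_nat_Suc)
  also have "\<dots> * exp (- (2 * z) * of_real (ln (real (Suc n)))) = exp (- s * of_real (ln (real (Suc n))))"
    unfolding exp_add [symmetric] by (rule arg_cong[where f = exp]) (simp add: z_def algebra_simps)
  also have "\<dots> = of_nat (Suc n) powr (- s)"
    using Ln_of_real[of "real (Suc n)"] by (simp add: powr_def del: of_nat_Suc)
  finally have "of_real r ^ par * (Gamma z * exp (- z * of_real (ln c))) =
      Gamma z / L_factor s * of_nat (Suc n) powr (- s)"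
    using L_factor_nonzero[of s] by (simp add: field_simps)
  thus ?thesis using g by (simp add: g_def z_def)
qed

theorem D_dirichlet_series:
  assumes s: "Re s > 1"
  shows "L_entire s = dirichlet_series chi s"
proof -
  define g where "g = (\<lambda>n u. of_real (kern (real (Suc n) * sqrt (exp u / q))) * exp (s / 2 * of_real u) :: complex)"
  let ?A = "Gamma ((s + of_nat par) / 2) / L_factor s"
  have g: "has_bochner_integral lborel (g n) (?A * of_nat (Suc n) powr (- s))" for n
    unfolding g_def by (rule kern_mellin) (use s in simp)
  have int: "integrable lborel (\<lambda>u. of_real (X (Suc n)) * g n u)" for n
    using g[of n] by (intro integrable_mult_right) (simp add: has_bochner_integral_iff)
  define \<sigma> where "\<sigma> = Re s"
  define B where "B = Gamma ((of_real \<sigma> + of_nat par) / 2) / L_factor (of_real \<sigma>)"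
  have kpos: "kern (real (Suc n) * sqrt (exp u / q)) \<ge> 0" for n u
    by (simp add: kern_def)
  \<comment> \<open>Since \<open>kern\<close> is nonnegative here, the modulus of the integrand at s
    is the integrand at the real part of s. The same Mellin formula therefore gives the dominating
    sums.\<close>
  have ng: "(\<integral>u. norm (g n u) \<partial>lborel) = norm B * real (Suc n) powr (- \<sigma>)" for n
  proof -
    have "(of_real (norm (g n u)) :: complex) =
        of_real (kern (real (Suc n) * sqrt (exp u / q))) * exp (of_real \<sigma> / 2 * of_real u)" for u
      using kpos[of n u] by (simp add: g_def norm_mult \<sigma>_def exp_of_real [symmetric])
    hence "has_bochner_integral lborel (\<lambda>u. of_real (norm (g n u)) :: complex) (B * of_nat (Suc n) powr (- of_real \<sigma>))"
      using kern_mellin[of "of_real \<sigma>" n] s by (simp add: B_def \<sigma>_def)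
    hence "(\<integral>u. of_real (norm (g n u)) \<partial>lborel) = B * of_nat (Suc n) powr (- of_real \<sigma>)"
      by (rule has_bochner_integral_integral_eq)
    hence "of_real (\<integral>u. norm (g n u) \<partial>lborel) = B * of_nat (Suc n) powr (- of_real \<sigma>)" by simp
    hence "norm (of_real (\<integral>u. norm (g n u) \<partial>lborel) :: complex) = norm (B * of_nat (Suc n) powr (- of_real \<sigma>))"
      by (simp only:)
    moreover have "(\<integral>u. norm (g n u) \<partial>lborel) \<ge> 0" by simp
    moreover have "norm ((of_nat (Suc n) :: complex) powr (- of_real \<sigma>)) = real (Suc n) powr (- \<sigma>)"
      using norm_powr_real_powr[of "of_nat (Suc n)" "- of_real \<sigma>"] by (simp del: of_nat_Suc)
    ultimately show ?thesis by (simp add: norm_mult)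
  qed
  have "summable (\<lambda>n. norm B * real (Suc n) powr (- \<sigma>))"
  proof (rule summable_mult)
    have "summable (\<lambda>n. real n powr (- \<sigma>))" using s by (subst summable_real_powr_iff) (simp add: \<sigma>_def)
    thus "summable (\<lambda>n. real (Suc n) powr (- \<sigma>))" by (subst summable_Suc_iff)
  qed
  hence "summable (\<lambda>n. \<integral>u. norm (of_real (X (Suc n)) * g n u) \<partial>lborel)"
  proof (rule summable_comparison_test')
    fix n
    have "(\<integral>u. norm (of_real (X (Suc n)) * g n u) \<partial>lborel) = \<bar>X (Suc n)\<bar> * (norm B * real (Suc n) powr (- \<sigma>))"
      by (simp add: norm_mult ng)
    also have "\<dots> \<le> 1 * (norm B * real (Suc n) powr (- \<sigma>))"
      by (intro mult_right_mono abs_X_le) auto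
    finally show "norm (\<integral>u. norm (of_real (X (Suc n)) * g n u) \<partial>lborel) \<le> norm B * real (Suc n) powr (- \<sigma>)"
      by simp
  qed
  moreover have hs: "(\<lambda>n. of_real (X (Suc n)) * g n u) sums (of_real (h u) * exp (s / 2 * of_real u))" for u
  proof -
    have "(\<lambda>n. X (Suc n) * kern (real (Suc n) * sqrt (exp u / q))) sums h u"
      unfolding h_def vtheta_def by (rule summable_sums[OF summable_rabs_cancel[OF summable_vtheta_abs]]) simp
    hence "(\<lambda>n. of_real (X (Suc n) * kern (real (Suc n) * sqrt (exp u / q))) * exp (s / 2 * of_real u)) sums
             (of_real (h u) * exp (s / 2 * of_real u))"
      by (intro sums_mult2 sums_of_real)
    thus ?thesis by (simp add: g_def mult_ac del: of_nat_Suc)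
  qed
  moreover have "summable (\<lambda>n. norm (of_real (X (Suc n)) * g n u))" for u
  proof -
    have "summable (\<lambda>n. \<bar>X (Suc n) * kern (real (Suc n) * sqrt (exp u / q))\<bar> * norm (exp (s / 2 * of_real u)))"
      by (intro summable_mult2 summable_vtheta_abs) auto
    thus ?thesis by (simp add: g_def norm_mult abs_mult mult_ac del: of_nat_Suc)
  qed
  ultimately have "(\<lambda>n. \<integral>u. of_real (X (Suc n)) * g n u \<partial>lborel) sums (\<integral>u. (\<Sum>n. of_real (X (Suc n)) * g n u) \<partial>lborel)"
    by (intro sums_integral int AE_I2)
  moreover have "(\<Sum>n. of_real (X (Suc n)) * g n u) = of_real (h u) * exp (s / 2 * of_real u)" for u
    using sums_unique[OF hs] by simp
  moreover have "(\<integral>u. of_real (X (Suc n)) * g n u \<partial>lborel) = ?A * (chi (int (Suc n)) * of_nat (Suc n) powr (- s))" for n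
    using has_bochner_integral_integral_eq[OF g[of n]] by (simp add: of_real_X mult_ac del: of_nat_Suc)
  ultimately have sums: "(\<lambda>n. ?A * (chi (int (Suc n)) * of_nat (Suc n) powr (- s))) sums D (s / 2)"
    by (simp add: D_def)
  have A: "?A \<noteq> 0"
  proof -
    have "(s + of_nat par) / 2 \<notin> \<int>\<^sub>\<le>\<^sub>0" using s by (intro not_nonpos_Ints_complex) simp
    thus ?thesis by (simp add: Gamma_eq_zero_iff L_factor_nonzero)
  qed
  have "(\<lambda>n. (1 / ?A) * (?A * (chi (int (Suc n)) * of_nat (Suc n) powr (- s)))) sums (1 / ?A * D (s / 2))"
    by (rule sums_mult[OF sums])
  hence "(\<lambda>n. chi (int (Suc n)) * of_nat (Suc n) powr (- s)) sums (1 / ?A * D (s / 2))"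
    using A by (simp del: of_nat_Suc)
  hence "dirichlet_series chi s = 1 / ?A * D (s / 2)"
    unfolding dirichlet_series_def by (rule sums_unique [symmetric])
  thus ?thesis using A L_factor_nonzero[of s]
    by (simp add: L_entire_def rGamma_inverse_Gamma field_simps)
qed

text \<open>For positive arguments \<open>rGamma\<close> has no zero, so a zero of the L-function
  must come from the integral.\<close>

lemma D_eq_0:
  assumes "L_entire (of_real \<beta>) = 0" "\<beta> > 0"
  shows "(\<integral>u. h u * exp (\<beta> / 2 * u) \<partial>lborel) = 0"
proof -
  have "(of_real \<beta> + of_nat par) / 2 \<notin> (\<int>\<^sub>\<le>\<^sub>0 :: complex set)"
    using assms(2) by (intro not_nonpos_Ints_complex) simp
  hence "D (of_real \<beta> / 2) = 0"
    using assms(1) by (simp add: L_entire_def L_factor_nonzero rGamma_eq_zero_iff)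
  moreover have "D (of_real \<beta> / 2) = of_real (\<integral>u. h u * exp (\<beta> / 2 * u) \<partial>lborel)"
    unfolding D_def integral_complex_of_real [symmetric]
    by (rule Bochner_Integration.integral_cong) (auto simp: exp_of_real [symmetric])
  ultimately show ?thesis by simp
qed

end

section \<open>The convolution of theta series\<close>

definition psi_exp :: "real \<Rightarrow> real" where "psi_exp u = psi (exp u)"

text \<open>\<open>psi x\<close> behaves like \<open>1 / (2 * sqrt x)\<close> near 0. Removing this
  term leaves a function whose Mellin integral at \<open>s / 2\<close> converges exactly in the
  strip needed, \<open>0 < s < 1\<close>.\<close>

definition psi_reg :: "real \<Rightarrow> real" where "psi_reg u = psi_exp u - exp (- u / 2) / 2"

lemma psi_exp_measurable [measurable]: "psi_exp \<in> borel_measurable borel"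
  unfolding psi_exp_def by measurable

lemma psi_reg_measurable [measurable]: "psi_reg \<in> borel_measurable borel"
  unfolding psi_reg_def by measurable

lemma psi_exp_pos: "psi_exp u > 0"
  by (simp add: psi_exp_def psi_pos)

lemma psi_exp_minus: "psi_exp (- u) = exp (u / 2) * psi_exp u + exp (u / 2) / 2 - 1 / 2"
proof -
  have "sqrt (exp u) = exp (u / 2)" by (rule real_sqrt_unique) (auto simp flip: exp_of_nat_mult)
  thus ?thesis using psi_functional_equation[of "exp u"]
    by (simp add: psi_exp_def exp_minus inverse_eq_divide)
qed

lemma psi_exp_bound: "\<exists>C\<ge>0. \<forall>u. psi_exp u \<le> C * exp (\<bar>u\<bar> / 2)"
proof -
  obtain C where C: "C \<ge> 0" "\<And>u. u \<ge> 0 \<Longrightarrow> psi (1 * exp u) \<le> C * exp (- 0 * u)"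
    using psi_exp_decay[of 1 0] by auto
  have pos: "psi_exp u \<le> C" if "u \<ge> 0" for u using C(2)[OF that] by (simp add: psi_exp_def)
  have "psi_exp u \<le> (C + 1) * exp (\<bar>u\<bar> / 2)" for u
  proof (cases "u \<ge> 0")
    case True
    have "C * 1 \<le> (C + 1) * exp (\<bar>u\<bar> / 2)" using C by (intro mult_mono) auto
    thus ?thesis using pos[OF True] by simp
  next
    case False
    define v where "v = - u"
    have v: "v \<ge> 0" "u = - v" using False by (auto simp: v_def)
    have "psi_exp u \<le> exp (v / 2) * psi_exp v + exp (v / 2) / 2" unfolding v(2) psi_exp_minus by simp
    also have "\<dots> \<le> exp (v / 2) * C + exp (v / 2) / 2"
      by (intro add_right_mono mult_left_mono pos v) auto
    also have "\<dots> \<le> (C + 1) * exp (v / 2)" by (simp add: algebra_simps)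
    finally show ?thesis using v by simp
  qed
  thus ?thesis using C by (intro exI[of _ "C + 1"]) auto
qed

lemma psi_reg_bound: "\<exists>C\<ge>0. \<forall>u. \<bar>psi_reg u\<bar> \<le> C \<and> (u \<ge> 0 \<longrightarrow> \<bar>psi_reg u\<bar> \<le> C * exp (- u / 2))"
proof -
  obtain C where C: "C \<ge> 0" "\<And>u. u \<ge> 0 \<Longrightarrow> psi (1 * exp u) \<le> C * exp (- (1 / 2) * u)"
    using psi_exp_decay[of 1 "1/2"] by auto
  have p: "psi_exp u \<le> C * exp (- u / 2)" if "u \<ge> 0" for u using C(2)[OF that] by (simp add: psi_exp_def)
  have pos: "\<bar>psi_reg u\<bar> \<le> (C + 1) * exp (- u / 2)" if "u \<ge> 0" for u
  proof -
    have "\<bar>psi_reg u\<bar> \<le> psi_exp u + exp (- u / 2) / 2"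
      using psi_exp_pos[of u] by (simp add: psi_reg_def abs_le_iff)
    also have "\<dots> \<le> C * exp (- u / 2) + exp (- u / 2)" by (intro add_mono p that) simp
    also have "\<dots> = (C + 1) * exp (- u / 2)" by (simp add: algebra_simps)
    finally show ?thesis .
  qed
  have "\<bar>psi_reg u\<bar> \<le> C + 1" for u
  proof (cases "u \<ge> 0")
    case True
    have "(C + 1) * exp (- u / 2) \<le> (C + 1) * 1" using True C by (intro mult_left_mono) auto
    thus ?thesis using pos[OF True] by simp
  next
    case False
    define v where "v = - u"
    have v: "v \<ge> 0" "u = - v" using False by (auto simp: v_def)
    have "psi_reg u = exp (v / 2) * psi_exp v - 1 / 2" by (simp add: psi_reg_def v psi_exp_minus)
    moreover have "exp (v / 2) * psi_exp v \<le> exp (v / 2) * (C * exp (- v / 2))"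
      by (intro mult_left_mono p v) auto
    moreover have "exp (v / 2) * (C * exp (- v / 2)) = C" by (simp add: exp_minus)
    moreover have "exp (v / 2) * psi_exp v \<ge> 0" using psi_exp_pos[of v] by simp
    ultimately show ?thesis using C by linarith
  qed
  thus ?thesis using C pos by (intro exI[of _ "C + 1"]) auto
qed

lemma integrable_psi_reg_exp:
  assumes s: "0 < s" "s < 1"
  shows "integrable lborel (\<lambda>u. psi_reg u * exp (s / 2 * u))"
proof -
  obtain C where C: "C \<ge> 0" "\<And>u. \<bar>psi_reg u\<bar> \<le> C" "\<And>u. u \<ge> 0 \<Longrightarrow> \<bar>psi_reg u\<bar> \<le> C * exp (- u / 2)"
    using psi_reg_bound by blast
  \<comment> \<open>The integrand decays at rate \<open>s / 2\<close> towards minus infinity and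
    \<open>(1 - s) / 2\<close> towards plus infinity; k is the smaller of the two.\<close>
  define k where "k = min s (1 - s) / 2"
  have k: "k > 0" "k \<le> s / 2" "k \<le> (1 - s) / 2" using s by (auto simp: k_def)
  show ?thesis
  proof (rule Bochner_Integration.integrable_bound)
    show "integrable lborel (\<lambda>u::real. C * exp (- k * \<bar>u\<bar>))"
      by (intro integrable_mult_right integrable_exp_neg_abs k)
    show "AE u in lborel. norm (psi_reg u * exp (s / 2 * u)) \<le> norm (C * exp (- k * \<bar>u\<bar>))"
    proof (rule AE_I2)
      fix u :: real
      have "\<bar>psi_reg u\<bar> * exp (s / 2 * u) \<le> C * exp (- k * \<bar>u\<bar>)"
      proof (cases "u \<ge> 0")
        case True
        have "\<bar>psi_reg u\<bar> * exp (s / 2 * u) \<le> C * exp (- u / 2) * exp (s / 2 * u)"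
          by (intro mult_right_mono C True) auto
        also have "\<dots> = C * exp (- ((1 - s) / 2) * u)" by (simp add: field_simps flip: exp_add)
        also have "\<dots> \<le> C * exp (- k * u)"
          using C mult_right_mono[OF k(3) True] by (intro mult_left_mono) auto
        finally show ?thesis using True by simp
      next
        case False
        have "\<bar>psi_reg u\<bar> * exp (s / 2 * u) \<le> C * exp (s / 2 * u)"
          by (intro mult_right_mono C) auto
        also have "\<dots> \<le> C * exp (k * u)"
          using C mult_right_mono_neg[OF k(2), of u] False by (intro mult_left_mono) auto
        finally show ?thesis using False by simp
      qed
      thus "norm (psi_reg u * exp (s / 2 * u)) \<le> norm (C * exp (- k * \<bar>u\<bar>))" using C by (simp add: abs_mult)
    qed
  qed measurable
qed

context nontrivial_primitive_quadratic
begin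

lemma integrable_h: "integrable lborel h"
  using integrable_h_exp[of 0] by (subst integrable_norm_iff [symmetric]) auto

lemma integrable_h_mult:
  assumes [measurable]: "f \<in> borel_measurable borel" and f: "\<And>u. \<bar>f u\<bar> \<le> C * exp (K * \<bar>u\<bar>)"
  shows "integrable lborel (\<lambda>u. f u * h u)"
proof (rule Bochner_Integration.integrable_bound)
  show "integrable lborel (\<lambda>u. C * (\<bar>h u\<bar> * exp (K * \<bar>u\<bar>)))"
    by (intro integrable_mult_right integrable_h_exp)
  have "\<bar>f u\<bar> * \<bar>h u\<bar> \<le> C * exp (K * \<bar>u\<bar>) * \<bar>h u\<bar>" for u
    by (intro mult_right_mono f) auto
  also have "C * exp (K * \<bar>u\<bar>) * \<bar>h u\<bar> \<le> \<bar>C * (\<bar>h u\<bar> * exp (K * \<bar>u\<bar>))\<bar>" for u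
    by (simp add: mult_ac)
  finally show "AE u in lborel. norm (f u * h u) \<le> norm (C * (\<bar>h u\<bar> * exp (K * \<bar>u\<bar>)))"
    by (intro AE_I2) (simp add: abs_mult)
qed measurable

lemma integrable_exp_h: "integrable lborel (\<lambda>u. exp (K * u) * h u)"
proof (rule integrable_h_mult[where C = 1 and K = "\<bar>K\<bar>"])
  fix u
  have "K * u \<le> \<bar>K\<bar> * \<bar>u\<bar>" by (metis abs_ge_self abs_mult)
  thus "\<bar>exp (K * u)\<bar> \<le> 1 * exp (\<bar>K\<bar> * \<bar>u\<bar>)" by simp
qed measurable

text \<open>By \<open>h_minus\<close> this is also half the integral of
  \<open>exp (u / 2) * h u\<close>, the completed L-function at 1 up to a positive factor.\<close>

definition c0 :: real where "c0 = (\<integral>u. h u \<partial>lborel) / 2"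

lemma integral_exp_half_h: "(\<integral>u. exp (u / 2) * h u \<partial>lborel) = 2 * c0"
  using lborel_integral_real_affine[of "-1" h 0] by (simp add: c0_def h_minus)

text \<open>The two arguments have sum \<open>2 * u\<close>, so \<open>exp (s * u)\<close> factors
  as exponentials at \<open>s / 2\<close> in each of them. The transform of \<open>S\<close> at s is
  a product of the two transforms at \<open>s / 2\<close>.\<close>

definition S :: "real \<Rightarrow> real" where "S u = (\<integral>x. psi_exp (u - x) * h (u + x) \<partial>lborel)"

lemma integrable_shifted:
  assumes "integrable lborel (f :: real \<Rightarrow> real)"
  shows "integrable lborel (\<lambda>x. f (u + x))" "integrable lborel (\<lambda>x. f (u - x))"
  using lborel_integrable_real_affine[OF assms, of 1 u] lborel_integrable_real_affine[OF assms, of "-1" u]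
  by simp_all

lemma integral_shifted:
  fixes f :: "real \<Rightarrow> real"
  shows "(\<integral>x. f (u + x) \<partial>lborel) = (\<integral>x. f x \<partial>lborel)" "(\<integral>x. f (u - x) \<partial>lborel) = (\<integral>x. f x \<partial>lborel)"
  using lborel_integral_real_affine[of 1 f u] lborel_integral_real_affine[of "-1" f u] by simp_all

lemma S_integrable: "integrable lborel (\<lambda>x. psi_exp (u - x) * h (u + x))"
proof -
  obtain C where C: "C \<ge> 0" "\<And>u. psi_exp u \<le> C * exp (\<bar>u\<bar> / 2)" using psi_exp_bound by blast
  have "integrable lborel (\<lambda>y. psi_exp (2 * u - y) * h y)"
  proof (rule integrable_h_mult[where C = "C * exp \<bar>u\<bar>" and K = "1/2"])
    fix y
    have "\<bar>psi_exp (2 * u - y)\<bar> \<le> C * exp (\<bar>2 * u - y\<bar> / 2)"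
      using C(2)[of "2 * u - y"] psi_exp_pos[of "2 * u - y"] by simp
    also have "\<dots> \<le> C * exp (\<bar>u\<bar> + 1/2 * \<bar>y\<bar>)"
      using C(1) by (intro mult_left_mono) auto
    finally show "\<bar>psi_exp (2 * u - y)\<bar> \<le> C * exp \<bar>u\<bar> * exp (1/2 * \<bar>y\<bar>)" by (simp add: exp_add mult.assoc)
  qed measurable
  from integrable_shifted(1)[OF this, of u] show ?thesis by (simp add: algebra_simps)
qed

text \<open>After x is replaced by \<open>- x\<close>, the factors of the two functional equations
  multiply to \<open>exp u\<close>. The inhomogeneous terms for \<open>psi_exp\<close> leave two
  integrals of \<open>h\<close>, both equal to \<open>2 * c0\<close>.\<close>

lemma S_minus: "S (- u) = exp u * S u + c0 * (exp u - 1)"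
proof -
  have eq: "psi_exp (- u - x) * h (- u + x) =
      exp u * (psi_exp (u - (- x)) * h (u + (- x))) + (exp u / 2 * h (u - x) - 1/2 * (exp ((u - x) / 2) * h (u - x)))" for x
  proof -
    have 1: "psi_exp (- u - x) = exp ((u + x) / 2) * psi_exp (u + x) + exp ((u + x) / 2) / 2 - 1 / 2"
      using psi_exp_minus[of "u + x"] by simp
    have 2: "h (- u + x) = exp ((u - x) / 2) * h (u - x)" using h_minus[of "u - x"] by simp
    have 3: "exp ((u + x) / 2) * exp ((u - x) / 2) = exp u" by (simp add: field_simps flip: exp_add)
    have "psi_exp (- u - x) * h (- u + x) =
       (exp ((u + x) / 2) * exp ((u - x) / 2)) * (psi_exp (u + x) * h (u - x)) +
       ((exp ((u + x) / 2) * exp ((u - x) / 2)) / 2 * h (u - x) - 1/2 * (exp ((u - x) / 2) * h (u - x)))"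
      unfolding 1 2 by (simp add: algebra_simps)
    thus ?thesis unfolding 3 by simp
  qed
  have i1: "integrable lborel (\<lambda>x. psi_exp (u - (- x)) * h (u + (- x)))"
    using integrable_shifted(2)[OF S_integrable[of u], of 0] by simp
  have i2: "integrable lborel (\<lambda>x. h (u - x))" by (rule integrable_shifted(2)[OF integrable_h])
  have i3: "integrable lborel (\<lambda>x. exp ((u - x) / 2) * h (u - x))"
    using integrable_shifted(2)[OF integrable_exp_h[of "1/2"], of u] by simp
  have "(\<integral>x. psi_exp (u - (- x)) * h (u + (- x)) \<partial>lborel) = S u"
    using integral_shifted(2)[of "\<lambda>x. psi_exp (u - x) * h (u + x)" 0] by (simp add: S_def)
  moreover have "(\<integral>x. h (u - x) \<partial>lborel) = 2 * c0" by (simp add: integral_shifted c0_def)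
  moreover have "(\<integral>x. exp ((u - x) / 2) * h (u - x) \<partial>lborel) = 2 * c0"
    using integral_shifted(2)[of "\<lambda>x. exp (x / 2) * h x" u] by (simp add: integral_exp_half_h)
  moreover have "S (- u) = exp u * (\<integral>x. psi_exp (u - (- x)) * h (u + (- x)) \<partial>lborel) +
     (exp u / 2 * (\<integral>x. h (u - x) \<partial>lborel) - 1/2 * (\<integral>x. exp ((u - x) / 2) * h (u - x) \<partial>lborel))"
    unfolding S_def eq using i1 i2 i3
    by (subst Bochner_Integration.integral_add, simp, simp, subst Bochner_Integration.integral_diff) simp_all
  ultimately show ?thesis by (simp add: algebra_simps)
qed

text \<open>Removing the singular part of \<open>psi_exp\<close> under the integral costs exactly
  \<open>c0 * exp (- u)\<close>, because \<open>exp (x / 2) * h x\<close> has integral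
  \<open>2 * c0\<close>.\<close>

lemma S_reg: "S u - c0 * exp (- u) = (\<integral>z. psi_reg (2 * u - z) * h z \<partial>lborel)"
proof -
  have "(\<integral>z. psi_reg (2 * u - z) * h z \<partial>lborel) = (\<integral>x. psi_reg (u - x) * h (u + x) \<partial>lborel)"
    using integral_shifted(1)[of "\<lambda>z. psi_reg (2 * u - z) * h z" u] by (simp add: algebra_simps)
  also have "\<dots> = (\<integral>x. psi_exp (u - x) * h (u + x) - exp (- u) / 2 * (exp ((u + x) / 2) * h (u + x)) \<partial>lborel)"
  proof (rule Bochner_Integration.integral_cong)
    fix x
    have "exp (- (u - x) / 2) = exp (- u) * exp ((u + x) / 2)" by (simp add: field_simps flip: exp_add)
    thus "psi_reg (u - x) * h (u + x) = psi_exp (u - x) * h (u + x) - exp (- u) / 2 * (exp ((u + x) / 2) * h (u + x))"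
      by (simp add: psi_reg_def algebra_simps)
  qed simp
  also have "\<dots> = S u - exp (- u) / 2 * (\<integral>x. exp ((u + x) / 2) * h (u + x) \<partial>lborel)"
    unfolding S_def using S_integrable[of u] integrable_shifted(1)[OF integrable_exp_h[of "1/2"], of u]
    by (subst Bochner_Integration.integral_diff) simp_all
  also have "(\<integral>x. exp ((u + x) / 2) * h (u + x) \<partial>lborel) = 2 * c0"
    using integral_shifted(1)[of "\<lambda>x. exp (x / 2) * h x" u] by (simp add: integral_exp_half_h)
  finally show ?thesis by simp
qed

text \<open>Fubini's theorem and the substitution \<open>y = 2 * u - z\<close> factor the transform,
  and one factor is the integral assumed to vanish.\<close>

lemma mellin_S:
  assumes s: "0 < s" "s < 1" and zero: "(\<integral>u. h u * exp (s / 2 * u) \<partial>lborel) = 0"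
  shows "integrable lborel (\<lambda>u. (S u - c0 * exp (- u)) * exp (s * u))"
    and "(\<integral>u. (S u - c0 * exp (- u)) * exp (s * u) \<partial>lborel) = 0"
proof -
  define G where "G = (\<lambda>z u. psi_reg (2 * u - z) * h z * exp (s * u))"
  have Gm: "(\<lambda>(z, u). G z u) \<in> borel_measurable (lborel \<Otimes>\<^sub>M lborel)" unfolding G_def by measurable
  have hb: "has_bochner_integral lborel (G z) (h z * exp (s / 2 * z) / 2 * (\<integral>y. psi_reg y * exp (s / 2 * y) \<partial>lborel))"
    and hn: "has_bochner_integral lborel (\<lambda>u. norm (G z u))
          (\<bar>h z\<bar> * exp (s / 2 * z) / 2 * (\<integral>y. norm (psi_reg y * exp (s / 2 * y)) \<partial>lborel))" for z
  proof -
    let ?f = "\<lambda>y. psi_reg y * exp (s / 2 * y)"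
    have "has_bochner_integral lborel ?f (integral\<^sup>L lborel ?f)"
      using integrable_psi_reg_exp[OF s] by (simp add: has_bochner_integral_iff)
    hence "has_bochner_integral lborel (\<lambda>u. ?f (- z + 2 * u)) (integral\<^sup>L lborel ?f /\<^sub>R \<bar>2\<bar>)"
      by (subst (asm) lborel_has_bochner_integral_real_affine_iff[where c = 2 and t = "- z"]) auto
    hence "has_bochner_integral lborel (\<lambda>u. (h z * exp (s / 2 * z)) * ?f (- z + 2 * u)) ((h z * exp (s / 2 * z)) * (integral\<^sup>L lborel ?f /\<^sub>R \<bar>2\<bar>))"
      by (intro has_bochner_integral_mult_right) simp
    moreover have eq: "(h z * exp (s / 2 * z)) * ?f (- z + 2 * u) = G z u" for u
    proof -
      have "exp (s / 2 * z) * exp (s / 2 * (- z + 2 * u)) = exp (s * u)" by (simp add: algebra_simps flip: exp_add)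
      moreover have "(h z * exp (s / 2 * z)) * ?f (- z + 2 * u) =
          psi_reg (2 * u - z) * h z * (exp (s / 2 * z) * exp (s / 2 * (- z + 2 * u)))" by simp
      ultimately show ?thesis by (simp only: G_def)
    qed
    ultimately show "has_bochner_integral lborel (G z) (h z * exp (s / 2 * z) / 2 * integral\<^sup>L lborel ?f)" by simp
    have "has_bochner_integral lborel (\<lambda>y. norm (?f y)) (integral\<^sup>L lborel (\<lambda>y. norm (?f y)))"
      using integrable_norm[OF integrable_psi_reg_exp[OF s]] by (simp add: has_bochner_integral_iff)
    hence "has_bochner_integral lborel (\<lambda>u. norm (?f (- z + 2 * u))) (integral\<^sup>L lborel (\<lambda>y. norm (?f y)) /\<^sub>R \<bar>2\<bar>)"
      by (subst (asm) lborel_has_bochner_integral_real_affine_iff[where c = 2 and t = "- z"]) auto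
    hence "has_bochner_integral lborel (\<lambda>u. norm (h z * exp (s / 2 * z)) * norm (?f (- z + 2 * u)))
       (norm (h z * exp (s / 2 * z)) * (integral\<^sup>L lborel (\<lambda>y. norm (?f y)) /\<^sub>R \<bar>2\<bar>))"
      by (intro has_bochner_integral_mult_right) simp
    thus "has_bochner_integral lborel (\<lambda>u. norm (G z u)) (\<bar>h z\<bar> * exp (s / 2 * z) / 2 * (\<integral>y. norm (?f y) \<partial>lborel))"
      by (simp add: eq [symmetric] norm_mult abs_mult mult_ac)
  qed
  have Gi: "integrable (lborel \<Otimes>\<^sub>M lborel) (\<lambda>(z, u). G z u)"
  proof (rule lborel_pair.Fubini_integrable[OF Gm])
    have "integrable lborel (\<lambda>z. \<bar>exp (s / 2 * z) * h z\<bar> * (1 / 2 * (\<integral>y. norm (psi_reg y * exp (s / 2 * y)) \<partial>lborel)))"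
      by (intro integrable_mult_left integrable_abs integrable_exp_h)
    moreover have "\<bar>exp (s / 2 * z) * h z\<bar> * (1 / 2 * (\<integral>y. norm (psi_reg y * exp (s / 2 * y)) \<partial>lborel)) =
        (\<integral>u. norm (case (z, u) of (z, u) \<Rightarrow> G z u) \<partial>lborel)" for z
      unfolding prod.case has_bochner_integral_integral_eq[OF hn] by (simp add: abs_mult)
    ultimately show "integrable lborel (\<lambda>z. \<integral>u. norm (case (z, u) of (z, u) \<Rightarrow> G z u) \<partial>lborel)"
      by (simp only:)
    show "AE z in lborel. integrable lborel (\<lambda>u. case (z, u) of (z, u) \<Rightarrow> G z u)"
      using hb by (intro AE_I2) (auto simp: has_bochner_integral_iff)
  qed
  have eq: "(\<integral>z. G z u \<partial>lborel) = (S u - c0 * exp (- u)) * exp (s * u)" for u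
    unfolding S_reg G_def by simp
  show "integrable lborel (\<lambda>u. (S u - c0 * exp (- u)) * exp (s * u))"
    using lborel_pair.integrable_snd[OF Gi] by (simp add: eq)
  have "(\<integral>u. (S u - c0 * exp (- u)) * exp (s * u) \<partial>lborel) = (\<integral>u. \<integral>z. G z u \<partial>lborel \<partial>lborel)" by (simp add: eq)
  also have "\<dots> = (\<integral>z. \<integral>u. G z u \<partial>lborel \<partial>lborel)"
    by (rule lborel_pair.Fubini_integral[OF Gi])
  also have "\<dots> = (\<integral>z. (h z * exp (s / 2 * z)) * (1 / 2 * (\<integral>y. psi_reg y * exp (s / 2 * y) \<partial>lborel)) \<partial>lborel)"
 unfolding has_bochner_integral_integral_eq[OF hb] by simp
  also have "\<dots> = 0" by (subst integral_mult_left_zero) (simp only: zero mult_zero_left)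
  finally show "(\<integral>u. (S u - c0 * exp (- u)) * exp (s * u) \<partial>lborel) = 0" .
qed

text \<open>Folding the vanishing transform at 0 with \<open>S_minus\<close> gives an identity:
  \<open>c0 / (s * (1 - s))\<close> is the integral over \<open>u > 0\<close> of
  \<open>S u * (exp (s * u) + exp ((1 - s) * u))\<close>. Both exponents are at most u.\<close>

theorem c0_le_of_zero:
  assumes s: "0 < s" "s < 1" and zero: "(\<integral>u. h u * exp (s / 2 * u) \<partial>lborel) = 0"
    and S_nonneg: "\<And>u. S u \<ge> 0"
  shows "ennreal (c0 / (s * (1 - s))) \<le> (\<integral>\<^sup>+u. ennreal (2 * (S u * exp u)) * indicator {0<..} u \<partial>lborel)"
proof -
  define R where "R = (\<lambda>u. (S u - c0 * exp (- u)) * exp (s * u))"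
  have R: "integrable lborel R" "integral\<^sup>L lborel R = 0" using mellin_S[OF s zero] by (simp_all add: R_def)
  have Rp: "integrable lborel (\<lambda>u. indicator {0<..} u *\<^sub>R R u)" and Rn: "integrable lborel (\<lambda>u. indicator {..<0} u *\<^sub>R R u)"
    by (rule integrable_mult_indicator[OF _ R(1)]; simp)+
  have Rn': "integrable lborel (\<lambda>u. indicator {0<..} u *\<^sub>R R (- u))"
    using integrable_shifted(2)[OF Rn, of 0] by (simp add: indicator_def if_distrib cong: if_cong)
  have "0 = (\<integral>u. indicator {0<..} u *\<^sub>R R u + indicator {..<0} u *\<^sub>R R u \<partial>lborel)"
  proof -
    have "integral\<^sup>L lborel R = (\<integral>u. indicator {0<..} u *\<^sub>R R u + indicator {..<0} u *\<^sub>R R u \<partial>lborel)"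
    proof (rule integral_cong_AE)
      show "AE u in lborel. R u = indicator {0<..} u *\<^sub>R R u + indicator {..<0} u *\<^sub>R R u"
        using AE_lborel_singleton[of 0] by eventually_elim (auto simp: indicator_def)
    qed (use R Rp Rn in auto)
    thus ?thesis using R(2) by simp
  qed
  also have "\<dots> = (\<integral>u. indicator {0<..} u *\<^sub>R R u \<partial>lborel) + (\<integral>u. indicator {..<0} u *\<^sub>R R u \<partial>lborel)"
    by (rule Bochner_Integration.integral_add[OF Rp Rn])
  also have "(\<integral>u. indicator {..<0} u *\<^sub>R R u \<partial>lborel) = (\<integral>u. indicator {0<..} u *\<^sub>R R (- u) \<partial>lborel)"
    using integral_shifted(2)[of "\<lambda>u. indicator {..<0} u *\<^sub>R R u" 0]
    by (simp add: indicator_def if_distrib cong: if_cong)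
  also have "(\<integral>u. indicator {0<..} u *\<^sub>R R u \<partial>lborel) + \<dots> = (\<integral>u. indicator {0<..} u *\<^sub>R (R u + R (- u)) \<partial>lborel)"
    by (subst Bochner_Integration.integral_add [symmetric, OF Rp Rn']) (simp add: algebra_simps)
  finally have tot: "(\<integral>u. indicator {0<..} u *\<^sub>R (R u + R (- u)) \<partial>lborel) = 0" by simp
  have tot_i: "integrable lborel (\<lambda>u. indicator {0<..} u *\<^sub>R (R u + R (- u)))"
    using Bochner_Integration.integrable_add[OF Rp Rn'] by (simp add: algebra_simps)
  define W where "W = (\<lambda>u. S u * (exp (s * u) + exp ((1 - s) * u)))"
  have RW: "R u + R (- u) = W u - c0 * (exp (- (1 - s) * u) + exp (- s * u))" for u
  proof -
    have "R (- u) = (exp u * S u - c0) * exp (- s * u)" by (simp add: R_def S_minus algebra_simps)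
    also have "\<dots> = S u * (exp u * exp (- s * u)) - c0 * exp (- s * u)" by (simp add: algebra_simps)
    also have "exp u * exp (- s * u) = exp ((1 - s) * u)" by (simp add: algebra_simps flip: exp_add)
    finally have 1: "R (- u) = S u * exp ((1 - s) * u) - c0 * exp (- s * u)" .
    have "R u = S u * exp (s * u) - c0 * (exp (- u) * exp (s * u))" by (simp add: R_def algebra_simps)
    also have "exp (- u) * exp (s * u) = exp (- (1 - s) * u)" by (simp add: algebra_simps flip: exp_add)
    finally show ?thesis using 1 by (simp add: W_def algebra_simps)
  qed
  have E: "has_bochner_integral lborel (\<lambda>u. indicator {0<..} u *\<^sub>R exp (- k * u)) (1 / k)" if "k > 0" for k :: real
  proof -
    have "(\<integral>\<^sup>+u. ennreal (exp (- k * u)) * indicator {0..} u \<partial>lborel) = 0 - (- (1 / k) * exp (- k * 0))"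
    proof (rule nn_integral_FTC_atLeast)
      show "((\<lambda>u. - (1 / k) * exp (- k * u)) \<longlongrightarrow> 0) at_top" using that by real_asymp
    qed (use that in \<open>auto intro!: derivative_eq_intros\<close>)
    moreover have "(\<integral>\<^sup>+u. ennreal (exp (- k * u)) * indicator {0..} u \<partial>lborel) =
        (\<integral>\<^sup>+u. ennreal (indicator {0<..} u *\<^sub>R exp (- k * u)) \<partial>lborel)"
      by (rule nn_integral_cong_AE)
         (use AE_lborel_singleton[of 0] in \<open>eventually_elim, auto simp: indicator_def\<close>)
    ultimately show ?thesis using that by (intro has_bochner_integral_nn_integral) auto
  qed
  have E2: "has_bochner_integral lborel (\<lambda>u. c0 * (indicator {0<..} u *\<^sub>R exp (- (1 - s) * u) + indicator {0<..} u *\<^sub>R exp (- s * u)))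
      (c0 * (1 / (1 - s) + 1 / s))"
    by (intro has_bochner_integral_mult_right has_bochner_integral_add E) (use s in auto)
  have "has_bochner_integral lborel (\<lambda>u. indicator {0<..} u *\<^sub>R (R u + R (- u))) 0"
    using tot tot_i by (simp add: has_bochner_integral_iff)
  from has_bochner_integral_add[OF this E2]
  have "has_bochner_integral lborel (\<lambda>u. indicator {0<..} u *\<^sub>R W u) (c0 * (1 / (1 - s) + 1 / s))"
    unfolding RW by (simp add: algebra_simps)
  moreover have "c0 * (1 / (1 - s) + 1 / s) = c0 / (s * (1 - s))" using s by (simp add: field_simps)
  ultimately have "ennreal (c0 / (s * (1 - s))) = (\<integral>\<^sup>+u. ennreal (indicator {0<..} u *\<^sub>R W u) \<partial>lborel)"
    using S_nonneg by (subst nn_integral_eq_integral) (auto simp: has_bochner_integral_iff W_def)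
  also have "\<dots> \<le> (\<integral>\<^sup>+u. ennreal (2 * (S u * exp u)) * indicator {0<..} u \<partial>lborel)"
  proof (rule nn_integral_mono)
    fix u :: real
    show "ennreal (indicator {0<..} u *\<^sub>R W u) \<le> ennreal (2 * (S u * exp u)) * indicator {0<..} u"
    proof (cases "u > 0")
      case True
      have "s * u \<le> 1 * u" "(1 - s) * u \<le> 1 * u" using True s by (auto intro!: mult_right_mono)
      hence "exp (s * u) + exp ((1 - s) * u) \<le> exp u + exp u" by (intro add_mono) auto
      hence "W u \<le> S u * (exp u + exp u)" unfolding W_def by (intro mult_left_mono S_nonneg)
      thus ?thesis using True by (simp add: ennreal_leI)
    qed simp
  qed
  finally show ?thesis .
qed

end

section \<open>Nonnegativity of the coefficients\<close>

lemma has_sum_product_nat: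
  fixes a b :: "nat \<Rightarrow> real"
  assumes a: "summable (\<lambda>n. \<bar>a n\<bar>)" and b: "summable (\<lambda>n. \<bar>b n\<bar>)"
  shows "((\<lambda>(i, j). a i * b j) has_sum (suminf a * suminf b)) UNIV"
    and "(\<lambda>z. norm (case z of (i, j) \<Rightarrow> a i * b j)) summable_on UNIV"
proof -
  have ha: "(a has_sum suminf a) UNIV"
    by (rule norm_summable_imp_has_sum[OF _ summable_sums[OF summable_rabs_cancel[OF a]]]) (use a in simp)
  have hb: "(b has_sum suminf b) UNIV"
    by (rule norm_summable_imp_has_sum[OF _ summable_sums[OF summable_rabs_cancel[OF b]]]) (use b in simp)
  have hb': "((\<lambda>n. \<bar>b n\<bar>) has_sum (\<Sum>n. \<bar>b n\<bar>)) UNIV"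
    by (rule norm_summable_imp_has_sum[OF _ summable_sums[OF b]]) (use b in simp)
  have ha': "(\<lambda>n. \<bar>a n\<bar>) summable_on UNIV"
    using a by (intro norm_summable_imp_summable_on) auto
  have "(\<lambda>(i, j). \<bar>a i\<bar> * \<bar>b j\<bar>) summable_on (UNIV \<times> UNIV)"
  proof (rule summable_on_SigmaI)
    show "((\<lambda>j. case (i, j) of (i, j) \<Rightarrow> \<bar>a i\<bar> * \<bar>b j\<bar>) has_sum (\<bar>a i\<bar> * (\<Sum>n. \<bar>b n\<bar>))) UNIV" for i
      using has_sum_cmult_right[OF hb'] by simp
    show "(\<lambda>i. \<bar>a i\<bar> * (\<Sum>n. \<bar>b n\<bar>)) summable_on UNIV"
      by (rule summable_on_cmult_left[OF ha'])
  qed auto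
  thus abs: "(\<lambda>z. norm (case z of (i, j) \<Rightarrow> a i * b j)) summable_on UNIV"
    by (simp add: case_prod_unfold abs_mult)
  have "((\<lambda>(i, j). a i * b j) has_sum (suminf a * suminf b)) (UNIV \<times> UNIV)"
  proof (rule has_sum_SigmaI)
    show "((\<lambda>j. case (i, j) of (i, j) \<Rightarrow> a i * b j) has_sum (a i * suminf b)) UNIV" for i
      using has_sum_cmult_right[OF hb] by simp
    show "((\<lambda>i. a i * suminf b) has_sum suminf a * suminf b) UNIV"
      by (rule has_sum_cmult_left[OF ha])
    show "(\<lambda>(i, j). a i * b j) summable_on (UNIV \<times> UNIV)"
      using abs_summable_summable[OF abs] by simp
  qed
  thus "((\<lambda>(i, j). a i * b j) has_sum (suminf a * suminf b)) UNIV" by simp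
qed

text \<open>The pairs are enumerated by \<open>prod_decode\<close> so that the theorem on termwise
  integration of ordinary series applies.\<close>

lemma integral_has_sum_pairs:
  fixes f :: "nat \<times> nat \<Rightarrow> real \<Rightarrow> real"
  assumes int: "\<And>z. integrable lborel (f z)"
    and f: "\<And>x. (\<lambda>z. norm (f z x)) summable_on UNIV"
    and s: "(\<lambda>z. \<integral>x. \<bar>f z x\<bar> \<partial>lborel) summable_on UNIV"
  shows "((\<lambda>z. \<integral>x. f z x \<partial>lborel) has_sum (\<integral>x. (\<Sum>\<^sub>\<infinity>z. f z x) \<partial>lborel)) UNIV"
proof -
  have bij: "bij_betw prod_decode UNIV UNIV" by (rule bij_prod_decode)
  have re: "(\<lambda>k. g (prod_decode k)) summable_on UNIV \<longleftrightarrow> g summable_on UNIV" for g :: "nat \<times> nat \<Rightarrow> real"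
    by (rule summable_on_reindex_bij_betw[OF bij])
  have sf: "summable (\<lambda>k. norm (f (prod_decode k) x))" for x
    using f[of x] re[of "\<lambda>z. norm (f z x)"] by (simp add: summable_on_imp_summable)
  have si: "summable (\<lambda>k. \<integral>x. norm (f (prod_decode k) x) \<partial>lborel)"
    using s re[of "\<lambda>z. \<integral>x. \<bar>f z x\<bar> \<partial>lborel"] by (simp add: summable_on_imp_summable)
  have sums: "(\<lambda>k. \<integral>x. f (prod_decode k) x \<partial>lborel) sums (\<integral>x. (\<Sum>k. f (prod_decode k) x) \<partial>lborel)"
    by (intro sums_integral int AE_I2 sf si)
  have "(\<Sum>k. f (prod_decode k) x) = (\<Sum>\<^sub>\<infinity>z. f z x)" for x
  proof -
    have "((\<lambda>k. f (prod_decode k) x) has_sum (\<Sum>\<^sub>\<infinity>z. f z x)) UNIV"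
      by (subst has_sum_reindex_bij_betw[OF bij]) (rule has_sum_infsum[OF abs_summable_summable[OF f]])
    thus ?thesis by (intro sums_unique [symmetric] has_sum_imp_sums)
  qed
  hence "(\<lambda>k. \<integral>x. f (prod_decode k) x \<partial>lborel) sums (\<integral>x. (\<Sum>\<^sub>\<infinity>z. f z x) \<partial>lborel)" using sums by simp
  moreover have "summable (\<lambda>k. norm (\<integral>x. f (prod_decode k) x \<partial>lborel))"
  proof (rule summable_comparison_test'[OF si])
    fix k :: nat
    show "norm (norm (\<integral>x. f (prod_decode k) x \<partial>lborel)) \<le> (\<integral>x. norm (f (prod_decode k) x) \<partial>lborel)"
      using integral_norm_bound[of lborel "f (prod_decode k)"] by simp
  qed
  ultimately have "((\<lambda>k. \<integral>x. f (prod_decode k) x \<partial>lborel) has_sum (\<integral>x. (\<Sum>\<^sub>\<infinity>z. f z x) \<partial>lborel)) UNIV"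
    by (intro norm_summable_imp_has_sum)
  thus ?thesis by (subst (asm) has_sum_reindex_bij_betw[OF bij, of "\<lambda>z. \<integral>x. f z x \<partial>lborel"])
qed

lemma square_part_squarefree_mult:
  fixes s l :: nat
  assumes s: "squarefree s" and l: "l > 0"
  shows "square_part (s * l\<^sup>2) = l"
proof (rule multiplicity_eq_nat)
  have s0: "s \<noteq> 0"
  proof
    assume "s = 0"
    thus False using s not_squarefree_0 by blast
  qed
  have "s * l\<^sup>2 \<noteq> 0" using s0 l by simp
  hence "square_part (s * l\<^sup>2) \<noteq> 0" by (simp only: square_part_0_iff not_False_eq_True)
  thus "square_part (s * l\<^sup>2) > 0" by (rule neq0_conv[THEN iffD1])
  show "l > 0" by (rule l)
  fix p :: nat assume p: "prime p"
  have "multiplicity p s \<le> 1" 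
  proof (rule ccontr)
    assume "\<not> multiplicity p s \<le> 1"
    hence "2 \<le> multiplicity p s" by simp
    hence "p\<^sup>2 dvd s" by (rule multiplicity_dvd')
    hence "p dvd 1" using s unfolding squarefree_def by blast
    thus False using p by simp
  qed
  moreover have "multiplicity p (s * l\<^sup>2) = multiplicity p s + 2 * multiplicity p l"
  proof -
    have pe: "prime_elem p" using p by simp
    have l2: "l\<^sup>2 \<noteq> 0" using l by simp
    show ?thesis
      unfolding prime_elem_multiplicity_mult_distrib[OF pe s0 l2]
      using l by (subst prime_elem_multiplicity_power_distrib[OF pe]) auto
  qed
  ultimately show "multiplicity p (square_part (s * l\<^sup>2)) = multiplicity p l"
    unfolding prime_multiplicity_square_part[OF p] by linarith
qed

lemma squarefree_part_squarefree_mult: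
  fixes s l :: nat
  assumes s: "squarefree s" and l: "l > 0"
  shows "squarefree_part (s * l\<^sup>2) = s"
proof -
  have "squarefree_part (s * l\<^sup>2) * (square_part (s * l\<^sup>2))\<^sup>2 = s * l\<^sup>2"
    by (rule squarefree_decompose [symmetric])
  thus ?thesis using l by (simp add: square_part_squarefree_mult[OF assms])
qed

section \<open>Nonnegative coefficients and the expansion of the convolution\<close>

context nontrivial_primitive_quadratic
begin

text \<open>The Dirichlet coefficients of \<open>\<zeta>(s) L(s,\<chi>) / \<zeta>(2 s)\<close>: the
  indicator of squarefree numbers convolved with the character.\<close>

definition rho :: "nat \<Rightarrow> real" where
  "rho a = (\<Sum>s | s dvd a \<and> squarefree s. X (a div s))"

lemma rho_1 [simp]: "rho (Suc 0) = 1"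
proof -
  have "{s::nat. s dvd Suc 0 \<and> squarefree s} = {Suc 0}" by auto
  thus ?thesis by (simp add: rho_def)
qed

lemma X_power: "X (p ^ k) = X p ^ k"
  by (induction k) (simp_all add: X_mult)

text \<open>A squarefree divisor contains p at most once, hence two terms. Their sum is nonnegative
  for \<open>X p\<close> equal to -1, 0 or 1, which drives the induction for
  \<open>rho_nonneg\<close>.\<close>

lemma rho_prime_power:
  assumes p: "prime p" and b: "\<not> p dvd b" "b > 0"
  shows "rho (p ^ Suc k * b) = (X p ^ Suc k + X p ^ k) * rho b"
proof -
  let ?D = "{d. d dvd b \<and> squarefree d}"
  have p0: "p > 0" using p prime_gt_0_nat by blast
  have fin: "finite ?D" using b(2) by (intro finite_subset[OF _ finite_divisors_nat[of b]]) auto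
  have set: "{s. s dvd p ^ Suc k * b \<and> squarefree s} = ?D \<union> (*) p ` ?D"
  proof (intro equalityI subsetI)
    fix s assume s: "s \<in> {s. s dvd p ^ Suc k * b \<and> squarefree s}"
    show "s \<in> ?D \<union> (*) p ` ?D"
    proof (cases "p dvd s")
      case False
      have "coprime s (p ^ Suc k)" using prime_imp_coprime[OF p False] by (simp add: coprime_commute del: power_Suc)
      thus ?thesis using s by (simp add: coprime_dvd_mult_right_iff)
    next
      case True
      then obtain e where e: "s = p * e" by blast
      have sqe: "squarefree e" using s squarefree_mono[of e s] by (simp add: e)
      have pe: "\<not> p dvd e"
      proof
        assume "p dvd e"
        hence "p\<^sup>2 dvd s" by (simp add: e power2_eq_square)
        moreover have "squarefree s" using s by simp
        ultimately have "p dvd 1" unfolding squarefree_def by blast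
        thus False using p by simp
      qed
      have "coprime e (p ^ k)" using prime_imp_coprime[OF p pe] by (simp add: coprime_commute)
      moreover have "e dvd p ^ k * b" using s e p0 by (simp add: mult.assoc)
      ultimately have "e dvd b" by (simp add: coprime_dvd_mult_right_iff)
      thus ?thesis using e sqe by blast
    qed
  next
    fix s assume "s \<in> ?D \<union> (*) p ` ?D"
    thus "s \<in> {s. s dvd p ^ Suc k * b \<and> squarefree s}"
    proof
      assume "s \<in> (*) p ` ?D"
      then obtain e where e: "s = p * e" "e dvd b" "squarefree e" by blast
      have "\<not> p dvd e" using b(1) e(2) dvd_trans[of p e b] by auto
      hence "coprime p e" by (rule prime_imp_coprime[OF p])
      hence "squarefree s" using e p by (simp add: squarefree_mult_coprime squarefree_prime)
      thus ?thesis using e by (simp add: mult_dvd_mono mult.assoc)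
    qed simp
  qed
  have disj: "?D \<inter> (*) p ` ?D = {}" using b(1) by (auto dest: dvd_mult_left)
  have inj: "inj_on ((*) p) ?D" using p0 by (auto simp: inj_on_def)
  have "rho (p ^ Suc k * b) = (\<Sum>s\<in>?D. X (p ^ Suc k * b div s)) + (\<Sum>s\<in>?D. X (p ^ Suc k * b div (p * s)))"
    unfolding rho_def set using fin by (subst sum.union_disjoint[OF _ _ disj]) (auto simp: sum.reindex[OF inj] o_def)
  also have "(\<Sum>s\<in>?D. X (p ^ Suc k * b div s)) = (\<Sum>s\<in>?D. X p ^ Suc k * X (b div s))"
  proof (rule sum.cong[OF refl])
    fix s assume "s \<in> ?D"
    hence "p ^ Suc k * b div s = p ^ Suc k * (b div s)" by (simp add: div_mult_swap)
    thus "X (p ^ Suc k * b div s) = X p ^ Suc k * X (b div s)" by (simp only: X_mult X_power)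
  qed
  also have "(\<Sum>s\<in>?D. X (p ^ Suc k * b div (p * s))) = (\<Sum>s\<in>?D. X p ^ k * X (b div s))"
  proof (rule sum.cong[OF refl])
    fix s assume "s \<in> ?D"
    hence "p ^ Suc k * b div (p * s) = p ^ k * (b div s)" using p0 by (simp add: div_mult_swap mult.assoc)
    thus "X (p ^ Suc k * b div (p * s)) = X p ^ k * X (b div s)" by (simp only: X_mult X_power)
  qed
  finally show ?thesis by (simp add: rho_def sum_distrib_left distrib_right sum.distrib mult.assoc)
qed

lemma rho_nonneg: "a > 0 \<Longrightarrow> rho a \<ge> 0"
proof (induction a rule: less_induct)
  case (less a)
  show ?case
  proof (cases "a = 1")
    case False
    then obtain p where p: "prime p" "p dvd a" using prime_factor_nat by blast
    define k where "k = multiplicity p a"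
    have "k > 0" using p less.prems by (simp add: k_def prime_multiplicity_gt_zero_iff)
    have "p \<noteq> Suc 0" using p(1) by auto
    then obtain b where b: "a = p ^ k * b" "\<not> p dvd b"
      using multiplicity_decompose'[of a p] less.prems unfolding k_def by auto
    have b0: "b > 0" using b less.prems by (cases "b = 0") auto
    have "b < a"
    proof -
      have "p ^ k > 1" using p(1) \<open>k > 0\<close> prime_gt_1_nat by (intro one_less_power) auto
      thus ?thesis using b(1) b0 by simp
    qed
    moreover obtain j where j: "k = Suc j" using \<open>k > 0\<close> gr0_conv_Suc by blast
    moreover have "X p ^ Suc j + X p ^ j \<ge> 0"
      using X_values[of p] by (cases j) auto
    ultimately show ?thesis
      using less.IH[of b] b0 rho_prime_power[OF p(1) b(2) b0, of j] b(1) by simp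
  qed simp
qed

text \<open>Write \<open>n = s * l\<^sup>2\<close> with s squarefree and put
  \<open>a = s * m\<close>; then \<open>n * m = a * l\<^sup>2\<close>, and for fixed a and l the sum
  over s is \<open>rho a\<close>.\<close>

lemma has_sum_regroup:
  assumes f: "((\<lambda>(n, m). X m * f (n * m)) has_sum T) ({0<..} \<times> {0<..})"
  shows "((\<lambda>(a, l). rho a * f (a * l\<^sup>2)) has_sum T) ({0<..} \<times> {0<..})"
proof -
  let ?P = "{0<..} \<times> {0<..} :: (nat \<times> nat) set"
  let ?B = "\<lambda>z :: nat \<times> nat. {s. s dvd fst z \<and> squarefree s}"
  have bij: "bij_betw (\<lambda>(z, s). (s * (snd z)\<^sup>2, fst z div s)) (Sigma ?P ?B) ?P"
  proof (rule bij_betw_byWitness[where f' = "\<lambda>(n, m). ((squarefree_part n * m, square_part n), squarefree_part n)"])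
    show "\<forall>y\<in>Sigma ?P ?B. (\<lambda>(n, m). ((squarefree_part n * m, square_part n), squarefree_part n))
        ((\<lambda>(z, s). (s * (snd z)\<^sup>2, fst z div s)) y) = y"
    proof
      fix y assume "y \<in> Sigma ?P ?B"
      then obtain a l s where y: "y = ((a, l), s)" "l > 0" "s dvd a" "squarefree s" by (cases y) auto
      show "(\<lambda>(n, m). ((squarefree_part n * m, square_part n), squarefree_part n))
        ((\<lambda>(z, s). (s * (snd z)\<^sup>2, fst z div s)) y) = y"
        unfolding y(1) prod.case fst_conv snd_conv square_part_squarefree_mult[OF y(4,2)]
          squarefree_part_squarefree_mult[OF y(4,2)] dvd_mult_div_cancel[OF y(3)] ..
    qed
    show "\<forall>y\<in>?P. (\<lambda>(z, s). (s * (snd z)\<^sup>2, fst z div s))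
        ((\<lambda>(n, m). ((squarefree_part n * m, square_part n), squarefree_part n)) y) = y"
    proof
      fix y :: "nat \<times> nat" assume "y \<in> ?P"
      obtain n m where y: "y = (n, m)" by force
      show "(\<lambda>(z, s). (s * (snd z)\<^sup>2, fst z div s))
        ((\<lambda>(n, m). ((squarefree_part n * m, square_part n), squarefree_part n)) y) = y"
        unfolding y prod.case fst_conv snd_conv squarefree_decompose [symmetric] by simp
    qed
    show "(\<lambda>(z, s). (s * (snd z)\<^sup>2, fst z div s)) ` Sigma ?P ?B \<subseteq> ?P"
    proof (rule image_subsetI)
      fix y assume "y \<in> Sigma ?P ?B"
      then obtain a l s where y: "y = ((a, l), s)" "a > 0" "l > 0" "s dvd a" by (cases y) auto
      then obtain t where "a = s * t" by blast
      thus "(\<lambda>(z, s). (s * (snd z)\<^sup>2, fst z div s)) y \<in> ?P" using y by auto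
    qed
    show "(\<lambda>(n, m). ((squarefree_part n * m, square_part n), squarefree_part n)) ` ?P \<subseteq> Sigma ?P ?B"
    proof (rule image_subsetI)
      fix y :: "nat \<times> nat" assume "y \<in> ?P"
      then obtain n m where y: "y = (n, m)" "n > 0" "m > 0" by (cases y) auto
      have "squarefree_part n > 0" "square_part n > 0" using y(2) by (auto intro!: Nat.gr0I)
      thus "(\<lambda>(n, m). ((squarefree_part n * m, square_part n), squarefree_part n)) y \<in> Sigma ?P ?B"
        using y by auto
    qed
  qed
  have "((\<lambda>y. (\<lambda>(n, m). X m * f (n * m)) ((\<lambda>(z, s). (s * (snd z)\<^sup>2, fst z div s)) y)) has_sum T) (Sigma ?P ?B)"
    using f by (subst has_sum_reindex_bij_betw[OF bij])
  hence "((\<lambda>(z, s). X (fst z div s) * f (fst z * (snd z)\<^sup>2)) has_sum T) (Sigma ?P ?B)"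
  proof (rule has_sum_cong[THEN iffD1, rotated])
    fix y assume "y \<in> Sigma ?P ?B"
    then obtain a l s where y: "y = ((a, l), s)" "s dvd a" by (cases y) auto
    then obtain t where "a = s * t" by blast
    thus "(\<lambda>(n, m). X m * f (n * m)) ((\<lambda>(z, s). (s * (snd z)\<^sup>2, fst z div s)) y) =
       (case y of (z, s) \<Rightarrow> X (fst z div s) * f (fst z * (snd z)\<^sup>2))"
      by (cases "s = 0") (simp_all add: y mult_ac)
  qed
  hence "((\<lambda>z. \<Sum>s\<in>?B z. X (fst z div s) * f (fst z * (snd z)\<^sup>2)) has_sum T) ?P"
  proof (rule has_sum_SigmaD)
    fix z assume "z \<in> ?P"
    hence "finite (?B z)" by (intro finite_subset[OF _ finite_divisors_nat[of "fst z"]]) auto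
    thus "((\<lambda>s. case (z, s) of (z, s) \<Rightarrow> X (fst z div s) * f (fst z * (snd z)\<^sup>2)) has_sum
       (\<Sum>s\<in>?B z. X (fst z div s) * f (fst z * (snd z)\<^sup>2))) (?B z)"
      by (simp add: has_sum_finite)
  qed
  thus ?thesis by (simp add: rho_def sum_distrib_right case_prod_unfold)
qed

definition K :: "real \<Rightarrow> real \<Rightarrow> real" where
  "K y x = exp (- pi * y * exp (- x)) * kern (sqrt y * exp (x / 2))"

text \<open>For even characters this is twice the Bessel function \<open>K_0\<close> at
  \<open>2 * pi * y\<close>; for odd ones it reduces to an exponential, see
  \<open>kappa_odd\<close>.\<close>

definition kappa :: "real \<Rightarrow> real" where "kappa y = (\<integral>x. K y x \<partial>lborel)"

lemma K_measurable [measurable]: "K y \<in> borel_measurable borel"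
  unfolding K_def kern_def by measurable

lemma K_nonneg: "y > 0 \<Longrightarrow> K y x \<ge> 0"
  by (simp add: K_def kern_def)

text \<open>The true decay in y is exponential; the crude \<open>1 / y\<^sup>2\<close> is enough to
  sum absolutely over all products \<open>n * m\<close>.\<close>

lemma K_bound:
  assumes y: "y > 0"
  shows "K y x \<le> 4 / y\<^sup>2 * exp (- 2 * \<bar>x\<bar>)"
proof -
  have "kern (sqrt y * exp (x / 2)) \<le> 2 * exp (- pi * (1 / 2) * (sqrt y * exp (x / 2))\<^sup>2)"
    using abs_kern_le[of "sqrt y * exp (x / 2)"] by linarith
  also have "(sqrt y * exp (x / 2))\<^sup>2 = y * exp x"
    using y by (simp add: power_mult_distrib flip: exp_of_nat_mult)
  finally have "K y x \<le> exp (- pi * y * exp (- x)) * (2 * exp (- pi * (1 / 2) * (y * exp x)))"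
    unfolding K_def by (intro mult_left_mono) auto
  also have "\<dots> = 2 * exp (- (pi / 2) * y * (2 * exp (- x) + exp x))"
    by (simp add: algebra_simps flip: exp_add)
  also have "\<dots> \<le> 2 * exp (- (y * exp \<bar>x\<bar>))"
  proof -
    have "exp \<bar>x\<bar> \<le> 2 * exp (- x) + exp x" by (cases "x \<ge> 0") (auto simp: add_increasing)
    hence "1 * (y * exp \<bar>x\<bar>) \<le> (pi / 2) * (y * (2 * exp (- x) + exp x))"
      using pi_gt3 y by (intro mult_mono) auto
    thus ?thesis by (simp add: mult_ac)
  qed
  also have "\<dots> \<le> 2 * (2 / (y * exp \<bar>x\<bar>)\<^sup>2)"
  proof -
    define z where "z = y * exp \<bar>x\<bar>"
    have z: "z > 0" using y by (simp add: z_def)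
    have "z\<^sup>2 / 2 \<le> exp z" using exp_lower_Taylor_quadratic[of z] z by linarith
    hence "exp (- z) \<le> 2 / z\<^sup>2" using z by (simp add: exp_minus field_simps)
    thus ?thesis by (simp add: z_def)
  qed
  also have "\<dots> = 4 / y\<^sup>2 * exp (- 2 * \<bar>x\<bar>)"
  proof -
    have "(exp \<bar>x\<bar>)\<^sup>2 = exp (2 * \<bar>x\<bar>)" by (simp flip: exp_of_nat_mult)
    thus ?thesis by (simp add: power_mult_distrib exp_minus divide_inverse)
  qed
  finally show ?thesis .
qed

lemma K_integrable:
  assumes "y > 0"
  shows "integrable lborel (K y)"
proof (rule Bochner_Integration.integrable_bound)
  show "integrable lborel (\<lambda>x::real. 4 / y\<^sup>2 * exp (- 2 * \<bar>x\<bar>))"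
    by (intro integrable_mult_right integrable_exp_neg_abs) simp
  have "norm (K y x) \<le> norm (4 / y\<^sup>2 * exp (- 2 * \<bar>x\<bar>))" for x
    using K_nonneg[OF assms, of x] K_bound[OF assms, of x] by (simp only: real_norm_def abs_of_nonneg)
  thus "AE x in lborel. norm (K y x) \<le> norm (4 / y\<^sup>2 * exp (- 2 * \<bar>x\<bar>))" by (intro AE_I2)
qed measurable

lemma kappa_bound: "\<exists>C\<ge>0. \<forall>y>0. 0 \<le> kappa y \<and> kappa y \<le> C / y\<^sup>2"
proof -
  let ?I = "(\<integral>x. exp (- 2 * \<bar>x\<bar>) \<partial>lborel) :: real"
  have "0 \<le> kappa y \<and> kappa y \<le> (4 * ?I) / y\<^sup>2" if y: "y > 0" for y
  proof
    show "0 \<le> kappa y" unfolding kappa_def by (intro Bochner_Integration.integral_nonneg K_nonneg y)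
    have "kappa y \<le> (\<integral>x. 4 / y\<^sup>2 * exp (- 2 * \<bar>x\<bar>) \<partial>lborel)"
      unfolding kappa_def
      by (intro integral_mono K_integrable K_bound integrable_mult_right integrable_exp_neg_abs y) simp
    thus "kappa y \<le> (4 * ?I) / y\<^sup>2" by simp
  qed
  thus ?thesis by (intro exI[of _ "4 * ?I"]) auto
qed

lemma S_has_sum:
  "((\<lambda>(n, m). X m * kappa (real (n * m) * (exp u / sqrt q))) has_sum S u) ({0<..} \<times> {0<..})"
proof -
  define Y where "Y = exp u / sqrt q"
  have Y: "Y > 0" using q_pos by (simp add: Y_def)
  define a where "a = (\<lambda>x n. exp (- pi * exp (u - x) * real (Suc n) ^ 2))"
  define b where "b = (\<lambda>x m. X (Suc m) * kern (real (Suc m) * sqrt (exp (u + x) / q)))"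
  define f where "f = (\<lambda>(n, m) x. a x n * b x m)"
  have sa: "summable (\<lambda>n. \<bar>a x n\<bar>)" for x unfolding a_def by (simp only: abs_exp_cancel, rule summable_psi) simp
  have sb: "summable (\<lambda>n. \<bar>b x n\<bar>)" for x unfolding b_def by (rule summable_vtheta_abs) simp
  have fsum: "((\<lambda>z. f z x) has_sum (psi_exp (u - x) * h (u + x))) UNIV" for x
    using has_sum_product_nat(1)[OF sa sb, of x x]
    by (simp add: f_def case_prod_unfold psi_exp_def h_def psi_def vtheta_def a_def b_def)
  have fabs: "(\<lambda>z. norm (f z x)) summable_on UNIV" for x
    using has_sum_product_nat(2)[OF sa sb, of x x] by (simp add: f_def case_prod_unfold)
  \<comment> \<open>Translating x by \<open>ln (n * sqrt q / m)\<close> balances the two exponents,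
    after which the term depends on n and m only through \<open>n * m\<close> and the character
    value.\<close>
  have shift: "f (n, m) (ln (real (Suc n) * sqrt q / real (Suc m)) + 1 * t) = X (Suc m) * K (real (Suc n * Suc m) * Y) t" for n m t
  proof -
    define N M where "N = real (Suc n)" and "M = real (Suc m)"
    have NM: "N > 0" "M > 0" by (simp_all add: N_def M_def)
    have sq: "sqrt q > 0" "sqrt q * sqrt q = q" using q_pos by simp_all
    define c where "c = N * sqrt q / M"
    have c: "c > 0" using NM sq by (simp add: c_def)
    have c1: "N\<^sup>2 / c = N * M / sqrt q" using NM by (simp add: c_def power2_eq_square)
    have "sqrt q / q = 1 / sqrt q" using sq by (simp add: field_simps)
    hence "M * N * (sqrt q / q) = M * N * (1 / sqrt q)" by (simp only:)
    hence c2: "M\<^sup>2 * c / q = N * M / sqrt q" using NM by (simp add: c_def power2_eq_square mult_ac)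
    have e1: "exp (u - (ln c + t)) * N\<^sup>2 = N * M * Y * exp (- t)"
    proof -
      have "exp (u - (ln c + t)) = exp u / c * exp (- t)" using c by (simp add: exp_diff exp_add exp_minus divide_inverse)
      hence "exp (u - (ln c + t)) * N\<^sup>2 = exp u * (N\<^sup>2 / c) * exp (- t)" by simp
      thus ?thesis unfolding c1 by (simp add: Y_def)
    qed
    have e2: "M * sqrt (exp (u + (ln c + t)) / q) = sqrt (N * M * Y) * exp (t / 2)"
    proof (rule power2_eq_imp_eq)
      have "(M * sqrt (exp (u + (ln c + t)) / q))\<^sup>2 = M\<^sup>2 * (exp u * (c * exp t) / q)"
        using c by (simp add: power_mult_distrib exp_add)
      also have "\<dots> = exp u * (M\<^sup>2 * c / q) * exp t" by simp
      also have "\<dots> = N * M * Y * exp t" unfolding c2 by (simp add: Y_def)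
      also have "\<dots> = (sqrt (N * M * Y) * exp (t / 2))\<^sup>2"
        using NM Y by (simp add: power_mult_distrib flip: exp_of_nat_mult)
      finally show "(M * sqrt (exp (u + (ln c + t)) / q))\<^sup>2 = (sqrt (N * M * Y) * exp (t / 2))\<^sup>2" .
    qed (use NM Y in auto)
    have "f (n, m) (ln c + t) = exp (- pi * (exp (u - (ln c + t)) * N\<^sup>2)) * (X (Suc m) * kern (M * sqrt (exp (u + (ln c + t)) / q)))"
      by (simp add: f_def a_def b_def N_def M_def mult.assoc del: of_nat_Suc)
    also have "\<dots> = X (Suc m) * K (N * M * Y) t" unfolding e1 e2 K_def by (simp add: mult_ac)
    finally show ?thesis unfolding c_def N_def M_def by (simp only: of_nat_mult mult_1_left)
  qed
  have pos: "real (Suc n * Suc m) * Y > 0" for n m using Y by (simp del: of_nat_Suc mult_Suc)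
  have hb: "has_bochner_integral lborel (f (n, m)) (X (Suc m) * kappa (real (Suc n * Suc m) * Y))" for n m
  proof -
    have "has_bochner_integral lborel (\<lambda>t. X (Suc m) * K (real (Suc n * Suc m) * Y) t) (X (Suc m) * kappa (real (Suc n * Suc m) * Y))"
      using K_integrable[OF pos] by (intro has_bochner_integral_mult_right) (simp add: has_bochner_integral_iff kappa_def)
    thus ?thesis
      using lborel_has_bochner_integral_real_affine_iff[of 1 "f (n, m)" "X (Suc m) * kappa (real (Suc n * Suc m) * Y)"
         "ln (real (Suc n) * sqrt q / real (Suc m))"] unfolding shift by simp
  qed
  have hb': "(\<integral>x. \<bar>f (n, m) x\<bar> \<partial>lborel) = \<bar>X (Suc m)\<bar> * kappa (real (Suc n * Suc m) * Y)" for n m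
  proof -
    have "(\<integral>x. \<bar>f (n, m) x\<bar> \<partial>lborel) = (\<integral>t. \<bar>f (n, m) (ln (real (Suc n) * sqrt q / real (Suc m)) + 1 * t)\<bar> \<partial>lborel)"
      using lborel_integral_real_affine[of 1 "\<lambda>x. \<bar>f (n, m) x\<bar>" "ln (real (Suc n) * sqrt q / real (Suc m))"] by simp
    also have "\<dots> = (\<integral>t. \<bar>X (Suc m)\<bar> * K (real (Suc n * Suc m) * Y) t \<partial>lborel)"
      unfolding shift using K_nonneg[OF pos] by (simp add: abs_mult)
    finally show ?thesis by (simp add: kappa_def)
  qed
  obtain C where C: "C \<ge> 0" "\<And>y. y > 0 \<Longrightarrow> 0 \<le> kappa y" "\<And>y. y > 0 \<Longrightarrow> kappa y \<le> C / y\<^sup>2"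
    using kappa_bound by blast
  have "(\<lambda>z. \<integral>x. \<bar>f z x\<bar> \<partial>lborel) summable_on UNIV"
  proof (rule summable_on_comparison_test)
    have s2: "summable (\<lambda>n. \<bar>1 / real (Suc n) ^ 2\<bar>)"
      using inverse_squares_sums by (simp add: sums_iff add.commute)
    have "(\<lambda>(i, j). 1 / real (Suc i) ^ 2 * (1 / real (Suc j) ^ 2)) summable_on UNIV"
      by (rule abs_summable_summable[OF has_sum_product_nat(2)[OF s2 s2]])
    thus "(\<lambda>z. C / Y\<^sup>2 * (\<lambda>(i, j). 1 / real (Suc i) ^ 2 * (1 / real (Suc j) ^ 2)) z) summable_on UNIV"
      by (rule summable_on_cmult_right)
    fix z :: "nat \<times> nat"
    obtain n m where z: "z = (n, m)" by force
    have "(\<integral>x. \<bar>f z x\<bar> \<partial>lborel) \<le> 1 * (C / (real (Suc n * Suc m) * Y)\<^sup>2)"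
      unfolding z hb' by (intro mult_mono abs_X_le C pos) auto
    also have "\<dots> = C / Y\<^sup>2 * (1 / real (Suc n) ^ 2 * (1 / real (Suc m) ^ 2))"
      by (simp only: of_nat_mult power_mult_distrib) simp
    finally show "(\<integral>x. \<bar>f z x\<bar> \<partial>lborel) \<le> C / Y\<^sup>2 * (\<lambda>(i, j). 1 / real (Suc i) ^ 2 * (1 / real (Suc j) ^ 2)) z"
      by (simp only: z prod.case)
  qed auto
  moreover have "integrable lborel (f z)" for z using hb by (cases z) (auto simp: has_bochner_integral_iff)
  ultimately have "((\<lambda>z. \<integral>x. f z x \<partial>lborel) has_sum (\<integral>x. (\<Sum>\<^sub>\<infinity>z. f z x) \<partial>lborel)) UNIV"
    by (intro integral_has_sum_pairs fabs)
  also have "(\<integral>x. (\<Sum>\<^sub>\<infinity>z. f z x) \<partial>lborel) = S u" unfolding S_def using infsumI[OF fsum] by simp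
  finally have "((\<lambda>(n, m). X (Suc m) * kappa (real (Suc n * Suc m) * Y)) has_sum S u) UNIV"
  proof (rule has_sum_cong[THEN iffD1, rotated])
    fix z :: "nat \<times> nat"
    show "(\<integral>x. f z x \<partial>lborel) = (case z of (n, m) \<Rightarrow> X (Suc m) * kappa (real (Suc n * Suc m) * Y))"
      by (cases z) (simp only: prod.case has_bochner_integral_integral_eq[OF hb])
  qed
  moreover have "bij_betw (map_prod Suc Suc) UNIV ({0<..} \<times> {0<..})"
    by (rule bij_betw_byWitness[where f' = "map_prod (\<lambda>n. n - 1) (\<lambda>n. n - 1)"]) auto
  ultimately show ?thesis
    unfolding Y_def [symmetric]
    by (subst has_sum_reindex_bij_betw [symmetric, of "map_prod Suc Suc" UNIV])
       (simp_all add: case_prod_unfold del: of_nat_mult of_nat_Suc mult_Suc)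
qed

lemma S_has_sum_rho:
  "((\<lambda>(a, l). rho a * kappa (real (a * l\<^sup>2) * (exp u / sqrt q))) has_sum S u) ({0<..} \<times> {0<..})"
  using has_sum_regroup[OF S_has_sum] .

end

section \<open>An inequality for the theta series\<close>

text \<open>This is \<open>1 / x\<close> times the integral of \<open>psi\<close> from x to
  infinity; it arises from integrating \<open>S u * exp u\<close> over \<open>u > 0\<close>.\<close>

definition psi_tail :: "real \<Rightarrow> real" where
  "psi_tail x = (\<Sum>n. exp (- pi * x * real (Suc n) ^ 2) / (pi * x * real (Suc n) ^ 2))"

lemma summable_psi_tail:
  assumes x: "x > 0"
  shows "summable (\<lambda>n. exp (- pi * x * real (Suc n) ^ 2) / (pi * x * real (Suc n) ^ 2))"
proof (rule summable_comparison_test')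
  show "summable (\<lambda>n. exp (- pi * x * real (Suc n) ^ 2) * (1 / (pi * x)))"
    by (intro summable_mult2 summable_psi x)
  fix n
  have "pi * x * 1 \<le> pi * x * real (Suc n) ^ 2"
    using x by (intro mult_left_mono one_le_power) auto
  hence "exp (- pi * x * real (Suc n) ^ 2) / (pi * x * real (Suc n) ^ 2) \<le> exp (- pi * x * real (Suc n) ^ 2) / (pi * x)"
    using x by (intro divide_left_mono mult_pos_pos) auto
  thus "norm (exp (- pi * x * real (Suc n) ^ 2) / (pi * x * real (Suc n) ^ 2)) \<le>
      exp (- pi * x * real (Suc n) ^ 2) * (1 / (pi * x))" using x by simp
qed

lemma ennreal_psi: "x > 0 \<Longrightarrow> ennreal (psi x) = (\<Sum>n. ennreal (exp (- pi * x * real (Suc n) ^ 2)))"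
  unfolding psi_def by (rule suminf_ennreal2 [symmetric]) (simp, rule summable_psi)

lemma nn_integral_psi_tail:
  assumes x: "x > 0"
  shows "(\<integral>\<^sup>+u. ennreal (psi (x * exp u) * exp u) * indicator {0..} u \<partial>lborel) = ennreal (psi_tail x)"
proof -
  define c where "c = (\<lambda>n. pi * x * real (Suc n) ^ 2)"
  have c: "c n > 0" for n using x by (simp add: c_def del: of_nat_Suc)
  have "ennreal (psi (x * exp u) * exp u) * indicator {0..} u =
      (\<Sum>n. ennreal (exp (- c n * exp u) * exp u) * indicator {0..} u)" for u
  proof -
    have "ennreal (psi (x * exp u) * exp u) = (\<Sum>n. ennreal (exp (- pi * (x * exp u) * real (Suc n) ^ 2))) * ennreal (exp u)"
      using x psi_nonneg by (simp add: ennreal_mult ennreal_psi)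
    also have "\<dots> = (\<Sum>n. ennreal (exp (- pi * (x * exp u) * real (Suc n) ^ 2)) * ennreal (exp u))" by simp
    also have "\<dots> = (\<Sum>n. ennreal (exp (- c n * exp u) * exp u))"
      by (intro suminf_cong) (simp add: c_def mult_ac flip: ennreal_mult)
    finally show ?thesis by simp
  qed
  hence "(\<integral>\<^sup>+u. ennreal (psi (x * exp u) * exp u) * indicator {0..} u \<partial>lborel) =
      (\<Sum>n. \<integral>\<^sup>+u. ennreal (exp (- c n * exp u) * exp u) * indicator {0..} u \<partial>lborel)"
    by (simp only:) (rule nn_integral_suminf, measurable)
  also have "\<dots> = (\<Sum>n. ennreal (exp (- c n) / c n))"
  proof (intro suminf_cong)
    fix n
    have "(\<integral>\<^sup>+u. ennreal (exp (- c n * exp u) * exp u) * indicator {0..} u \<partial>lborel) =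
       0 - (- (exp (- c n * exp 0) / c n))"
    proof (rule nn_integral_FTC_atLeast)
      show "((\<lambda>u. - (exp (- c n * exp u) / c n)) \<longlongrightarrow> 0) at_top"
        using c[of n] by real_asymp
      show "((\<lambda>u. - (exp (- c n * exp u) / c n)) has_real_derivative exp (- c n * exp u) * exp u) (at u)" for u
        using c[of n] by (auto intro!: derivative_eq_intros)
    qed auto
    thus "(\<integral>\<^sup>+u. ennreal (exp (- c n * exp u) * exp u) * indicator {0..} u \<partial>lborel) = ennreal (exp (- c n) / c n)"
      by simp
  qed
  also have "\<dots> = ennreal (psi_tail x)"
  proof -
    have "summable (\<lambda>n. exp (- c n) / c n)" using summable_psi_tail[OF x] by (simp add: c_def)
    moreover have "0 \<le> exp (- c n) / c n" for n using c[of n] by simp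
    ultimately have "(\<Sum>n. ennreal (exp (- c n) / c n)) = ennreal (\<Sum>n. exp (- c n) / c n)"
      by (intro suminf_ennreal2)
    thus ?thesis by (simp add: psi_tail_def c_def)
  qed
  finally show ?thesis .
qed

text \<open>The functional equation expresses \<open>psi x\<close> as this lower bound plus a
  nonnegative multiple of \<open>psi (1 / x)\<close>.\<close>

lemma psi_ge:
  assumes x: "x > 0"
  shows "psi x \<ge> 1 / (2 * sqrt x) - 1 / 2"
proof -
  have "psi x = sqrt (1 / x) * psi (1 / x) + sqrt (1 / x) / 2 - 1 / 2"
    using psi_functional_equation[of "1 / x"] x by simp
  moreover have "sqrt (1 / x) * psi (1 / x) \<ge> 0" using psi_nonneg[of "1 / x"] x by simp
  moreover have "sqrt (1 / x) / 2 = 1 / (2 * sqrt x)" by (simp add: real_sqrt_divide)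
  ultimately show ?thesis by linarith
qed

text \<open>The bound is \<open>\<zeta>(2)/(\<pi> x)\<close> minus the contribution of \<open>0 < t < x\<close> to \<open>\<integral> \<psi>(t) dt\<close>,
  where \<open>\<psi>(t) \<ge> t\<^sup>-\<^sup>1\<^sup>/\<^sup>2/2 - 1/2\<close>.\<close>

lemma psi_tail_le:
  assumes x: "0 < x" "x \<le> 1"
  shows "x * psi_tail x \<le> pi / 6 - sqrt x + x / 2"
proof -
  define c where "c = (\<lambda>n. pi * real (Suc n) ^ 2)"
  have c: "c n > 0" for n by (simp add: c_def del: of_nat_Suc)
  have sq: "(\<lambda>n. 1 / c n) sums (pi / 6)"
  proof -
    have "(\<lambda>n. 1 / (real n + 1)\<^sup>2) sums (pi\<^sup>2 / 6)" using inverse_squares_sums by (simp add: add.commute)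
    hence "(\<lambda>n. 1 / pi * (1 / (real n + 1)\<^sup>2)) sums (1 / pi * (pi\<^sup>2 / 6))" by (rule sums_mult)
    thus ?thesis by (simp add: c_def add.commute power2_eq_square)
  qed
  have tail: "(\<lambda>n. exp (- c n * x) / c n) sums (x * psi_tail x)"
  proof -
    have "(\<lambda>n. x * (exp (- pi * x * real (Suc n) ^ 2) / (pi * x * real (Suc n) ^ 2))) sums (x * psi_tail x)"
      unfolding psi_tail_def by (intro sums_mult summable_sums summable_psi_tail x)
    moreover have "x * (exp (- pi * x * real (Suc n) ^ 2) / (pi * x * real (Suc n) ^ 2)) = exp (- c n * x) / c n" for n
      using x by (simp add: c_def mult_ac del: of_nat_Suc)
    ultimately show ?thesis by (simp only:)
  qed
  define T where "T = pi / 6 - x * psi_tail x"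
  have T: "(\<lambda>n. 1 / c n - exp (- c n * x) / c n) sums T"
    unfolding T_def by (rule sums_diff[OF sq tail])
  have Tn: "0 \<le> 1 / c n - exp (- c n * x) / c n" for n
    using c[of n] x by (simp add: divide_right_mono flip: diff_divide_distrib)
  have T0: "T \<ge> 0" by (rule sums_le[OF _ sums_zero T]) (rule Tn)
  \<comment> \<open>The lower bound for \<open>psi\<close> is singular at 0, so it is integrated
    from \<open>e\<^sup>2\<close>, where the loss is at most e.\<close>
  have main: "sqrt x - x / 2 \<le> T + e" if e: "e > 0" for e
  proof (cases "e\<^sup>2 < x")
    case False
    hence "sqrt x \<le> e" using e by (simp add: real_le_lsqrt real_sqrt_le_iff not_less)
    thus ?thesis using x T0 by linarith
  next
    case True
    have e2: "e\<^sup>2 > 0" using e by simp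
    have "(\<integral>\<^sup>+t. ennreal (1 / (2 * sqrt t) - 1 / 2) * indicator {e\<^sup>2..x} t \<partial>lborel) =
        sqrt x - x / 2 - (sqrt (e\<^sup>2) - e\<^sup>2 / 2)"
    proof (rule nn_integral_FTC_Icc[where F = "\<lambda>t. sqrt t - t / 2"])
      fix t assume t: "t \<in> {e\<^sup>2..x}"
      hence t0: "t > 0" "t \<le> 1" using less_le_trans[OF e2, of t] x by auto
      show "((\<lambda>t. sqrt t - t / 2) has_real_derivative (1 / (2 * sqrt t) - 1 / 2)) (at t)"
        by (rule DERIV_cong[OF DERIV_diff[OF DERIV_real_sqrt[OF t0(1)] DERIV_cdivide[OF DERIV_ident]]])
           (simp_all add: inverse_eq_divide)
      have "2 * sqrt t \<le> 2 * 1" using t0 by (intro mult_left_mono) auto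
      hence "1 / 2 \<le> 1 / (2 * sqrt t)" using t0 by (intro divide_left_mono) auto
      thus "0 \<le> 1 / (2 * sqrt t) - 1 / 2" by simp
    qed (use True in auto)
    hence "ennreal (sqrt x - x / 2 - (sqrt (e\<^sup>2) - e\<^sup>2 / 2)) =
        (\<integral>\<^sup>+t. ennreal (1 / (2 * sqrt t) - 1 / 2) * indicator {e\<^sup>2..x} t \<partial>lborel)" by (rule sym)
    also have "\<dots> \<le> (\<integral>\<^sup>+t. (\<Sum>n. ennreal (exp (- c n * t)) * indicator {0..x} t) \<partial>lborel)"
    proof (rule nn_integral_mono)
      fix t :: real
      show "ennreal (1 / (2 * sqrt t) - 1 / 2) * indicator {e\<^sup>2..x} t \<le> (\<Sum>n. ennreal (exp (- c n * t)) * indicator {0..x} t)"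
      proof (cases "t \<in> {e\<^sup>2..x}")
        case True
        hence t0: "t > 0" "t \<le> x" using less_le_trans[OF e2, of t] by auto
        have "ennreal (1 / (2 * sqrt t) - 1 / 2) \<le> ennreal (psi t)" by (intro ennreal_leI psi_ge t0)
        also have "\<dots> = (\<Sum>n. ennreal (exp (- c n * t)))"
          unfolding ennreal_psi[OF t0(1)] by (simp add: c_def mult_ac)
        finally show ?thesis using True t0 by simp
      qed simp
    qed
    also have "\<dots> = (\<Sum>n. \<integral>\<^sup>+t. ennreal (exp (- c n * t)) * indicator {0..x} t \<partial>lborel)"
      by (rule nn_integral_suminf) measurable
    also have "\<dots> = (\<Sum>n. ennreal (1 / c n - exp (- c n * x) / c n))"
    proof (intro suminf_cong)
      fix n
      have "(\<integral>\<^sup>+t. ennreal (exp (- c n * t)) * indicator {0..x} t \<partial>lborel) =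
         - exp (- c n * x) / c n - (- exp (- c n * 0) / c n)"
      proof (rule nn_integral_FTC_Icc[where F = "\<lambda>t. - exp (- c n * t) / c n"])
        show "((\<lambda>t. - exp (- c n * t) / c n) has_real_derivative exp (- c n * t)) (at t)" for t
          using c[of n] by (auto intro!: derivative_eq_intros)
      qed (use x in auto)
      thus "(\<integral>\<^sup>+t. ennreal (exp (- c n * t)) * indicator {0..x} t \<partial>lborel) = ennreal (1 / c n - exp (- c n * x) / c n)"
        by simp
    qed
    also have "\<dots> = ennreal T"
      using suminf_ennreal_eq[OF Tn T] .
    finally have "sqrt x - x / 2 - (sqrt (e\<^sup>2) - e\<^sup>2 / 2) \<le> T"
      using T0 by (simp add: ennreal_le_iff)
    moreover have "sqrt (e\<^sup>2) = e" using e by simp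
    ultimately show ?thesis using e2 by linarith
  qed
  have "sqrt x - x / 2 \<le> T" by (rule field_le_epsilon) (rule main)
  thus ?thesis by (simp add: T_def)
qed

lemma exp_07_ge: "exp (7 / 10 :: real) \<ge> 2"
proof -
  have "1 + 7 / 40 + (7 / 40)\<^sup>2 / 2 \<le> exp (7 / 40 :: real)"
    by (rule exp_lower_Taylor_quadratic) simp
  hence "(1 + 7 / 40 + (7 / 40)\<^sup>2 / 2) ^ 4 \<le> exp (7 / 40 :: real) ^ 4" by (intro power_mono) auto
  also have "\<dots> = exp (7 / 10)" by (simp flip: exp_of_nat_mult)
  finally show ?thesis by (simp add: eval_nat_numeral)
qed

lemma psi_small:
  assumes y: "y \<ge> pi"
  shows "sqrt (2 * y) * psi (y / 2) \<le> 1 / 50"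
proof -
  have y3: "y \<ge> 314 / 100" using y pi_approx by simp
  define t where "t = pi * (y / 2)"
  have "(157 / 100) * y \<le> pi / 2 * y" using y3 pi_approx by (intro mult_right_mono) auto
  hence t: "t \<ge> (157 / 100) * y" by (simp add: t_def)
  \<comment> \<open>At \<open>y = pi\<close> one has \<open>t = pi\<^sup>2 / 2\<close>, just above
    49/10. Splitting off \<open>exp (49 / 10) \<ge> 128\<close> and using the tangent line for the
    rest loses little.\<close>
  have e: "exp t \<ge> 128 * ((157 / 100) * y - 39 / 10)"
  proof -
    have "2 ^ 7 \<le> exp (7 / 10 :: real) ^ 7" by (intro power_mono exp_07_ge) simp
    hence "128 \<le> exp (49 / 10 :: real)" by (simp flip: exp_of_nat_mult)
    moreover have "(157 / 100) * y - 39 / 10 \<le> exp (t - 49 / 10)"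
      using exp_ge_add_one_self[of "t - 49 / 10"] t by linarith
    moreover have "(157 / 100) * y - 39 / 10 \<ge> 0" using y3 by simp
    ultimately have "128 * ((157 / 100) * y - 39 / 10) \<le> exp (49 / 10) * exp (t - 49 / 10)"
      by (intro mult_mono) auto
    thus ?thesis by (simp flip: exp_add)
  qed
  have e1: "exp t - 1 \<ge> 127 * ((157 / 100) * y - 39 / 10)" using e y3 by simp
  have "127 * ((157 / 100) * y - 39 / 10) > 0" using y3 by simp
  hence pos: "exp t - 1 > 0" using e1 by linarith
  have "psi (y / 2) \<le> exp (- t) / (1 - exp (- t))"
    using psi_le_geometric[of "y / 2"] y3 by (simp add: t_def)
  also have "\<dots> = 1 / (exp t - 1)" using pos by (simp add: exp_minus field_simps)
  finally have p: "psi (y / 2) \<le> 1 / (exp t - 1)" .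
  \<comment> \<open>The linear bound for the root is nearly tangent at the critical point: 5/2 is
    close to \<open>sqrt (2 * pi)\<close>.\<close>
  have "0 \<le> (sqrt (2 * y) - 5 / 2)\<^sup>2" by simp
  also have "\<dots> = (sqrt (2 * y))\<^sup>2 - 5 * sqrt (2 * y) + 25 / 4"
    by (simp only: power2_diff) (simp add: power2_eq_square)
  also have "(sqrt (2 * y))\<^sup>2 = 2 * y" using y3 by simp
  finally have "sqrt (2 * y) \<le> (2 / 5) * y + 5 / 4" by simp
  also have "\<dots> \<le> 1 / 50 * (127 * ((157 / 100) * y - 39 / 10))" using y3 by simp
  also have "\<dots> \<le> 1 / 50 * (exp t - 1)" using e1 by simp
  finally have s: "sqrt (2 * y) \<le> 1 / 50 * (exp t - 1)" .
  have "sqrt (2 * y) * psi (y / 2) \<le> (1 / 50 * (exp t - 1)) * (1 / (exp t - 1))"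
    using s p pos y3 psi_nonneg[of "y / 2"] by (intro mult_mono) auto
  also have "\<dots> = 1 / 50" using pos by (simp add: field_simps)
  finally show ?thesis .
qed

text \<open>Applying the functional equation to both values, the multiples of
  \<open>sqrt (2 / x)\<close> without a \<open>psi\<close> factor cancel and the constants combine
  to 1/2.\<close>

lemma psi_difference:
  assumes x: "x > 0"
  shows "psi (x / 2) - 2 * psi (2 * x) = 1 / 2 - sqrt (2 / x) * (psi (1 / x / 2) - psi (2 / x))"
proof -
  define a where "a = sqrt (2 / x)"
  have s1: "sqrt (1 / (2 * x)) = a / 2"
  proof (rule real_sqrt_unique)
    show "(a / 2)\<^sup>2 = 1 / (2 * x)" using x by (simp add: a_def power_divide)
  qed (use x in \<open>simp add: a_def\<close>)
  have 1: "psi (x / 2) = a * psi (2 / x) + a / 2 - 1 / 2"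
    using psi_functional_equation[of "2 / x"] x by (simp add: a_def)
  have 2: "psi (2 * x) = a / 2 * psi (1 / (2 * x)) + a / 4 - 1 / 2"
    using psi_functional_equation[of "1 / (2 * x)"] x by (simp add: s1)
  have "1 / x / 2 = 1 / (2 * x)" by simp
  thus ?thesis unfolding 1 2 a_def [symmetric] by (simp add: algebra_simps)
qed

text \<open>The bound 101/200 on c is 2.02 times the maximum 1/4 of
  \<open>\<beta> (1 - \<beta>)\<close>. For \<open>pi * x \<ge> 1\<close> the inequality holds term
  by term. For smaller x the right side exceeds \<open>2 * psi (2 * x)\<close> by at least 1/2 -
  1/50 = 12/25, which \<open>cY\<close> compares with \<open>c * psi_tail x\<close>.\<close>

lemma psi_inequality:
  assumes x: "x > 0" and c: "0 \<le> c" "c \<le> 101 / 200" and Y: "1 / x \<le> Y"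
    and cY: "c * (pi / 6 * Y - sqrt Y + 1 / 2) \<le> 12 / 25"
  shows "c * psi_tail x + 2 * psi (2 * x) \<le> psi (x / 2)"
proof (cases "pi * x \<ge> 1")
  case True
  have termwise: "c * (exp (- z) / z) + 2 * exp (- (2 * z)) \<le> exp (- (z / 2))" if z: "z \<ge> 1" for z :: real
  proof -
    \<comment> \<open>All three exponentials are powers of w, and \<open>w \<le> 8 / 13\<close>
      comes from the quadratic Taylor bound for \<open>exp (1 / 2)\<close>.\<close>
    define w where "w = exp (- (z / 2))"
    have w: "w > 0" "w \<le> 8 / 13"
    proof -
      have "exp (1 / 2 :: real) \<ge> 1 + 1 / 2 + (1 / 2)\<^sup>2 / 2"
        using exp_lower_Taylor_quadratic[of "1 / 2 :: real"] by simp
      moreover have "exp (z / 2) \<ge> exp (1 / 2)" using z by simp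
      ultimately have "exp (z / 2) \<ge> 1 + 1 / 2 + (1 / 2)\<^sup>2 / 2" by (rule order_trans)
      hence "exp (z / 2) \<ge> 13 / 8" by (simp add: power2_eq_square)
      thus "w \<le> 8 / 13" by (simp add: w_def exp_minus field_simps)
    qed (simp add: w_def)
    have w2: "exp (- z) = w\<^sup>2" and w4: "exp (- (2 * z)) = w ^ 4"
      by (simp_all add: w_def flip: exp_of_nat_mult)
    have "c * (w\<^sup>2 / z) \<le> (101 / 200) * (w\<^sup>2 / 1)"
      using c z by (intro mult_mono divide_left_mono) auto
    also have "\<dots> \<le> (101 / 200) * (w * (8 / 13))"
      using w by (simp add: power2_eq_square)
    finally have 1: "c * (w\<^sup>2 / z) \<le> (101 / 200) * (8 / 13) * w" by simp
    have "w ^ 3 \<le> (8 / 13) ^ 3" using w by (intro power_mono) auto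
    hence "w * w ^ 3 \<le> w * (8 / 13) ^ 3" using w by (intro mult_left_mono) auto
    hence 2: "w ^ 4 \<le> (8 / 13) ^ 3 * w" by (simp add: eval_nat_numeral mult_ac)
    have "c * (w\<^sup>2 / z) + 2 * w ^ 4 \<le> ((101 / 200) * (8 / 13) + 2 * (8 / 13) ^ 3) * w"
      unfolding distrib_right using 1 2 by linarith
    also have "\<dots> \<le> 1 * w" using w by (intro mult_right_mono) (auto simp: eval_nat_numeral)
    finally show ?thesis by (simp add: w2 w4 w_def)
  qed
  define z where "z = (\<lambda>n. pi * x * real (Suc n) ^ 2)"
  have z1: "z n \<ge> 1" for n
  proof -
    have "1 * 1 \<le> pi * x * real (Suc n) ^ 2" using True by (intro mult_mono one_le_power) auto
    thus ?thesis by (simp add: z_def)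
  qed
  have s1: "(\<lambda>n. c * (exp (- z n) / z n)) sums (c * psi_tail x)"
    unfolding psi_tail_def z_def using summable_sums[OF summable_psi_tail[OF x]] by (intro sums_mult) simp
  have s2: "(\<lambda>n. 2 * exp (- (2 * z n))) sums (2 * psi (2 * x))"
    unfolding psi_def z_def using summable_sums[OF summable_psi[of "2 * x"]] x by (intro sums_mult) (simp add: mult_ac)
  have s3: "(\<lambda>n. exp (- (z n / 2))) sums psi (x / 2)"
    unfolding psi_def z_def using summable_sums[OF summable_psi[of "x / 2"]] x by (simp add: mult_ac)
  show ?thesis
    by (rule sums_le[OF _ sums_add[OF s1 s2] s3]) (rule termwise[OF z1])
next
  case False
  define y where "y = 1 / x"
  have xy: "x = 1 / y" by (simp add: y_def)
  have ypi: "y > pi" using False x by (simp add: y_def field_simps)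
  have y3: "y \<ge> 314 / 100" using ypi pi_approx by simp
  have x1: "x \<le> 1" using y3 by (simp add: xy)
  have "x * psi_tail x \<le> pi / 6 - sqrt x + x / 2" by (rule psi_tail_le[OF x x1])
  hence "y * (x * psi_tail x) \<le> y * (pi / 6 - sqrt x + x / 2)" using y3 by (intro mult_left_mono) auto
  also have "y * (x * psi_tail x) = psi_tail x" using y3 by (simp add: xy)
  also have "y * (pi / 6 - sqrt x + x / 2) = pi / 6 * y - sqrt y + 1 / 2"
  proof -
    have "y * sqrt x = sqrt y" using y3 by (simp add: xy real_sqrt_divide real_div_sqrt)
    thus ?thesis using y3 by (simp add: algebra_simps xy)
  qed
  also have "\<dots> \<le> pi / 6 * Y - sqrt Y + 1 / 2"
  proof -
    have yY: "y \<le> Y" using Y by (simp add: y_def)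
    hence sq: "sqrt y \<le> sqrt Y" by simp
    have "sqrt y \<ge> 17 / 10" using y3 by (intro real_le_rsqrt) (simp add: power2_eq_square)
    hence "17 / 10 + 17 / 10 \<le> sqrt Y + sqrt y" "0 \<le> sqrt Y + sqrt y" using sq by linarith+
    \<comment> \<open>The expression is increasing in its argument beyond \<open>y > pi\<close>, so
      1/x may be replaced by the uniform bound Y.\<close>
    hence "(17 / 10 + 17 / 10) * (1 / 2) \<le> (sqrt Y + sqrt y) * (pi / 6)"
      using pi_approx by (intro mult_mono) auto
    hence "0 \<le> (sqrt Y - sqrt y) * ((sqrt Y + sqrt y) * (pi / 6) - 1)"
      using sq by (intro mult_nonneg_nonneg) auto
    also have "\<dots> = pi / 6 * ((sqrt Y)\<^sup>2 - (sqrt y)\<^sup>2) - (sqrt Y - sqrt y)"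
      by (simp add: power2_eq_square algebra_simps)
    also have "\<dots> = pi / 6 * (Y - y) - (sqrt Y - sqrt y)" using y3 yY by simp
    also have "\<dots> = pi / 6 * Y - sqrt Y + 1 / 2 - (pi / 6 * y - sqrt y + 1 / 2)" by (simp only: right_diff_distrib)
    finally show ?thesis by linarith
  qed
  finally have "psi_tail x \<le> pi / 6 * Y - sqrt Y + 1 / 2" .
  hence "c * psi_tail x \<le> c * (pi / 6 * Y - sqrt Y + 1 / 2)" using c by (intro mult_left_mono)
  hence 1: "c * psi_tail x \<le> 12 / 25" using cY by linarith
  have "psi (x / 2) - 2 * psi (2 * x) = 1 / 2 - sqrt (2 * y) * (psi (y / 2) - psi (2 * y))"
    using psi_difference[OF x] by (simp add: y_def)
  also have "\<dots> \<ge> 1 / 2 - sqrt (2 * y) * psi (y / 2)"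
    using psi_nonneg[of "2 * y"] y3 by (simp add: algebra_simps)
  finally have "psi (x / 2) - 2 * psi (2 * x) \<ge> 1 / 2 - 1 / 50"
    using psi_small[of y] ypi by linarith
  thus ?thesis using 1 by linarith
qed

section \<open>The zero-free interval\<close>

lemma psi_tail_pos: "x > 0 \<Longrightarrow> psi_tail x > 0"
  unfolding psi_tail_def by (rule suminf_pos[OF summable_psi_tail]) (auto simp del: of_nat_Suc)

lemma psi_tail_measurable [measurable]: "psi_tail \<in> borel_measurable borel"
  unfolding psi_tail_def by measurable

section \<open>The convolution as a positive combination of theta values\<close>

context nontrivial_primitive_quadratic
begin

text \<open>With this measure \<open>kappa y\<close> is the integral of
  \<open>exp (- 2 * pi * y * cosh x)\<close> for both parities, since the unit mass at 0 yields
  \<open>exp (- 2 * pi * y)\<close>.\<close>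

definition M :: "real measure" where
  "M = (if par = 0 then lborel else return lborel 0)"

lemma sets_M [measurable_cong]: "sets M = sets borel"
  by (simp add: M_def)

lemma sigma_finite_M: "sigma_finite_measure M"
proof (cases "par = 0")
  case True
  thus ?thesis by (simp add: M_def lborel.sigma_finite_measure_axioms)
next
  case False
  have "prob_space M" using False by (auto simp: M_def intro: prob_space_return)
  thus ?thesis by (simp add: prob_space_def finite_measure_def)
qed

lemma emeasure_M_nonzero: "emeasure M (space M) \<noteq> 0"
  by (simp add: M_def)

text \<open>Adding the integrand at x and \<open>- x\<close> turns \<open>exp (x / 2)\<close> into
  \<open>2 * cosh (x / 2)\<close>, the derivative needed for
  \<open>v = 2 * sqrt y * sinh (x / 2)\<close>. The identity
  \<open>cosh x = 1 + 2 * (sinh (x / 2))\<^sup>2\<close> then leaves a Gaussian integral.\<close>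

lemma kappa_odd:
  assumes par: "par = 1" and y: "y > 0"
  shows "kappa y = exp (- 2 * pi * y)"
proof -
  define g where "g = (\<lambda>x. 2 * sqrt y * sinh (x / 2))"
  define F where "F = (\<lambda>v::real. exp (- pi * v\<^sup>2))"
  have F: "has_bochner_integral lborel F 1"
  proof -
    have "has_bochner_integral lborel (\<lambda>x. of_real (F x) :: complex) (of_real 1)"
      using gaussian_fourier_lborel[of 1 0] by (simp add: F_def)
    from has_bochner_integral_bounded_linear[OF bounded_linear_Re this] show ?thesis by simp
  qed
  have "F integrable_on UNIV" "integral UNIV F = 1"
    using F integrable_on_lborel[of F] integral_lborel[of F] by (auto simp: has_bochner_integral_iff)
  hence Fa: "F absolutely_integrable_on UNIV"
    by (intro nonnegative_absolutely_integrable_1) (auto simp: F_def)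
  have surj: "range g = UNIV"
  proof (rule surjI)
    fix v show "g (2 * arsinh (v / (2 * sqrt y))) = v" using y by (simp add: g_def)
  qed
  have inj: "inj g" using y by (auto simp: g_def inj_on_def)
  have "(\<lambda>x. \<bar>sqrt y * cosh (x / 2)\<bar> *\<^sub>R F (g x)) absolutely_integrable_on UNIV \<and>
        integral UNIV (\<lambda>x. \<bar>sqrt y * cosh (x / 2)\<bar> *\<^sub>R F (g x)) = 1"
  proof (rule has_absolute_integral_change_of_variables_real[where f = F and g = g, THEN iffD2])
    show "(g has_real_derivative sqrt y * cosh (x / 2)) (at x within UNIV)" for x
      unfolding g_def using y by (auto intro!: derivative_eq_intros)
    show "F absolutely_integrable_on range g \<and> integral (range g) F = 1"
      unfolding surj using Fa \<open>integral UNIV F = 1\<close> by simp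
  qed (use inj in auto)
  hence G: "(\<lambda>x. sqrt y * cosh (x / 2) * F (g x)) absolutely_integrable_on UNIV"
    "integral UNIV (\<lambda>x. sqrt y * cosh (x / 2) * F (g x)) = 1" using y by (simp_all add: abs_mult)
  have eq: "K y x + K y (0 - x) = exp (- 2 * pi * y) * (2 * (sqrt y * cosh (x / 2) * F (g x)))" for x
  proof -
    have k: "K y z = exp (- 2 * pi * y * cosh z) * (sqrt y * exp (z / 2))" for z
    proof -
      have "(sqrt y * exp (z / 2))\<^sup>2 = y * exp z" using y by (simp add: power_mult_distrib flip: exp_of_nat_mult)
      hence "K y z = exp (- pi * y * exp (- z)) * exp (- pi * (y * exp z)) * (sqrt y * exp (z / 2))"
        by (simp add: K_def kern_def par)
      also have "exp (- pi * y * exp (- z)) * exp (- pi * (y * exp z)) = exp (- 2 * pi * y * cosh z)"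
        by (simp add: cosh_def algebra_simps flip: exp_add)
      finally show ?thesis .
    qed
    have "cosh x = 1 + 2 * (sinh (x / 2))\<^sup>2"
      using cosh_double[of "x / 2"] cosh_square_eq[of "x / 2"] by simp
    hence "exp (- 2 * pi * y * cosh x) = exp (- 2 * pi * y) * F (g x)"
      using y by (simp add: F_def g_def power_mult_distrib algebra_simps flip: exp_add)
    moreover have "exp (x / 2) + exp (- x / 2) = 2 * cosh (x / 2)" by (simp add: cosh_def)
    moreover have "K y x + K y (0 - x) = exp (- 2 * pi * y * cosh x) * (sqrt y * (exp (x / 2) + exp (- x / 2)))"
      by (simp add: k algebra_simps)
    ultimately show ?thesis by simp
  qed
  have m: "(\<lambda>x. sqrt y * cosh (x / 2) * F (g x)) \<in> borel_measurable lborel"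
    unfolding F_def g_def sinh_def cosh_def by measurable
  have i: "integrable lborel (\<lambda>x. sqrt y * cosh (x / 2) * F (g x))"
    using G(1) integrable_completion[OF m] by (simp add: set_integrable_def)
  have "2 * kappa y = (\<integral>x. K y x + K y (0 - x) \<partial>lborel)"
    using integral_shifted(2)[of "K y" 0] integrable_shifted(2)[OF K_integrable[OF y], of 0] K_integrable[OF y]
    by (subst Bochner_Integration.integral_add) (auto simp: kappa_def)
  also have "\<dots> = exp (- 2 * pi * y) * (2 * (\<integral>x. sqrt y * cosh (x / 2) * F (g x) \<partial>lborel))"
    unfolding eq by (simp only: integral_mult_right_zero)
  also have "(\<integral>x. sqrt y * cosh (x / 2) * F (g x) \<partial>lborel) = 1"
    using integral_lborel[OF i] G(2) by simp
  finally show ?thesis by simp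
qed

lemma ennreal_kappa:
  assumes y: "y > 0"
  shows "ennreal (kappa y) = (\<integral>\<^sup>+x. ennreal (exp (- 2 * pi * y * cosh x)) \<partial>M)"
proof (cases "par = 0")
  case True
  have "K y x = exp (- 2 * pi * y * cosh x)" for x
  proof -
    have "(sqrt y * exp (x / 2))\<^sup>2 = y * exp x" using y by (simp add: power_mult_distrib flip: exp_of_nat_mult)
    thus ?thesis by (simp add: K_def kern_def True cosh_def algebra_simps flip: exp_add)
  qed
  hence "(\<integral>\<^sup>+x. ennreal (exp (- 2 * pi * y * cosh x)) \<partial>M) = (\<integral>\<^sup>+x. ennreal (K y x) \<partial>lborel)"
    by (simp add: M_def True)
  also have "\<dots> = ennreal (kappa y)"
    unfolding kappa_def by (rule nn_integral_eq_integral[OF K_integrable[OF y]]) (simp add: K_nonneg y)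
  finally show ?thesis ..
next
  case False
  hence "par = 1" using par_cases by simp
  moreover have "(\<integral>\<^sup>+x. ennreal (exp (- 2 * pi * y * cosh x)) \<partial>return lborel 0) = ennreal (exp (- 2 * pi * y * cosh 0))"
    by (rule nn_integral_return) (auto simp: cosh_def)
  ultimately show ?thesis using y by (simp add: M_def kappa_odd)
qed

text \<open>Summing the kernel over the squares \<open>l\<^sup>2\<close> under the integral rebuilds
  the full theta series.\<close>

lemma nn_integral_psi_cosh:
  assumes y: "y > 0"
  shows "(\<lambda>l. kappa (real (Suc l) ^ 2 * y)) sums enn2real (\<integral>\<^sup>+x. ennreal (psi (2 * y * cosh x)) \<partial>M)"
    and "(\<integral>\<^sup>+x. ennreal (psi (2 * y * cosh x)) \<partial>M) < \<infinity>"
proof -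
  let ?I = "(\<integral>\<^sup>+x. ennreal (psi (2 * y * cosh x)) \<partial>M)"
  obtain C where C: "C \<ge> 0" "\<And>y. y > 0 \<Longrightarrow> 0 \<le> kappa y" "\<And>y. y > 0 \<Longrightarrow> kappa y \<le> C / y\<^sup>2"
    using kappa_bound by blast
  have pos: "real (Suc l) ^ 2 * y > 0" for l using y by (simp del: of_nat_Suc)
  have sm: "summable (\<lambda>l. kappa (real (Suc l) ^ 2 * y))"
  proof (rule summable_comparison_test')
    show "summable (\<lambda>l. C / y\<^sup>2 * (1 / real (Suc l) ^ 2))"
      using inverse_squares_sums by (intro summable_mult) (simp add: sums_iff add.commute)
    fix l
    have "kappa (real (Suc l) ^ 2 * y) \<le> C / (real (Suc l) ^ 2 * y)\<^sup>2" by (rule C(3)[OF pos])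
    also have "\<dots> \<le> C / (real (Suc l) * y)\<^sup>2"
    proof (intro divide_left_mono power_mono mult_right_mono)
      have "real (Suc l) * 1 \<le> real (Suc l) * real (Suc l)" by (intro mult_left_mono) auto
      thus "real (Suc l) \<le> real (Suc l) ^ 2" by (simp add: power2_eq_square)
    qed (use y C in \<open>auto simp del: of_nat_Suc\<close>)
    also have "\<dots> = C / y\<^sup>2 * (1 / real (Suc l) ^ 2)" by (simp add: power_mult_distrib)
    finally show "norm (kappa (real (Suc l) ^ 2 * y)) \<le> C / y\<^sup>2 * (1 / real (Suc l) ^ 2)"
      using C(2)[OF pos[of l]] by simp
  qed
  have "?I = (\<integral>\<^sup>+x. (\<Sum>l. ennreal (exp (- 2 * pi * (real (Suc l) ^ 2 * y) * cosh x))) \<partial>M)"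
  proof (rule nn_integral_cong)
    fix x
    have "2 * y * cosh x > 0" using y by simp
    thus "ennreal (psi (2 * y * cosh x)) = (\<Sum>l. ennreal (exp (- 2 * pi * (real (Suc l) ^ 2 * y) * cosh x)))"
      by (simp add: ennreal_psi mult_ac)
  qed
  also have "\<dots> = (\<Sum>l. \<integral>\<^sup>+x. ennreal (exp (- 2 * pi * (real (Suc l) ^ 2 * y) * cosh x)) \<partial>M)"
    unfolding cosh_def by (rule nn_integral_suminf) measurable
  also have "\<dots> = (\<Sum>l. ennreal (kappa (real (Suc l) ^ 2 * y)))"
    by (intro suminf_cong ennreal_kappa [symmetric] pos)
  also have "\<dots> = ennreal (\<Sum>l. kappa (real (Suc l) ^ 2 * y))"
    by (rule suminf_ennreal2[OF C(2)[OF pos] sm])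
  finally have I: "?I = ennreal (\<Sum>l. kappa (real (Suc l) ^ 2 * y))" .
  show "?I < \<infinity>" unfolding I by simp
  have "enn2real ?I = (\<Sum>l. kappa (real (Suc l) ^ 2 * y))"
    unfolding I by (intro enn2real_ennreal suminf_nonneg sm C(2) pos)
  thus "(\<lambda>l. kappa (real (Suc l) ^ 2 * y)) sums enn2real ?I" using sm by (simp add: summable_sums)
qed

lemma S_series:
  shows "ennreal (S u) = (\<Sum>a. ennreal (rho (Suc a)) * (\<integral>\<^sup>+x. ennreal (psi (2 * (real (Suc a) * (exp u / sqrt q)) * cosh x)) \<partial>M))"
    and "S u \<ge> 0"
proof -
  define Y where "Y = exp u / sqrt q"
  have Y: "Y > 0" using q_pos by (simp add: Y_def)
  define I where "I = (\<lambda>a. \<integral>\<^sup>+x. ennreal (psi (2 * (real (Suc a) * Y) * cosh x)) \<partial>M)"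
  have pos: "real (Suc a) * Y > 0" for a using Y by (simp del: of_nat_Suc)
  have kpos: "kappa y \<ge> 0" if "y > 0" for y using kappa_bound that by auto
  have bij: "bij_betw (map_prod Suc Suc) UNIV ({0<..} \<times> {0<..})"
    by (rule bij_betw_byWitness[where f' = "map_prod (\<lambda>n. n - 1) (\<lambda>n. n - 1)"]) auto
  have "((\<lambda>z. (\<lambda>(a, l). rho a * kappa (real (a * l\<^sup>2) * Y)) (map_prod Suc Suc z)) has_sum S u) UNIV"
    unfolding Y_def by (subst has_sum_reindex_bij_betw[OF bij]) (rule S_has_sum_rho)
  hence "((\<lambda>z. (\<lambda>(a, l). rho a * kappa (real (a * l\<^sup>2) * Y)) (map_prod Suc Suc z)) has_sum S u) (UNIV \<times> UNIV)"
    by simp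
  moreover have "((\<lambda>l. (\<lambda>(a, l). rho a * kappa (real (a * l\<^sup>2) * Y)) (map_prod Suc Suc (a, l))) has_sum
      (rho (Suc a) * enn2real (I a))) UNIV" for a
  proof -
    have "((\<lambda>l. kappa (real (Suc l) ^ 2 * (real (Suc a) * Y))) has_sum enn2real (I a)) UNIV"
      unfolding I_def
      by (rule sums_nonneg_imp_has_sum[OF nn_integral_psi_cosh(1)[OF pos]])
         (intro kpos mult_pos_pos pos, simp del: of_nat_Suc)
    from has_sum_cmult_right[OF this, of "rho (Suc a)"] show ?thesis
      by (simp add: mult_ac del: of_nat_Suc mult_Suc)
  qed
  ultimately have "((\<lambda>a. rho (Suc a) * enn2real (I a)) has_sum S u) UNIV"
    by (rule has_sum_SigmaD)
  hence sums: "(\<lambda>a. rho (Suc a) * enn2real (I a)) sums S u" by (rule has_sum_imp_sums)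
  have nn: "0 \<le> rho (Suc a) * enn2real (I a)" for a by (simp add: rho_nonneg)
  show "S u \<ge> 0" by (rule sums_le[OF _ sums_zero sums]) (rule nn)
  have "ennreal (S u) = (\<Sum>a. ennreal (rho (Suc a) * enn2real (I a)))"
    by (rule suminf_ennreal_eq[OF nn sums, symmetric])
  also have "\<dots> = (\<Sum>a. ennreal (rho (Suc a)) * I a)"
  proof (intro suminf_cong)
    fix a
    have "I a < \<infinity>" unfolding I_def by (rule nn_integral_psi_cosh(2)[OF pos])
    thus "ennreal (rho (Suc a) * enn2real (I a)) = ennreal (rho (Suc a)) * I a"
      by (simp add: ennreal_mult rho_nonneg)
  qed
  finally show "ennreal (S u) = (\<Sum>a. ennreal (rho (Suc a)) * (\<integral>\<^sup>+x. ennreal (psi (2 * (real (Suc a) * (exp u / sqrt q)) * cosh x)) \<partial>M))"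
    by (simp only: I_def Y_def)
qed

definition arg :: "nat \<Rightarrow> real \<Rightarrow> real" where
  "arg a x = 2 * real (Suc a) / sqrt q * cosh x"

lemma arg_measurable [measurable]: "arg a \<in> borel_measurable borel"
  unfolding arg_def cosh_def by measurable

lemma arg_pos: "arg a x > 0"
  using q_pos by (simp add: arg_def del: of_nat_Suc)

lemma inverse_arg_le: "1 / arg a x \<le> sqrt q / 2"
proof -
  have "2 * 1 / sqrt q * 1 \<le> arg a x"
    unfolding arg_def by (intro mult_mono divide_right_mono) (auto simp: cosh_real_ge_1)
  hence "1 / arg a x \<le> 1 / (2 / sqrt q)" using q_pos by (intro divide_left_mono) (auto simp: arg_pos)
  thus ?thesis by simp
qed

lemma ennreal_S: "ennreal (S u) = (\<Sum>a. ennreal (rho (Suc a)) * (\<integral>\<^sup>+x. ennreal (psi (arg a x * exp u)) \<partial>M))"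
  unfolding S_series arg_def by (simp add: mult_ac)

lemma nn_integral_S:
  "(\<integral>\<^sup>+u. ennreal (S u * exp u) * indicator {0..} u \<partial>lborel) =
     (\<Sum>a. ennreal (rho (Suc a)) * (\<integral>\<^sup>+x. ennreal (psi_tail (arg a x)) \<partial>M))"
proof -
  interpret M: sigma_finite_measure M by (rule sigma_finite_M)
  interpret pair: pair_sigma_finite lborel M ..
  have "(\<integral>\<^sup>+u. ennreal (S u * exp u) * indicator {0..} u \<partial>lborel) =
    (\<integral>\<^sup>+u. (\<Sum>a. ennreal (rho (Suc a)) * (\<integral>\<^sup>+x. ennreal (psi (arg a x * exp u) * exp u) * indicator {0..} u \<partial>M)) \<partial>lborel)"
  proof (rule nn_integral_cong)
    fix u :: real
    have "ennreal (S u * exp u) * indicator {0..} u = ennreal (S u) * (ennreal (exp u) * indicator {0..} u)"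
      by (simp add: ennreal_mult S_series(2) mult.assoc)
    also have "\<dots> = (\<Sum>a. ennreal (rho (Suc a)) * (\<integral>\<^sup>+x. ennreal (psi (arg a x * exp u)) \<partial>M) * (ennreal (exp u) * indicator {0..} u))"
      unfolding ennreal_S by simp
    also have "\<dots> = (\<Sum>a. ennreal (rho (Suc a)) * (\<integral>\<^sup>+x. ennreal (psi (arg a x * exp u) * exp u) * indicator {0..} u \<partial>M))"
    proof (intro suminf_cong)
      fix a
      have "(\<integral>\<^sup>+x. ennreal (psi (arg a x * exp u) * exp u) * indicator {0..} u \<partial>M) =
         (\<integral>\<^sup>+x. ennreal (psi (arg a x * exp u)) * (ennreal (exp u) * indicator {0..} u) \<partial>M)"
        by (intro nn_integral_cong) (simp add: ennreal_mult psi_nonneg arg_pos mult.assoc)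
      also have "\<dots> = (\<integral>\<^sup>+x. ennreal (psi (arg a x * exp u)) \<partial>M) * (ennreal (exp u) * indicator {0..} u)"
        by (rule nn_integral_multc) measurable
      finally show "ennreal (rho (Suc a)) * (\<integral>\<^sup>+x. ennreal (psi (arg a x * exp u)) \<partial>M) * (ennreal (exp u) * indicator {0..} u) =
          ennreal (rho (Suc a)) * (\<integral>\<^sup>+x. ennreal (psi (arg a x * exp u) * exp u) * indicator {0..} u \<partial>M)"
        by (simp only: mult.assoc)
    qed
    finally show "ennreal (S u * exp u) * indicator {0..} u =
       (\<Sum>a. ennreal (rho (Suc a)) * (\<integral>\<^sup>+x. ennreal (psi (arg a x * exp u) * exp u) * indicator {0..} u \<partial>M))" .
  qed
  also have "\<dots> = (\<Sum>a. \<integral>\<^sup>+u. ennreal (rho (Suc a)) * (\<integral>\<^sup>+x. ennreal (psi (arg a x * exp u) * exp u) * indicator {0..} u \<partial>M) \<partial>lborel)"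
    by (rule nn_integral_suminf) measurable
  also have "\<dots> = (\<Sum>a. ennreal (rho (Suc a)) * (\<integral>\<^sup>+u. \<integral>\<^sup>+x. ennreal (psi (arg a x * exp u) * exp u) * indicator {0..} u \<partial>M \<partial>lborel))"
    by (intro suminf_cong nn_integral_cmult) measurable
  also have "\<dots> = (\<Sum>a. ennreal (rho (Suc a)) * (\<integral>\<^sup>+x. \<integral>\<^sup>+u. ennreal (psi (arg a x * exp u) * exp u) * indicator {0..} u \<partial>lborel \<partial>M))"
    by (intro suminf_cong arg_cong2[where f = "(*)"] refl pair.Fubini' [symmetric]) measurable
  also have "\<dots> = (\<Sum>a. ennreal (rho (Suc a)) * (\<integral>\<^sup>+x. ennreal (psi_tail (arg a x)) \<partial>M))"
    by (simp only: nn_integral_psi_tail[OF arg_pos])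
  finally show ?thesis .
qed

text \<open>The index 0 stands for the coefficient \<open>rho 1 = 1\<close>, and its term is already
  positive.\<close>

lemma nn_integral_S_pos: "(\<integral>\<^sup>+u. ennreal (S u * exp u) * indicator {0..} u \<partial>lborel) > 0"
proof -
  let ?f = "\<lambda>a. ennreal (rho (Suc a)) * (\<integral>\<^sup>+x. ennreal (psi_tail (arg a x)) \<partial>M)"
  have "(\<integral>\<^sup>+x. ennreal (psi_tail (arg 0 x)) \<partial>M) \<noteq> 0"
  proof
    assume "(\<integral>\<^sup>+x. ennreal (psi_tail (arg 0 x)) \<partial>M) = 0"
    hence "AE x in M. ennreal (psi_tail (arg 0 x)) = 0" by (subst (asm) nn_integral_0_iff_AE) measurable
    moreover have "ennreal (psi_tail (arg 0 x)) \<noteq> 0" for x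
      using psi_tail_pos[OF arg_pos[of 0 x]] by (simp add: ennreal_eq_0_iff)
    ultimately have "AE x in M. False" by simp
    thus False using emeasure_M_nonzero by (simp add: ae_filter_eq_bot_iff flip: trivial_limit_def)
  qed
  hence "0 < ?f 0" by (simp add: zero_less_iff_neq_zero)
  also have "?f 0 \<le> (\<Sum>a. ?f a)" using sum_le_suminf[of ?f "{0}"] by simp
  finally show ?thesis unfolding nn_integral_S .
qed

theorem nn_integral_S_le:
  assumes c: "0 \<le> c" "c \<le> 101 / 200" "c * (pi / 6 * (sqrt q / 2) - sqrt (sqrt q / 2) + 1 / 2) \<le> 12 / 25"
  shows "ennreal c * (\<integral>\<^sup>+u. ennreal (S u * exp u) * indicator {0..} u \<partial>lborel) \<le> ennreal c0"
proof -
  let ?T = "\<integral>\<^sup>+u. ennreal (S u * exp u) * indicator {0..} u \<partial>lborel"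
  have "ennreal c * ?T + 2 * ennreal (S (ln 2)) =
     (\<Sum>a. ennreal (rho (Suc a)) * (\<integral>\<^sup>+x. ennreal (c * psi_tail (arg a x) + 2 * psi (2 * arg a x)) \<partial>M))"
  proof -
    have "(\<integral>\<^sup>+x. ennreal (c * psi_tail (arg a x) + 2 * psi (2 * arg a x)) \<partial>M) =
        ennreal c * (\<integral>\<^sup>+x. ennreal (psi_tail (arg a x)) \<partial>M) + 2 * (\<integral>\<^sup>+x. ennreal (psi (arg a x * exp (ln 2))) \<partial>M)" for a
    proof -
      have "(\<integral>\<^sup>+x. ennreal (c * psi_tail (arg a x) + 2 * psi (2 * arg a x)) \<partial>M) =
        (\<integral>\<^sup>+x. ennreal c * ennreal (psi_tail (arg a x)) + 2 * ennreal (psi (arg a x * exp (ln 2))) \<partial>M)"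
      proof (rule nn_integral_cong)
        fix x
        have "0 \<le> c * psi_tail (arg a x)" "0 \<le> psi (2 * arg a x)" "0 \<le> psi_tail (arg a x)"
          using c psi_tail_pos[OF arg_pos, of a x] psi_pos[of "2 * arg a x"] arg_pos[of a x] by simp_all
        thus "ennreal (c * psi_tail (arg a x) + 2 * psi (2 * arg a x)) =
           ennreal c * ennreal (psi_tail (arg a x)) + 2 * ennreal (psi (arg a x * exp (ln 2)))"
          using c by (simp add: ennreal_plus ennreal_mult mult_ac)
      qed
      also have "\<dots> = ennreal c * (\<integral>\<^sup>+x. ennreal (psi_tail (arg a x)) \<partial>M) + 2 * (\<integral>\<^sup>+x. ennreal (psi (arg a x * exp (ln 2))) \<partial>M)"
        by (subst nn_integral_add, measurable, subst (1 2) nn_integral_cmult, measurable)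
      finally show ?thesis .
    qed
    moreover have "(\<Sum>a. r a * (k * A a + 2 * B a)) = k * (\<Sum>a. r a * A a) + 2 * (\<Sum>a. r a * B a)"
      for r A B and k :: ennreal
    proof -
      have "(\<Sum>a. r a * (k * A a + 2 * B a)) = (\<Sum>a. k * (r a * A a) + 2 * (r a * B a))"
        by (intro suminf_cong) (simp only: distrib_left mult.left_commute)
      also have "\<dots> = (\<Sum>a. k * (r a * A a)) + (\<Sum>a. 2 * (r a * B a))"
        by (rule suminf_add [symmetric]) (rule summableI)+
      finally show ?thesis by (simp only: ennreal_suminf_cmult)
    qed
    ultimately show ?thesis unfolding nn_integral_S ennreal_S by (simp only:)
  qed
  also have "\<dots> \<le> (\<Sum>a. ennreal (rho (Suc a)) * (\<integral>\<^sup>+x. ennreal (psi (arg a x * exp (- ln 2))) \<partial>M))"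
  proof (intro suminf_le mult_left_mono nn_integral_mono ennreal_leI)
    fix a x
    have "c * psi_tail (arg a x) + 2 * psi (2 * arg a x) \<le> psi (arg a x / 2)"
      by (rule psi_inequality[OF arg_pos c(1,2) inverse_arg_le c(3)])
    thus "c * psi_tail (arg a x) + 2 * psi (2 * arg a x) \<le> psi (arg a x * exp (- ln 2))"
      by (simp add: exp_minus)
  qed auto
  also have "\<dots> = ennreal (S (- ln 2))" by (rule ennreal_S [symmetric])
  \<comment> \<open>This is the functional equation at \<open>ln 2\<close>, where both
    \<open>exp u\<close> and \<open>exp u - 1\<close> are explicit: 2 and 1.\<close>
  also have "S (- ln 2) = c0 + 2 * S (ln 2)" using S_minus[of "ln 2"] by simp
  finally have le: "ennreal c * ?T + 2 * ennreal (S (ln 2)) \<le> ennreal (c0 + 2 * S (ln 2))" .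
  have 2: "2 * ennreal (S (ln 2)) = ennreal (2 * S (ln 2))" by (simp add: ennreal_mult S_series(2))
  have "ennreal (2 * S (ln 2)) \<le> ennreal (c0 + 2 * S (ln 2))"
    by (rule order_trans[OF _ le]) (simp add: 2 add_increasing)
  show ?thesis
  proof (cases "c0 \<ge> 0")
    case True
    have "ennreal (c0 + 2 * S (ln 2)) = ennreal c0 + ennreal (2 * S (ln 2))"
      using True S_series(2) by (intro ennreal_plus) auto
    thus ?thesis using le by (simp add: 2 ennreal_add_left_cancel_le add.commute)
  next
    case False
    have "ennreal c * ?T + ennreal (2 * S (ln 2)) \<le> ennreal 0 + ennreal (2 * S (ln 2))"
      using False S_series(2)[of "ln 2"] by (intro order_trans[OF le[unfolded 2]]) (auto intro!: ennreal_leI)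
    hence "ennreal c * ?T \<le> 0"
      unfolding add.commute[of _ "ennreal (2 * S (ln 2))"] ennreal_add_left_cancel_le by simp
    thus ?thesis by (rule order_trans) simp
  qed
qed

end

section \<open>Numerical verification\<close>

lemma le_ln_natpow:
  fixes x :: real
  assumes x: "x > 0" and n: "n > 0" and le: "(68 / 25) ^ m \<le> x ^ n"
  shows "real m / real n \<le> ln x"
proof -
  \<comment> \<open>The rational 68/25 = 2.72 is an upper bound for e, so lower bounds for
    logarithms become comparisons of integer powers.\<close>
  have "exp (real m) = exp 1 ^ m" by (simp flip: exp_of_nat_mult)
  also have "\<dots> \<le> (68 / 25) ^ m" using e_less_272 by (intro power_mono) auto
  also note le
  finally have "exp (real m) \<le> x ^ n" .
  hence "real m \<le> ln (x ^ n)" using x by (simp add: ln_ge_iff)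
  thus ?thesis using n x by (simp add: ln_realpow field_simps)
qed

lemma square_le_chord:
  fixes r a b :: real
  assumes "a \<le> r" "r \<le> b"
  shows "r\<^sup>2 \<le> (a + b) * r - a * b"
proof -
  have "0 \<le> (r - a) * (b - r)" using assms by simp
  thus ?thesis by (simp add: power2_eq_square algebra_simps)
qed

text \<open>With \<open>Y = sqrt q / 2\<close>, the bounds on \<open>\<sigma>\<close> are those of \<open>\<sigma> = \<beta>(1 - \<beta>)\<close> for
  \<open>\<beta>\<close> in the claimed zero-free interval. The convex function of \<open>sqrt Y\<close> is bounded by its chords.\<close>

lemma numeric_bound:
  assumes Y: "Y \<ge> 81 / 100" and s: "0 \<le> \<sigma>" "\<sigma> \<le> 1 / 4" "\<sigma> * (Y * (ln (2 * Y))\<^sup>2) \<le> 5"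
  shows "101 / 50 * \<sigma> * (pi / 6 * Y - sqrt Y + 1 / 2) \<le> 12 / 25"
proof -
  define r where "r = sqrt Y"
  have rY: "Y = r\<^sup>2" using Y by (simp add: r_def)
  have r: "r \<ge> 9 / 10" unfolding r_def using Y by (intro real_le_rsqrt) (simp add: power2_eq_square)
  have pi: "pi / 6 * Y \<le> 5236 / 10000 * Y" using pi_approx Y by (intro mult_right_mono) auto
  have chord: "Y \<le> (a + b) * r - a * b" if "a \<le> r" "r \<le> b" for a b
    unfolding rY by (rule square_le_chord[OF that])
  \<comment> \<open>The constant 4752/100000 is 12/25 divided by 2.02 * 5, rounded down; each range
    only has to beat k with a lower bound for \<open>ln (2 * Y)\<close>.\<close>
  have large: ?thesis
    if L: "real m / real n \<le> ln (2 * Y)" and k: "k \<le> 4752 / 100000 * (real m / real n)\<^sup>2" and g: "pi / 6 * Y - r + 1 / 2 \<le> k * Y"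
    for m n k
  proof -
    have "pi / 6 * Y - r + 1 / 2 \<le> 4752 / 100000 * (real m / real n)\<^sup>2 * Y"
      using g k Y by (intro order_trans[OF g] mult_right_mono) auto
    also have "\<dots> \<le> 4752 / 100000 * (ln (2 * Y))\<^sup>2 * Y"
      using L Y by (intro mult_right_mono mult_left_mono power_mono) auto
    finally have "\<sigma> * (pi / 6 * Y - r + 1 / 2) \<le> \<sigma> * (4752 / 100000 * (ln (2 * Y))\<^sup>2 * Y)"
      using s by (intro mult_left_mono)
    also have "\<dots> = 4752 / 100000 * (\<sigma> * (Y * (ln (2 * Y))\<^sup>2))" by simp
    finally show ?thesis using s(3) unfolding r_def mult.assoc[of "101 / 50"] by simp
  qed
  \<comment> \<open>For \<open>Y \<le> 5\<close> the bound \<open>\<sigma> \<le> 1 / 4\<close>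
    suffices. On the other ranges the logarithm is bounded at the left end, where
    \<open>2 * Y\<close> is 10, 16 and 32.\<close>
  consider "Y \<le> 5" | "5 \<le> Y" "Y \<le> 8" | "8 \<le> Y" "Y \<le> 16" | "16 \<le> Y" by linarith
  thus ?thesis
  proof cases
    case 1
    have b: "r \<le> 224 / 100" unfolding r_def using 1 by (intro real_le_lsqrt) (auto simp: power2_eq_square)
    have g: "pi / 6 * Y - r + 1 / 2 \<le> 9 / 10" using chord[OF r b] pi b by simp
    have "\<sigma> * (pi / 6 * Y - r + 1 / 2) \<le> \<sigma> * (9 / 10)" using g s by (intro mult_left_mono)
    thus ?thesis using s unfolding r_def mult.assoc[of "101 / 50"] by simp
  next
    case 2
    have a: "22 / 10 \<le> r" unfolding r_def using 2 by (intro real_le_rsqrt) (auto simp: power2_eq_square)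
    have b: "r \<le> 283 / 100" unfolding r_def using 2 by (intro real_le_lsqrt) (auto simp: power2_eq_square)
    show ?thesis
    proof (rule large)
      show "real 9 / real 4 \<le> ln (2 * Y)"
      proof (rule le_ln_natpow)
        have "10 ^ 4 \<le> (2 * Y) ^ 4" using 2 by (intro power_mono) auto
        thus "(68 / 25) ^ 9 \<le> (2 * Y) ^ 4" by (rule order_trans[rotated]) (simp add: eval_nat_numeral)
      qed (use 2 in auto)
      show "2405 / 10000 \<le> 4752 / 100000 * (real 9 / real 4)\<^sup>2" by (simp add: power2_eq_square)
      show "pi / 6 * Y - r + 1 / 2 \<le> 2405 / 10000 * Y" using chord[OF a b] pi a b by simp
    qed
  next
    case 3
    have a: "28 / 10 \<le> r" unfolding r_def using 3 by (intro real_le_rsqrt) (auto simp: power2_eq_square)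
    have b: "r \<le> 4" unfolding r_def using 3 by (intro real_le_lsqrt) (auto simp: power2_eq_square)
    show ?thesis
    proof (rule large)
      show "real 27 / real 10 \<le> ln (2 * Y)"
      proof (rule le_ln_natpow)
        have "16 ^ 10 \<le> (2 * Y) ^ 10" using 3 by (intro power_mono) auto
        thus "(68 / 25) ^ 27 \<le> (2 * Y) ^ 10" by (rule order_trans[rotated]) (simp add: power_divide)
      qed (use 3 in auto)
      show "346 / 1000 \<le> 4752 / 100000 * (real 27 / real 10)\<^sup>2" by (simp add: power2_eq_square)
      show "pi / 6 * Y - r + 1 / 2 \<le> 346 / 1000 * Y" using chord[OF a b] pi a b by simp
    qed
  next
    case 4
    have a: "4 \<le> r" unfolding r_def using 4 by (intro real_le_rsqrt) (auto simp: power2_eq_square)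
    show ?thesis
    proof (rule large)
      show "real 10 / real 3 \<le> ln (2 * Y)"
      proof (rule le_ln_natpow)
        have "32 ^ 3 \<le> (2 * Y) ^ 3" using 4 by (intro power_mono) auto
        thus "(68 / 25) ^ 10 \<le> (2 * Y) ^ 3" by (rule order_trans[rotated]) (simp add: power_divide)
      qed (use 4 in auto)
      show "528 / 1000 \<le> 4752 / 100000 * (real 10 / real 3)\<^sup>2" by (simp add: power2_eq_square)
      show "pi / 6 * Y - r + 1 / 2 \<le> 528 / 1000 * Y" using pi a Y by linarith
    qed
  qed
qed

section \<open>Exclusion of zeros for primitive characters\<close>

context nontrivial_primitive_quadratic
begin

lemma q_ge_3: "q \<ge> 3"
  using q_gt_1 not_2_mod_4 by (cases "q = 2") auto

text \<open>Every sufficiently small \<open>c > 0\<close> is admissible in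
  \<open>nn_integral_S_le\<close>, and the integral there is positive; so L(1, chi) > 0 comes from
  the same inequality.\<close>

lemma c0_pos: "c0 > 0"
proof (rule ccontr)
  define g where "g = pi / 6 * (sqrt q / 2) - sqrt (sqrt q / 2) + 1 / 2"
  define c where "c = min (101 / 200) (12 / 25 / (\<bar>g\<bar> + 1))"
  have c: "c > 0" "c \<le> 101 / 200" by (auto simp: c_def)
  have "c * g \<le> c * (\<bar>g\<bar> + 1)" using c by (intro mult_left_mono) auto
  also have "\<dots> \<le> 12 / 25 / (\<bar>g\<bar> + 1) * (\<bar>g\<bar> + 1)" by (intro mult_right_mono) (auto simp: c_def)
  also have "\<dots> = 12 / 25"
    using abs_ge_zero[of g] by (intro nonzero_eq_divide_eq[THEN iffD1] refl) linarith
  finally have "ennreal c * (\<integral>\<^sup>+u. ennreal (S u * exp u) * indicator {0..} u \<partial>lborel) \<le> ennreal c0"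
    using c by (intro nn_integral_S_le) (auto simp: g_def)
  moreover have "ennreal c * (\<integral>\<^sup>+u. ennreal (S u * exp u) * indicator {0..} u \<partial>lborel) > 0"
    using c nn_integral_S_pos by (simp add: ennreal_zero_less_mult_iff)
  moreover assume "\<not> c0 > 0"
  ultimately show False using ennreal_neg[of c0] by (metis not_le linorder_le_cases)
qed

text \<open>A zero gives \<open>c0 \<le> 2 * \<sigma> * t\<close>, the theta inequality gives
  \<open>2.02 * \<sigma> * t \<le> c0\<close>, and t is positive and finite.\<close>

lemma no_zero_of_bound:
  assumes s: "0 < s" "s < 1" and zero: "L_entire (of_real s) = 0"
    and bound: "101 / 50 * (s * (1 - s)) * (pi / 6 * (sqrt q / 2) - sqrt (sqrt q / 2) + 1 / 2) \<le> 12 / 25"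
  shows False
proof -
  define \<sigma> where "\<sigma> = s * (1 - s)"
  have \<sigma>: "\<sigma> > 0" using s by (simp add: \<sigma>_def)
  have "0 \<le> (s - 1 / 2)\<^sup>2" by simp
  hence \<sigma>4: "\<sigma> \<le> 1 / 4" by (simp add: \<sigma>_def power2_eq_square algebra_simps)
  let ?T = "\<integral>\<^sup>+u. ennreal (S u * exp u) * indicator {0..} u \<partial>lborel"
  have low: "ennreal (101 / 50 * \<sigma>) * ?T \<le> ennreal c0"
    using \<sigma> \<sigma>4 bound by (intro nn_integral_S_le) (auto simp: \<sigma>_def)
  \<comment> \<open>Finiteness comes from the lower inequality itself, whose right side is a real
    number.\<close>
  have fin: "?T < \<infinity>"
  proof (rule ccontr)
    assume "\<not> ?T < \<infinity>"
    hence "ennreal (101 / 50 * \<sigma>) * ?T = \<infinity>" using \<sigma> by (simp add: less_top [symmetric] ennreal_mult_top)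
    thus False using low by (simp add: top_unique)
  qed
  then obtain t where t: "t \<ge> 0" "?T = ennreal t" by (cases ?T) auto
  have t0: "t > 0" using nn_integral_S_pos t by simp
  have "ennreal (c0 / \<sigma>) \<le> (\<integral>\<^sup>+u. ennreal (2 * (S u * exp u)) * indicator {0<..} u \<partial>lborel)"
    unfolding \<sigma>_def by (rule c0_le_of_zero[OF s D_eq_0[OF zero s(1)] S_series(2)])
  also have "\<dots> \<le> (\<integral>\<^sup>+u. 2 * (ennreal (S u * exp u) * indicator {0..} u) \<partial>lborel)"
  proof (rule nn_integral_mono)
    fix u :: real
    have "ennreal (2 * (S u * exp u)) = 2 * ennreal (S u * exp u)"
      using S_series(2) by (simp add: ennreal_mult)
    thus "ennreal (2 * (S u * exp u)) * indicator {0<..} u \<le> 2 * (ennreal (S u * exp u) * indicator {0..} u)"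
      by (simp add: indicator_def)
  qed
  also have "\<dots> = 2 * ?T" by (rule nn_integral_cmult) (unfold S_def, measurable)
  also have "\<dots> = ennreal (2 * t)" using t by (simp add: ennreal_mult)
  finally have "c0 / \<sigma> \<le> 2 * t" using t by simp
  hence "c0 \<le> 2 * \<sigma> * t" using \<sigma> by (simp add: field_simps)
  moreover have "101 / 50 * \<sigma> * t \<le> c0"
    using low \<sigma> t c0_pos by (simp add: ennreal_le_iff flip: ennreal_mult)
  moreover have "\<sigma> * t > 0" using \<sigma> t0 by simp
  ultimately show False by simp
qed

text \<open>The product of the zeta series with the series of \<open>chi\<close> regroups into
  nonnegative terms \<open>rho a * f (a * l\<^sup>2)\<close>, and the pair (1, 1) alone contributes
  1.\<close>

lemma L_entire_nonzero_gt_1: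
  assumes b: "\<beta> > 1"
  shows "L_entire (of_real \<beta>) \<noteq> 0"
proof
  assume zero: "L_entire (of_real \<beta>) = 0"
  define f where "f = (\<lambda>k. real k powr - \<beta>)"
  define A where "A = (\<lambda>n. f (Suc n))"
  define B where "B = (\<lambda>n. X (Suc n) * f (Suc n))"
  have "summable f" using b by (simp add: f_def summable_real_powr_iff)
  hence A: "summable (\<lambda>n. \<bar>A n\<bar>)" using summable_Suc_iff[of f] by (simp add: A_def f_def)
  have B: "summable (\<lambda>n. \<bar>B n\<bar>)"
  proof (rule summable_comparison_test'[OF A])
    show "norm \<bar>B n\<bar> \<le> \<bar>A n\<bar>" for n
      using mult_right_mono[OF abs_X_le[of "Suc n"], of "\<bar>f (Suc n)\<bar>"] by (simp add: A_def B_def abs_mult)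
  qed
  have "(\<lambda>n. of_real (B n) :: complex) = (\<lambda>n. chi (int (Suc n)) * of_nat (Suc n) powr (- of_real \<beta>))"
  proof
    fix n
    have "of_real (f (Suc n)) = (of_nat (Suc n) powr (- of_real \<beta>) :: complex)"
      using powr_of_real[of "real (Suc n)" "- \<beta>"] by (simp add: f_def del: of_nat_Suc)
    thus "of_real (B n) = chi (int (Suc n)) * of_nat (Suc n) powr (- of_real \<beta>)"
      by (simp only: B_def of_real_mult of_real_X)
  qed
  hence "of_real (\<Sum>n. B n) = dirichlet_series chi (of_real \<beta>)"
    unfolding dirichlet_series_def using suminf_of_real[OF summable_rabs_cancel[OF B], where 'a = complex] by simp
  also have "\<dots> = 0" using D_dirichlet_series[of "of_real \<beta>"] b zero by simp
  finally have B0: "suminf B = 0" by simp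
  have "((\<lambda>(n, m). A n * B m) has_sum 0) UNIV"
    using has_sum_product_nat(1)[OF A B] by (simp add: B0)
  also have "(\<lambda>(n, m). A n * B m) = (\<lambda>z. (\<lambda>(n, m). X m * f (n * m)) (map_prod Suc Suc z))"
    by (auto simp: fun_eq_iff A_def B_def f_def powr_mult simp del: of_nat_Suc mult_Suc mult_Suc_right)
  finally have "((\<lambda>z. (\<lambda>(n, m). X m * f (n * m)) (map_prod Suc Suc z)) has_sum 0) UNIV" .
  moreover have "bij_betw (map_prod Suc Suc) UNIV ({0<..} \<times> {0<..})"
    by (rule bij_betw_byWitness[where f' = "map_prod (\<lambda>n. n - 1) (\<lambda>n. n - 1)"]) auto
  ultimately have "((\<lambda>(n, m). X m * f (n * m)) has_sum 0) ({0<..} \<times> {0<..})"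
    by (subst (asm) has_sum_reindex_bij_betw)
  hence total: "((\<lambda>(a, l). rho a * f (a * l\<^sup>2)) has_sum 0) ({0<..} \<times> {0<..})"
    by (rule has_sum_regroup)
  have "((\<lambda>(a, l). rho a * f (a * l\<^sup>2)) has_sum 1) {(1, 1)}"
    using has_sum_finite[of "{(1, 1)}" "\<lambda>(a, l). rho a * f (a * l\<^sup>2)"] by (simp add: f_def)
  hence "1 \<le> (0 :: real)"
    by (rule has_sum_mono2[OF _ total]) (auto simp: rho_nonneg f_def)
  thus False by simp
qed

theorem L_entire_zero_bound:
  assumes b: "\<beta> > 0" and zero: "L_entire (of_real \<beta>) = 0"
  shows "\<beta> \<le> 1 - 40 / (sqrt q * (ln q)\<^sup>2)"
proof (rule ccontr)
  assume *: "\<not> \<beta> \<le> 1 - 40 / (sqrt q * (ln q)\<^sup>2)"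
  have "\<beta> \<noteq> 1"
  proof
    assume "\<beta> = 1"
    hence "(\<integral>u. exp (u / 2) * h u \<partial>lborel) = 0" using D_eq_0[OF zero b] by (simp add: mult.commute)
    thus False using integral_exp_half_h c0_pos by simp
  qed
  moreover have "\<not> \<beta> > 1" using L_entire_nonzero_gt_1 zero by blast
  ultimately have b1: "\<beta> < 1" by simp
  define Y where "Y = sqrt q / 2"
  have q3: "real q \<ge> 3" using q_ge_3 by simp
  have "sqrt q \<ge> 162 / 100" using q3 by (intro real_le_rsqrt) (simp add: power2_eq_square)
  hence Y: "Y \<ge> 81 / 100" by (simp add: Y_def)
  \<comment> \<open>Since \<open>2 * Y = sqrt q\<close>, the quantity
    \<open>Y * (ln (2 * Y))\<^sup>2\<close> is one eighth of the denominator, and 40 / 8 =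
    5.\<close>
  have "ln (2 * Y) = ln q / 2" using q3 by (simp add: Y_def ln_sqrt)
  hence "Y * (ln (2 * Y))\<^sup>2 = Y * (ln q / 2)\<^sup>2" by (simp only:)
  hence L: "Y * (ln (2 * Y))\<^sup>2 = sqrt q * (ln q)\<^sup>2 / 8" by (simp add: Y_def power_divide)
  define P where "P = sqrt q * (ln q)\<^sup>2"
  have P: "P > 0" using q3 by (simp add: P_def)
  have "1 - \<beta> < 40 / P" using * by (simp add: P_def)
  hence "(1 - \<beta>) * P \<le> 40" using P by (simp add: field_simps)
  moreover have "\<beta> * (1 - \<beta>) * P \<le> 1 * (1 - \<beta>) * P"
    using b b1 P by (intro mult_right_mono) auto
  ultimately have "\<beta> * (1 - \<beta>) * (Y * (ln (2 * Y))\<^sup>2) \<le> 5" unfolding L P_def by simp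
  moreover have "\<beta> * (1 - \<beta>) \<le> 1 / 4"
  proof -
    have "0 \<le> (\<beta> - 1 / 2)\<^sup>2" by simp
    thus ?thesis by (simp add: power2_eq_square algebra_simps)
  qed
  ultimately have "101 / 50 * (\<beta> * (1 - \<beta>)) * (pi / 6 * Y - sqrt Y + 1 / 2) \<le> 12 / 25"
    using b b1 Y by (intro numeric_bound) auto
  thus False unfolding Y_def by (rule no_zero_of_bound[OF b b1 zero])
qed

end

section \<open>Reduction to primitive characters\<close>

text \<open>Multiplication by p does not affect divisibility by the other primes, so discarding the
  multiples of p subtracts \<open>f p\<close> times the sum sieved so far.\<close>

lemma has_sum_remove_primes:
  fixes f :: "nat \<Rightarrow> complex"
  assumes mult: "\<And>m n. f (m * n) = f m * f n" and f: "(f has_sum T) UNIV"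
    and P: "finite P" "\<And>p. p \<in> P \<Longrightarrow> prime p"
  shows "((\<lambda>n. if \<exists>p\<in>P. p dvd n then 0 else f n) has_sum (T * (\<Prod>p\<in>P. 1 - f p))) UNIV"
  using P
proof (induction P)
  case empty
  thus ?case using f by simp
next
  case (insert p P)
  define g where "g = (\<lambda>n. if \<exists>p\<in>P. p dvd n then 0 else f n)"
  define U where "U = T * (\<Prod>p\<in>P. 1 - f p)"
  have g: "(g has_sum U) UNIV" using insert unfolding g_def U_def by simp
  have p: "prime p" using insert by simp
  have p0: "p > 0" using p prime_gt_0_nat by simp
  have gp: "g (p * n) = f p * g n" for n
  proof -
    have "r dvd p * n \<longleftrightarrow> r dvd n" if "r \<in> P" for r
    proof -
      have "prime r" "r \<noteq> p" using insert that by auto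
      thus ?thesis using p by (metis prime_dvd_mult_iff primes_dvd_imp_eq)
    qed
    thus ?thesis by (auto simp: g_def mult)
  qed
  have "((\<lambda>n. f p * g n) has_sum (f p * U)) UNIV" by (rule has_sum_cmult_right[OF g])
  hence "((g \<circ> (*) p) has_sum (f p * U)) UNIV" by (simp add: o_def gp)
  hence "(g has_sum (f p * U)) (range ((*) p))"
    using p0 by (subst has_sum_reindex) (auto simp: inj_on_def)
  hence "(g has_sum (U - f p * U)) (UNIV - range ((*) p))" by (intro has_sum_Diff g) auto
  also have "?this \<longleftrightarrow> ((\<lambda>n. if \<exists>p\<in>insert p P. p dvd n then 0 else f n) has_sum (U - f p * U)) UNIV"
    by (rule has_sum_cong_neutral) (auto simp: g_def dvd_def image_iff)
  also have "U - f p * U = T * (\<Prod>p\<in>insert p P. 1 - f p)"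
    using insert by (simp add: U_def algebra_simps)
  finally show ?case .
qed

lemma coprime_lift:
  fixes a :: int
  assumes q: "q > 0" and r: "r dvd q" and a: "coprime a (int r)"
  shows "\<exists>n. [n = a] (mod int r) \<and> coprime n (int q)"
proof -
  \<comment> \<open>Each prime divisor of q divides exactly one of a and \<open>r * k\<close>, hence
    never their sum.\<close>
  define k where "k = \<Prod>{p \<in> prime_factors q. \<not> int p dvd a}"
  have fin: "finite {p \<in> prime_factors q. \<not> int p dvd a}" by simp
  have "coprime (a + int r * int k) (int q)"
  proof (rule ccontr)
    assume "\<not> coprime (a + int r * int k) (int q)"
    then obtain p where p: "prime p" "p dvd a + int r * int k" "p dvd int q"
    proof -
      let ?g = "gcd (a + int r * int k) (int q)"
      have "?g \<noteq> 0" using q by simp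
      moreover have "\<not> is_unit ?g" using \<open>\<not> coprime _ _\<close> by (simp add: coprime_iff_gcd_eq_1)
      ultimately obtain p where "prime p" "p dvd ?g" using prime_divisor_exists[of ?g] by blast
      thus thesis using that[of p] by simp
    qed
    define p' where "p' = nat p"
    have p': "p = int p'" using p(1) by (simp add: p'_def prime_ge_0_int)
    have prime: "prime p'" "p' dvd q" using p by (simp_all add: p')
    hence pf: "p' \<in> prime_factors q" using q by (intro prime_factorsI) auto
    show False
    proof (cases "int p' dvd a")
      case True
      have ndk: "\<not> p' dvd k"
      proof
        assume "p' dvd k"
        then obtain s where "s \<in> prime_factors q" "\<not> int s dvd a" "p' dvd s"
          using prime_dvd_prod_iff[OF fin prime(1), of "\<lambda>x. x"] by (auto simp: k_def)
        moreover from this have "p' = s"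
          by (intro primes_dvd_imp_eq[OF prime(1)] in_prime_factors_imp_prime)
        ultimately show False using True by simp
      qed
      have "int p' dvd int r * int k" using p(2) True by (simp add: p' dvd_add_right_iff)
      hence "p' dvd r * k" by (simp flip: of_nat_mult)
      hence "p' dvd r" using ndk prime(1) by (simp add: prime_dvd_mult_iff)
      hence "is_unit (int p')" by (intro coprime_common_divisor[OF a True]) simp
      thus False using prime(1) by simp
    next
      case False
      hence "p' dvd k" unfolding k_def using pf by (intro dvd_prodI fin) auto
      hence "int p' dvd int r * int k" by (intro dvd_mult) simp
      hence "int p' dvd a" using p(2) by (simp add: p' dvd_add_left_iff)
      thus False using False by simp
    qed
  qed
  moreover have "[a + int r * int k = a] (mod int r)" by (simp add: cong_def)
  ultimately show ?thesis by blast
qed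

lemma quadratic_character_induced:
  assumes q: "q > 0" and chi: "quadratic_character q chi"
  obtains r psi where "nontrivial_primitive_quadratic r psi" "r dvd q"
    "\<And>n. chi n = (if coprime n (int q) then psi n else 0)"
proof -
  have char: "dirichlet_character q chi" and nonprincipal: "chi \<noteq> principal_character q"
    and sq: "(chi a)\<^sup>2 = principal_character q a" for a
    using chi by (auto simp: quadratic_character_def fun_eq_iff)
  have mult: "chi (a * b) = chi a * chi b" and zero: "chi a = 0 \<longleftrightarrow> \<not> coprime a (int q)" for a b
    using char by (auto simp: dirichlet_character_def)
  have chi_cong: "chi a = chi b" if "[a = b] (mod int q)" for a b
    by (rule dirichlet_character_cong[OF char that])
  have chi_values: "chi a \<in> {-1, 0, 1}" for a
    using sq[of a] by (auto simp: principal_character_def power2_eq_1_iff split: if_splits)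
  have "chi 1 * chi 1 = chi 1" using mult[of 1 1] by simp
  hence one: "chi 1 = 1" using zero[of 1] by simp
  define trivial where "trivial d \<longleftrightarrow> d dvd q \<and> (\<forall>n. coprime n (int q) \<longrightarrow> [n = 1] (mod int d) \<longrightarrow> chi n = 1)" for d
  \<comment> \<open>The conductor, as the least divisor d of q such that \<open>chi\<close> is 1 on
    all units congruent to 1 modulo d. Minimality is exactly the primitivity condition of the
    locale.\<close>
  define r where "r = (LEAST d. trivial d)"
  have "trivial q" using chi_cong one by (auto simp: trivial_def)
  hence r: "trivial r" unfolding r_def by (rule LeastI)
  hence rq: "r dvd q" by (simp add: trivial_def)
  have least: "\<not> trivial d" if "d < r" for d using that not_less_Least unfolding r_def by blast
  have r0: "r > 0" using rq q by (auto intro: Nat.gr0I)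
  have coprime_r: "coprime n (int r)" if "coprime n (int q)" for n
    using that rq by (meson coprime_divisors dvd_refl of_nat_dvd_iff)
  \<comment> \<open>On units of q the value depends only on the residue modulo r: multiplying by an
    inverse modulo q reduces to residues congruent to 1. This makes the definition of
    \<open>psi\<close> through lifts independent of the choice.\<close>
  have well: "chi m = chi n" if m: "coprime m (int q)" and n: "coprime n (int q)" and mn: "[m = n] (mod int r)" for m n
  proof -
    obtain k where k: "[n * k = 1] (mod int q)" using n by (metis coprime_iff_invertible_int)
    have kq: "coprime k (int q)" using k coprime_iff_invertible_int[of k "int q"] by (metis mult.commute)
    have "[n * k = 1] (mod int r)" using k rq by (meson cong_dvd_modulus of_nat_dvd_iff)
    hence "[m * k = 1] (mod int r)" using cong_mult[OF mn cong_refl[of k]] cong_trans by blast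
    hence "chi (m * k) = 1" using r m kq by (simp add: trivial_def)
    moreover have "chi (n * k) = 1" using chi_cong[OF k] one by simp
    ultimately have "chi k * (chi m - chi n) = 0" by (simp add: mult algebra_simps)
    thus ?thesis using kq zero[of k] by simp
  qed
  define lift where "lift a = (SOME n. [n = a] (mod int r) \<and> coprime n (int q))" for a
  have lift: "[lift a = a] (mod int r)" "coprime (lift a) (int q)" if "coprime a (int r)" for a
    using someI_ex[OF coprime_lift[OF q rq that]] by (simp_all add: lift_def)
  define psi where "psi a = (if coprime a (int r) then chi (lift a) else 0)" for a
  have psi_eq: "psi a = chi n" if n: "coprime n (int q)" and na: "[n = a] (mod int r)" for a n
  proof -
    have a: "coprime a (int r)" using coprime_r[OF n] na by (metis cong_imp_coprime)
    have "[lift a = n] (mod int r)" using lift(1)[OF a] na by (meson cong_sym cong_trans)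
    thus ?thesis using a well[OF lift(2)[OF a] n] by (simp add: psi_def)
  qed
  have "psi (a + int r) = psi a" for a
  proof (cases "coprime a (int r)")
    case True
    have "[lift a = a + int r] (mod int r)" using lift(1)[OF True] by (simp add: cong_def)
    thus ?thesis using psi_eq[OF lift(2)[OF True]] True by (simp add: psi_def)
  next
    case False
    thus ?thesis by (simp add: psi_def coprime_iff_gcd_eq_1)
  qed
  moreover have "psi (a * b) = psi a * psi b" for a b
  proof (cases "coprime a (int r) \<and> coprime b (int r)")
    case True
    hence a: "coprime a (int r)" and b: "coprime b (int r)" by auto
    have "psi (a * b) = chi (lift a * lift b)"
      by (rule psi_eq) (use lift[OF a] lift[OF b] in \<open>auto intro: cong_mult\<close>)
    thus ?thesis using a b by (simp add: mult psi_def)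
  qed (auto simp: psi_def)
  moreover have "psi a \<noteq> 0 \<longleftrightarrow> coprime a (int r)" for a
    using lift(2)[of a] zero[of "lift a"] by (simp add: psi_def)
  ultimately have psi_char: "dirichlet_character r psi" by (simp add: dirichlet_character_def)
  have "r \<noteq> 1"
  proof
    assume "r = 1"
    hence "chi n = principal_character q n" for n
      using r zero[of n] by (auto simp: trivial_def principal_character_def)
    thus False using nonprincipal by auto
  qed
  have "nontrivial_primitive_quadratic r psi"
  proof
    show "psi a \<in> {-1, 0, 1}" for a using chi_values[of "lift a"] by (auto simp: psi_def)
    fix d assume d: "d dvd r" "d < r"
    have "d dvd q" using d(1) rq by (rule dvd_trans)
    then obtain n where n: "coprime n (int q)" "[n = 1] (mod int d)" "chi n \<noteq> 1"
      using least[OF d(2)] by (auto simp: trivial_def)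
    moreover have "psi n = chi n" by (rule psi_eq[OF n(1) cong_refl])
    ultimately show "\<exists>n. coprime n (int r) \<and> [n = 1] (mod int d) \<and> psi n \<noteq> 1"
      using coprime_r by (intro exI[of _ n]) simp
  qed (use psi_char r0 \<open>r \<noteq> 1\<close> in auto)
  moreover have "chi n = (if coprime n (int q) then psi n else 0)" for n
    using psi_eq[OF _ cong_refl, of n] zero[of n] by auto
  ultimately show thesis using that rq by blast
qed

context nontrivial_primitive_quadratic
begin

lemma has_sum_dirichlet_series:
  assumes s: "Re s > 1"
  shows "((\<lambda>n. chi (int n) * of_nat n powr (- s)) has_sum L_entire s) UNIV"
proof -
  let ?f = "\<lambda>n. chi (int n) * of_nat n powr (- s)"
  have n: "summable (\<lambda>n. norm (?f n))"
  proof (rule summable_comparison_test')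
    show "summable (\<lambda>n. real n powr (- Re s))" using s by (simp add: summable_real_powr_iff)
    fix n :: nat
    have "norm (chi (int n)) \<le> 1" using chi_values[of "int n"] by auto
    moreover have "norm (of_nat n powr (- s)) = real n powr (- Re s)"
      by (cases "n = 0") (auto simp: norm_powr_real_powr)
    ultimately show "norm (norm (?f n)) \<le> real n powr (- Re s)"
      using mult_right_mono[of "norm (chi (int n))" 1 "real n powr (- Re s)"] by (simp add: norm_mult)
  qed
  have "summable (\<lambda>n. ?f (Suc n))" using summable_norm_cancel[OF n] by (subst summable_Suc_iff)
  hence "(\<lambda>n. ?f (Suc n)) sums L_entire s"
    unfolding D_dirichlet_series[OF s] dirichlet_series_def by (rule summable_sums)
  hence "?f sums (L_entire s + ?f 0)" by (rule sums_Suc_iff[THEN iffD1])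
  thus ?thesis by (intro norm_summable_imp_has_sum[OF n]) simp
qed

text \<open>For \<open>Re s > 1\<close>, sieving out the primes dividing N gives the finite Euler
  product; the right side is entire, so uniqueness of the continuation identifies the two functions
  everywhere.\<close>

lemma dirichlet_L_imprimitive:
  assumes N: "N > 0" and chi': "\<And>n. chi' n = (if coprime n (int N) then chi n else 0)"
  shows "dirichlet_L chi' = (\<lambda>s. L_entire s * (\<Prod>p\<in>prime_factors N. 1 - chi (int p) * of_nat p powr (- s)))"
proof (rule dirichlet_L_eqI)
  have "(\<lambda>s. L_entire s * (\<Prod>p\<in>prime_factors N. 1 - chi (int p) * of_nat p powr (- s))) holomorphic_on UNIV"
    by (intro holomorphic_intros L_entire_holomorphic)
  thus "(\<lambda>s. L_entire s * (\<Prod>p\<in>prime_factors N. 1 - chi (int p) * of_nat p powr (- s))) nicely_meromorphic_on UNIV"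
    by (rule analytic_on_imp_nicely_meromorphic_on[OF analytic_on_open[OF open_UNIV, THEN iffD2]])
  fix s :: complex assume s: "Re s > 1"
  define f where "f = (\<lambda>n. chi (int n) * of_nat n powr (- s))"
  have coprime: "coprime n N \<longleftrightarrow> \<not> (\<exists>p\<in>prime_factors N. p dvd n)" for n
  proof -
    have "coprime n N" if "\<not> (\<exists>p. prime p \<and> p dvd n \<and> p dvd N)"
    proof (rule ccontr)
      assume "\<not> coprime n N"
      hence "gcd n N \<noteq> 1" unfolding coprime_iff_gcd_eq_1 .
      then obtain p where "prime p" "p dvd gcd n N" using prime_factor_nat by blast
      thus False using that by (meson gcd_nat.boundedE)
    qed
    moreover have "\<not> coprime n N" if "prime p" "p dvd n" "p dvd N" for p
      using that by (meson coprime_common_divisor not_prime_unit)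
    moreover have "(\<exists>p\<in>prime_factors N. p dvd n) \<longleftrightarrow> (\<exists>p. prime p \<and> p dvd n \<and> p dvd N)"
      using N by (auto intro: prime_factorsI)
    ultimately show ?thesis by blast
  qed
  have "((\<lambda>n. if \<exists>p\<in>prime_factors N. p dvd n then 0 else f n) has_sum
       (L_entire s * (\<Prod>p\<in>prime_factors N. 1 - f p))) UNIV"
  proof (rule has_sum_remove_primes)
    show "f (m * n) = f m * f n" for m n by (simp add: f_def chi_mult powr_times_real)
    show "(f has_sum L_entire s) UNIV" unfolding f_def by (rule has_sum_dirichlet_series[OF s])
  qed auto
  also have "(\<lambda>n. if \<exists>p\<in>prime_factors N. p dvd n then 0 else f n) = (\<lambda>n. chi' (int n) * of_nat n powr (- s))"
    by (simp add: fun_eq_iff chi' coprime f_def)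
  finally have "(\<lambda>n. chi' (int n) * of_nat n powr (- s)) sums (L_entire s * (\<Prod>p\<in>prime_factors N. 1 - f p))"
    by (rule has_sum_imp_sums)
  hence "(\<lambda>n. chi' (int (Suc n)) * of_nat (Suc n) powr (- s)) sums (L_entire s * (\<Prod>p\<in>prime_factors N. 1 - f p))"
    by (subst sums_Suc_iff) simp
  thus "L_entire s * (\<Prod>p\<in>prime_factors N. 1 - chi (int p) * of_nat p powr (- s)) = dirichlet_series chi' s"
    unfolding dirichlet_series_def f_def by (rule sums_unique)
qed

end

theorem proposition1p11:
  fixes q :: nat and chi :: "int \<Rightarrow> complex" and \<beta> :: real
  assumes "q \<ge> 3"
    and "quadratic_character q chi"
    and "\<beta> > 0"
    and "dirichlet_L chi (complex_of_real \<beta>) = 0"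
  shows "\<beta> \<le> 1 - 40 / (sqrt (real q) * (ln (real q))\<^sup>2)"
proof -
  have q: "q > 0" using assms(1) by simp
  obtain r psi where r: "nontrivial_primitive_quadratic r psi" "r dvd q"
    and psi: "\<And>n. chi n = (if coprime n (int q) then psi n else 0)"
    using quadratic_character_induced[OF q assms(2)] by metis
  interpret nontrivial_primitive_quadratic r psi by (rule r)
  \<comment> \<open>For positive \<open>\<beta>\<close> each removed Euler factor is nonzero,
    because \<open>p powr (- \<beta>)\<close> has modulus below 1. A zero thus passes to the
    primitive character.\<close>
  have "1 - psi (int p) * of_nat p powr (- complex_of_real \<beta>) \<noteq> 0" if p: "p \<in> prime_factors q" for p
  proof
    assume "1 - psi (int p) * of_nat p powr (- complex_of_real \<beta>) = 0"
    hence "norm (psi (int p) * of_nat p powr (- complex_of_real \<beta>)) = 1" by simp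
    moreover have "norm (of_nat p powr (- complex_of_real \<beta>)) < 1"
    proof -
      have "real p > 1" using p prime_gt_1_nat by (auto simp: in_prime_factors_iff)
      moreover from this have "norm (of_nat p powr (- complex_of_real \<beta>)) = real p powr - \<beta>"
        by (simp add: norm_powr_real_powr)
      ultimately show ?thesis
        using gr_one_powr[of "real p" \<beta>] assms(3) by (simp add: powr_minus_divide)
    qed
    moreover have "norm (psi (int p)) \<le> 1" using chi_values[of "int p"] by auto
    ultimately show False
      using mult_right_mono[of "norm (psi (int p))" 1 "norm (of_nat p powr (- complex_of_real \<beta>))"]
      by (simp add: norm_mult)
  qed
  hence "L_entire (of_real \<beta>) = 0"
    using assms(4) unfolding dirichlet_L_imprimitive[OF q psi] by (auto simp: prod_zero_iff)
  hence "\<beta> \<le> 1 - 40 / (sqrt r * (ln r)\<^sup>2)" by (rule L_entire_zero_bound[OF assms(3)])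
  \<comment> \<open>The bound for the conductor r implies the one for q, because
    \<open>r \<le> q\<close> and the denominator increases with the modulus.\<close>
  also have "\<dots> \<le> 1 - 40 / (sqrt q * (ln q)\<^sup>2)"
  proof -
    have rq: "3 \<le> real r" "real r \<le> real q" using q_ge_3 dvd_imp_le[OF r(2) q] by simp_all
    hence "sqrt r * (ln r)\<^sup>2 \<le> sqrt q * (ln q)\<^sup>2" by (intro mult_mono power_mono) auto
    moreover have "sqrt r * (ln r)\<^sup>2 > 0" using rq by simp
    ultimately show ?thesis by (intro diff_left_mono divide_left_mono mult_pos_pos) (use rq in auto)
  qed
  finally show ?thesis .
qed

end
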